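(* Let $1\le p<\infty$. (i) $C_c^{\infty}(\mathbb{R}^+)$ is dense in $\mathcal{T}_p^{(\alpha)}(t^\alpha)$ for all $\alpha\ge 0$. (ii) For every $\alpha>0$, $\mathcal{T}_p^{(\alpha)}(t^\alpha)$ is a convolution Banach $\mathcal{T}_1^{(\alpha)}(t^\alpha)$-module; that is, there exists a constant $M_{\alpha,p}$ such that for every $g\in\mathcal{T}_1^{(\alpha)}(t^\alpha)$ and $f\in\mathcal{T}_p^{(\alpha)}(t^\alpha)$, $$g\ast f\in\mathcal{T}_p^{(\alpha)}(t^\alpha)\quad\text{with}\quad\|g\ast f\|_{p,(\alpha)}\le M_{\alpha,p}\|g\|_{1,(\alpha)}\|f\|_{p,(\alpha)}.$$ Moreover, $\mathcal{T}_1^{(\alpha)}(t^\alpha)\ast\mathcal{T}_p^{(\alpha)}(t^\alpha)$ is dense in $\mathcal{T}_p^{(\alpha)}(t^\alpha)$. (iii) For every $\alpha,\beta$ with $\beta>\alpha\ge 0$, there are continuous inclusions $$\mathcal{T}_p^{(\beta)}(t^\beta)\hookrightarrow\mathcal{T}_p^{(\alpha)}(t^\alpha)\hookrightarrow L_p(\mathbb{R}^+).$$ Furthermore, for every $f\in\mathcal{T}_p^{(\beta)}(t^\beta)$, $$W^\alpha f(t)=\frac{1}{\Gamma(\beta-\alpha)}\int_t^\infty(s-t)^{\beta-\alpha-1}W^\beta f(s)\,ds,\qquad t>0,$$ and, provided $\beta>\alpha+\frac1p$, there is a constant $C_{\alpha,\beta,p}>0$ (independent of $f$ and $t$) such that $$|W^\alpha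 f(t)|\le C_{\alpha,\beta,p}\,t^{-(\alpha+1/p)}\|f\|_{p,(\beta)},\qquad t>0.$$ (iv) For every $\alpha>0$, $$\mathcal{T}_p^{(\alpha)}(t^\alpha)=\{f\in L_p(\mathbb{R}^+):t^\alpha W^\alpha f\in L_p(\mathbb{R}^+)\}=\{f\in L_p(\mathbb{R}^+):t^\nu W^\nu f\in L_p(\mathbb{R}^+)\ \ \forall\,0\le\nu\le\alpha\},$$ and the following norms are equivalent on $\mathcal{T}_p^{(\alpha)}(t^\alpha)$: (1) $\|f\|_{p,(\alpha)}=\|t^\alpha W^\alpha f\|_{L_p(\mathbb{R}^+)}$; (2) $\sup_{0\le\nu\le\alpha}\|f\|_{p,(\nu)}=\sup_{0\le\nu\le\alpha}\|t^\nu W^\nu f\|_{L_p(\mathbb{R}^+)}$.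
   Context: $\mathbb{R}^+=(0,\infty)$, and $C_c^\infty(\mathbb{R}^+)$ is the space of $C^\infty$ functions with compact support in $(0,\infty)$. $L_p(\mathbb{R}^+,t^{\alpha p})$ is the space of measurable $g$ with $t\mapsto t^\alpha g(t)$ in $L_p(\mathbb{R}^+)$. Convolution is $(g\ast f)(t)=\int_0^t g(t-s)f(s)\,ds$, and $\mathcal{T}_1^{(\alpha)}(t^\alpha)\ast\mathcal{T}_p^{(\alpha)}(t^\alpha)$ is the set of all such convolutions. For $1\le p<\infty$ and $\alpha>0$, the operator $\mathcal{C}_\alpha^*f(s)=\alpha\int_s^\infty\frac{(u-s)^{\alpha-1}}{u^\alpha}f(u)\,du$ is bounded and injective on $L_p(\mathbb{R}^+)$. The space $\mathcal{T}_p^{(\alpha)}(t^\alpha):=\mathcal{C}_\alpha^*(L_p(\mathbb{R}^+))$ carries the norm $\|f\|_{p,(\alpha)}:=\Gamma(\alpha+1)\|(\mathcal{C}_\alpha^* )^{-1}f\|_{L_p(\mathbb{R}^+)}$. For $f\in\mathcal{T}_p^{(\alpha)}(t^\alpha)$ set $W^\alpha f(t):=\Gamma(\alpha+1)t^{-\alpha}[(\mathcal{C}_\alpha^* )^{-1}f](t)$. Equivalently, $\mathcal{T}_p^{(\alpha)}(t^\alpha)$ consists of the $f\in L_p(\mathbb{R}^+)$ for which there exists a (unique) element $W^\alpha f\in L_p(\mathbb{R}^+,t^{\alpha p})$ with $f(t)=\frac{1}{\Gamma(\alpha)}\int_t^\infty(s-t)^{\alpha-1}W^\alpha f(s)\,ds$,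 and $\|f\|_{p,(\alpha)}=\left(\int_0^\infty|t^\alpha W^\alpha f(t)|^p\,dt\right)^{1/p}$; for $f\in L_p(\mathbb{R}^+)$ the condition "$t^\nu W^\nu f\in L_p(\mathbb{R}^+)$" means that such an element $W^\nu f$ exists. For $\alpha=0$: $\mathcal{T}_p^{(0)}(t^0)=L_p(\mathbb{R}^+)$ and $W^0=\mathrm{Id}$. Elements of $L_p$-type spaces are identified almost everywhere; in the pointwise bound of (iii), $W^\alpha f(t)$ denotes the value given by the displayed integral formula, which converges for every $t>0$ when $\beta>\alpha+1/p$. *)

theory Defs
  imports "HOL-Analysis.Analysis"
begin

section \<open>Lebesgue spaces on the positive half-line\<close>

text \<open>
  Elements of the function spaces are represented by functions \<open>real \<Rightarrow> complex\<close>; only their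
  values on \<open>{0<..}\<close> matter. Spaces are sets of representatives closed under equality almost
  everywhere, so what would be a norm on equivalence classes is a seminorm on representatives.
\<close>

abbreviation Rpos :: "real measure" where
  "Rpos \<equiv> lebesgue_on {0<..}"

definition Lp :: "real \<Rightarrow> (real \<Rightarrow> complex) set" where
  "Lp p = {f \<in> borel_measurable Rpos. integrable Rpos (\<lambda>t. norm (f t) powr p)}"

definition Lp_norm :: "real \<Rightarrow> (real \<Rightarrow> complex) \<Rightarrow> real" where
  "Lp_norm p f = (LINT t|Rpos. norm (f t) powr p) powr (1 / p)"

text \<open>The weighted space \<open>L\<^sub>p(\<real>\<^sup>+, t\<^bsup>\<alpha>p\<^esup>)\<close>.\<close>

definition Lp_weighted :: "real \<Rightarrow> real \<Rightarrow> (real \<Rightarrow> complex) set" where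
  "Lp_weighted p \<alpha> = {g \<in> borel_measurable Rpos. (\<lambda>t. t powr \<alpha> *\<^sub>R g t) \<in> Lp p}"

text \<open>
  Convolution on the half-line. Only values of \<open>g\<close> and \<open>f\<close> on \<open>{0<..}\<close> enter; as for the other
  integral operators below, the value is 0 by convention where the integral does not converge.
\<close>

definition conv :: "(real \<Rightarrow> complex) \<Rightarrow> (real \<Rightarrow> complex) \<Rightarrow> real \<Rightarrow> complex" where
  "conv g f t = (LINT s:{0<..<t}|lebesgue. g (t - s) * f s)"

text \<open>
  Iterated derivatives at \<open>t > 0\<close> depend only on the function near \<open>t\<close>, hence smoothness and the
  support condition only concern the restriction to \<open>{0<..}\<close>.
\<close>

definition Cc_smooth :: "(real \<Rightarrow> complex) set" where
  "Cc_smooth = {\<phi>.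
     (\<forall>n. \<forall>t>0. ((\<lambda>f x. vector_derivative f (at x)) ^^ n) \<phi> differentiable (at t)) \<and>
     (\<exists>K. compact K \<and> K \<subseteq> {0<..} \<and> (\<forall>t\<in>{0<..} - K. \<phi> t = 0))}"


section \<open>The spaces \<open>T\<^sub>p\<^bsup>(\<alpha>)\<^esup>(t\<^bsup>\<alpha>\<^esup>)\<close>\<close>

definition cesaro_adj :: "real \<Rightarrow> (real \<Rightarrow> complex) \<Rightarrow> real \<Rightarrow> complex" where
  "cesaro_adj \<alpha> f s =
     \<alpha> *\<^sub>R (LINT u:{s<..}|lebesgue. ((u - s) powr (\<alpha> - 1) / u powr \<alpha>) *\<^sub>R f u)"

text \<open>
  The inverse of \<open>cesaro_adj \<alpha>\<close> on \<open>Lp p\<close>; since the operator is injective on classes, the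
  chosen representative is determined almost everywhere.
\<close>

definition cesaro_adj_inv :: "real \<Rightarrow> real \<Rightarrow> (real \<Rightarrow> complex) \<Rightarrow> real \<Rightarrow> complex" where
  "cesaro_adj_inv p \<alpha> f = (SOME g. g \<in> Lp p \<and> (AE t in Rpos. f t = cesaro_adj \<alpha> g t))"

definition T_space :: "real \<Rightarrow> real \<Rightarrow> (real \<Rightarrow> complex) set" where
  "T_space p \<alpha> =
     (if \<alpha> = 0 then Lp p else {f. \<exists>g\<in>Lp p. AE t in Rpos. f t = cesaro_adj \<alpha> g t})"

definition T_norm :: "real \<Rightarrow> real \<Rightarrow> (real \<Rightarrow> complex) \<Rightarrow> real" where
  "T_norm p \<alpha> f =
     (if \<alpha> = 0 then Lp_norm p f else Gamma (\<alpha> + 1) * Lp_norm p (cesaro_adj_inv p \<alpha> f))"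

text \<open>
  The derivative \<open>W\<^bsup>\<alpha>\<^esup>\<close> on \<open>T_space p \<alpha>\<close>. It carries \<open>p\<close> as an argument because it is
  defined through the inverse on \<open>Lp p\<close>.
\<close>

definition W :: "real \<Rightarrow> real \<Rightarrow> (real \<Rightarrow> complex) \<Rightarrow> real \<Rightarrow> complex" where
  "W p \<alpha> f t =
     (if \<alpha> = 0 then f t else (Gamma (\<alpha> + 1) * t powr (- \<alpha>)) *\<^sub>R cesaro_adj_inv p \<alpha> f t)"

definition weyl_integrand :: "real \<Rightarrow> (real \<Rightarrow> complex) \<Rightarrow> real \<Rightarrow> real \<Rightarrow> complex" where
  "weyl_integrand \<nu> h t s = (s - t) powr (\<nu> - 1) *\<^sub>R h s"

definition weyl_integral :: "real \<Rightarrow> (real \<Rightarrow> complex) \<Rightarrow> real \<Rightarrow> complex" where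
  "weyl_integral \<nu> h t = (1 / Gamma \<nu>) *\<^sub>R (LINT s:{t<..}|lebesgue. weyl_integrand \<nu> h t s)"

text \<open>
  For \<open>f \<in> Lp p\<close>, the condition \<open>t\<^bsup>\<nu>\<^esup> W\<^bsup>\<nu>\<^esup> f \<in> L\<^sub>p(\<real>\<^sup>+)\<close>: some element of the weighted
  space serves as \<open>W\<^bsup>\<nu>\<^esup> f\<close>, with \<open>W\<^bsup>0\<^esup>\<close> the identity. It does not refer to
  \<open>cesaro_adj\<close> or \<open>W\<close>.
\<close>

definition has_W_in_Lp :: "real \<Rightarrow> real \<Rightarrow> (real \<Rightarrow> complex) \<Rightarrow> bool" where
  "has_W_in_Lp p \<nu> f \<longleftrightarrow>
     (\<exists>h\<in>Lp_weighted p \<nu>. AE t in Rpos. f t = (if \<nu> = 0 then h t else weyl_integral \<nu> h t))"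

definition T_dense :: "real \<Rightarrow> real \<Rightarrow> (real \<Rightarrow> complex) set \<Rightarrow> bool" where
  "T_dense p \<alpha> D \<longleftrightarrow> D \<subseteq> T_space p \<alpha> \<and>
     (\<forall>f\<in>T_space p \<alpha>. \<forall>\<epsilon>>0. \<exists>d\<in>D. T_norm p \<alpha> (\<lambda>t. f t - d t) < \<epsilon>)"

text \<open>Continuity of a (linear) inclusion of seminormed spaces is boundedness.\<close>

definition continuous_inclusion ::
  "(real \<Rightarrow> complex) set \<Rightarrow> ((real \<Rightarrow> complex) \<Rightarrow> real) \<Rightarrow>
   (real \<Rightarrow> complex) set \<Rightarrow> ((real \<Rightarrow> complex) \<Rightarrow> real) \<Rightarrow> bool" where
  "continuous_inclusion X nX Y nY \<longleftrightarrow> X \<subseteq> Y \<and> (\<exists>C. \<forall>f\<in>X. nY f \<le> C * nX f)"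

end

theory Submission
  imports Defs
begin

text \<open>
  Put \<open>F(t) = t\<^sup>\<alpha> W\<^sup>\<alpha> f(t)\<close>, so that \<open>f\<close> is the Weyl integral of \<open>t\<^sup>-\<^sup>\<alpha> F\<close> and \<open>f \<mapsto> F\<close> identifies
  \<open>T\<^sub>p\<^bsup>(\<alpha>)\<^esup>\<close> with \<open>L\<^sub>p\<close>. In this picture the inclusion of \<open>T\<^sub>p\<^bsup>(\<beta>)\<^esup>\<close> into \<open>T\<^sub>p\<^bsup>(\<alpha>)\<^esup>\<close> is an integral
  operator with a kernel that is homogeneous of degree \<open>-1\<close>, bounded by a Schur test with weight
  \<open>t\<^bsup>-1/p\<^esup>\<close>; its norm is at most \<open>\<Gamma>(\<alpha> + 1/p) / \<Gamma>(\<beta> + 1/p)\<close>, which stays bounded for \<open>\<alpha>\<close> in \<open>[0, \<beta>]\<close>.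
  The Weyl integral is injective because testing it against \<open>t\<^bsup>-\<alpha>-1\<^esup> e\<^bsup>-c/t\<^esup>\<close> turns it into a Laplace
  transform in \<open>1/s\<close>.

  Density of the test functions: elements whose \<open>W\<^sup>\<alpha> f\<close> is a test function are dense; they are smooth
  on the whole line and vanish for large \<open>t\<close>, and cutting them off near \<open>0\<close> costs little in the norm of some
  integer order \<open>n > \<alpha>\<close>, which dominates the norm of order \<open>\<alpha>\<close>.

  For convolutions, the convolution of the Riesz kernels \<open>R\<^sub>r(x) = (r - x)\<^sub>+\<^bsup>\<alpha>-1\<^esup> / \<Gamma>(\<alpha>)\<close> and \<open>R\<^sub>t\<close> is a
  superposition of kernels \<open>R\<^sub>s\<close> with density \<open>\<plusminus>(r + t - s)\<^bsup>\<alpha>-1\<^esup> / \<Gamma>(\<alpha>)\<close>, positive on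
  \<open>max r t < s < r + t\<close> and negative on \<open>s < min r t\<close>. This gives a formula for \<open>W\<^sup>\<alpha>(g * f)\<close>, and
  Schur tests uniform in \<open>r\<close> together with Jensen's inequality give the norm estimate.
\<close>

section \<open>Powers of extended reals and the Schur test\<close>

text \<open>Elements of the spaces are classes modulo null sets, and \<open>W\<close> rests on an
  arbitrary choice of preimage under \<open>cesaro_adj\<close>. Arguments therefore run through the
  relation \<open>T_rep p \<alpha> f u\<close> with a Borel function \<open>u\<close>; injectivity
  makes \<open>u\<close> unique almost everywhere, so that norm and derivative can be read off from
  any such \<open>u\<close>. The weight t^(-1/p) is the power at the border of \<open>L_p\<close>: a
  kernel of degree -1 multiplies it by a constant, a quotient of Gamma values, and the same constant
  serves for the transposed kernel. Fractional derivatives are not local and have no finite product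
  rule. This is why cut-offs and mollifications are estimated at an integer order, where derivatives
  are ordinary ones up to sign. The Weyl integral looks to the right and the half-line convolution
  to the left, so \<open>W\<close> cannot simply be moved onto one factor: for order 1 a boundary
  term g(0) f appears. The negative part of the kernel stems from that. If both factors are test
  functions, the convolution is one over the whole line, and there the derivative does pass to one
  factor.\<close>

text \<open>
  Only meaningful for \<open>p > 0\<close>: the values at \<open>0\<close> and \<open>top\<close> do not depend on \<open>p\<close>.
\<close>

definition epow :: "real \<Rightarrow> ennreal \<Rightarrow> ennreal" where
  "epow p x = (if x = top then top else ennreal (enn2real x powr p))"

lemma epow_ennreal [simp]: "0 \<le> x \<Longrightarrow> epow p (ennreal x) = ennreal (x powr p)"
  by (simp add: epow_def)

lemma epow_top [simp]: "epow p top = top"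
  by (simp add: epow_def)

lemma epow_0 [simp]: "epow p 0 = 0"
  by (simp add: epow_def)

lemma epow_eq_top_iff [simp]: "epow p x = top \<longleftrightarrow> x = top"
  by (simp add: epow_def)

lemma epow_mono:
  assumes "0 \<le> p" "x \<le> y" shows "epow p x \<le> epow p y"
proof (cases "y = top")
  case False
  then have "x \<noteq> top" using assms(2) by (auto simp: top_unique)
  with False assms show ?thesis
    by (auto simp: epow_def intro!: ennreal_leI powr_mono2 enn2real_mono simp: less_top)
qed simp

lemma measurable_epow [measurable]: "epow p \<in> borel_measurable borel"
  unfolding epow_def[abs_def] by measurable

lemma epow_mult:
  assumes "0 \<le> c" "0 < p" shows "epow p (ennreal c * x) = ennreal (c powr p) * epow p x"
proof (cases "c = 0")
  case False
  then have "0 < c" using assms by simp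
  show ?thesis
  proof (cases x)
    case (real r)
    then show ?thesis using assms
      by (simp add: ennreal_mult'[symmetric] powr_mult)
  next
    case top
    then show ?thesis using \<open>0 < c\<close> by (simp add: ennreal_mult_top)
  qed
qed simp

lemma epow_mult_right:
  assumes "0 \<le> c" "0 < p" shows "epow p (x * ennreal c) = epow p x * ennreal (c powr p)"
  using epow_mult[OF assms, of x] by (simp add: mult.commute)

text \<open>A crude substitute for the triangle inequality of \<open>L_p\<close>: the sum is at most
  twice the maximum. The factor \<open>2 powr p\<close> is affordable because only finiteness,
  smallness and the existence of constants are at stake.\<close>

lemma epow_add:
  assumes "0 < p" shows "epow p (x + y) \<le> ennreal (2 powr p) * (epow p x + epow p y)"
proof -
  have "x + y \<le> ennreal 2 * max x y"
    by (simp add: max_def mult_2 add_mono)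
  then have "epow p (x + y) \<le> epow p (ennreal 2 * max x y)"
    using assms by (intro epow_mono) auto
  also have "\<dots> = ennreal (2 powr p) * epow p (max x y)"
    using assms by (intro epow_mult) auto
  also have "epow p (max x y) \<le> epow p x + epow p y"
    by (simp add: max_def)
  finally show ?thesis by (simp add: mult_left_mono)
qed

text \<open>On a set of finite measure this turns a finite integral of \<open>epow p\<close> into a
  finite integral of the function itself.\<close>

lemma le_1_add_epow: assumes "1 \<le> p" shows "x \<le> 1 + epow p x"
proof (cases x)
  case (real r)
  have "r \<le> 1 + r powr p"
  proof (cases "r \<le> 1")
    case False
    then have "r powr 1 \<le> r powr p" using assms by (intro powr_mono) auto
    with False show ?thesis by simp
  qed (use powr_ge_zero[of r p] in linarith)
  then have "ennreal r \<le> ennreal (1 + r powr p)" by (rule ennreal_leI)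
  then show ?thesis using real by simp
qed simp

text \<open>The tangent of the convex function \<open>x powr p\<close> at the point
  \<open>c\<close>, solved for \<open>x\<close>. No conjugate exponent occurs, so
  \<open>p = 1\<close> is an ordinary case.\<close>

lemma young_tangent:
  fixes x c p :: real
  assumes "1 \<le> p" "0 < c" "0 \<le> x"
  shows "x \<le> (1 - 1/p) * c + (1/p) * c powr (1 - p) * x powr p"
proof (cases "x = 0")
  case True
  then show ?thesis using assms by (simp add: mult_nonneg_nonneg)
next
  case False
  then have x: "0 < x" using assms by simp
  have "c powr (1 - 1/p) * (c powr (1 - p) * x powr p) powr (1/p)
        \<le> (1 - 1/p) * c + (1/p) * (c powr (1 - p) * x powr p)"
    using assms x by (intro Youngs_inequality_0) (auto simp: field_simps)
  also have "c powr (1 - 1/p) * (c powr (1 - p) * x powr p) powr (1/p) = x"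
    using assms x by (simp add: powr_mult powr_powr mult.assoc[symmetric] powr_add[symmetric])
      (simp add: diff_divide_distrib)
  finally show ?thesis by (simp add: mult.assoc)
qed

lemma ennreal_young_tangent:
  assumes "1 \<le> p" "0 < c"
  shows "F \<le> ennreal ((1 - 1/p) * c) + ennreal ((1/p) * c powr (1 - p)) * epow p F"
proof (cases F)
  case (real r)
  have "0 \<le> (1 - 1/p) * c" using assms by simp
  then show ?thesis using real young_tangent[OF assms, of r] assms
    by (simp add: ennreal_mult'[symmetric] ennreal_plus[symmetric] del: ennreal_plus)
next
  case top
  then show ?thesis using assms by (simp add: ennreal_mult_top)
qed

text \<open>The tangent inequality is integrated first, and its contact point \<open>c\<close> is
  chosen afterwards. \<open>A\<close> only has to bound the total mass.\<close>

lemma nn_integral_jensen: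
  assumes p: "1 \<le> p" and A: "0 < A" "(\<integral>\<^sup>+x. m x \<partial>M) \<le> ennreal A"
    and [measurable]: "m \<in> borel_measurable M" "F \<in> borel_measurable M"
  shows "epow p (\<integral>\<^sup>+x. m x * F x \<partial>M) \<le> ennreal (A powr (p - 1)) * (\<integral>\<^sup>+x. m x * epow p (F x) \<partial>M)"
proof (cases "(\<integral>\<^sup>+x. m x * epow p (F x) \<partial>M)")
  case top
  then show ?thesis using A by (simp add: ennreal_mult_top)
next
  case (real Y)
  \<comment> \<open>\<open>Y\<close> is replaced by an arbitrary positive upper bound
    \<open>Z\<close>, since \<open>Y = 0\<close> would force \<open>c = 0\<close>; the slack is
    removed at the end by letting \<open>Z\<close> tend to \<open>Y\<close>.\<close>
  have *: "(\<integral>\<^sup>+x. m x * F x \<partial>M) \<le> ennreal (A powr (1 - 1/p) * Z powr (1/p))" if Z: "0 < Z" "Y \<le> Z" for Z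
  proof -
    \<comment> \<open>The optimal contact point: both \<open>c * A\<close> and
      \<open>c powr (1 - p) * Z\<close> become
      \<open>A powr (1 - 1/p) * Z powr (1/p)\<close>.\<close>
    define c where "c = (Z / A) powr (1 / p)"
    have c: "0 < c" using Z A by (simp add: c_def)
    have "(\<integral>\<^sup>+x. m x * F x \<partial>M) \<le>
       (\<integral>\<^sup>+x. m x * (ennreal ((1 - 1/p) * c) + ennreal ((1/p) * c powr (1 - p)) * epow p (F x)) \<partial>M)"
      by (intro nn_integral_mono mult_left_mono ennreal_young_tangent p c) auto
    also have "\<dots> = (\<integral>\<^sup>+x. ennreal ((1 - 1/p) * c) * m x + ennreal ((1/p) * c powr (1 - p)) * (m x * epow p (F x)) \<partial>M)"
      by (intro nn_integral_cong) (simp add: algebra_simps)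
    also have "\<dots> = ennreal ((1 - 1/p) * c) * (\<integral>\<^sup>+x. m x \<partial>M) + ennreal ((1/p) * c powr (1 - p)) * ennreal Y"
      by (simp add: nn_integral_add nn_integral_cmult real)
    also have "\<dots> \<le> ennreal ((1 - 1/p) * c) * ennreal A + ennreal ((1/p) * c powr (1 - p)) * ennreal Z"
      using Z by (intro add_mono mult_left_mono A ennreal_leI) auto
    also have "\<dots> = ennreal ((1 - 1/p) * c * A + (1/p) * c powr (1 - p) * Z)"
      using p c A Z by (simp add: ennreal_mult'[symmetric] ennreal_plus[symmetric] del: ennreal_plus)
    also have "(1 - 1/p) * c * A + (1/p) * c powr (1 - p) * Z = A powr (1 - 1/p) * Z powr (1/p)"
    proof -
      have 1: "c * A = A powr (1 - 1/p) * Z powr (1/p)"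
        using A Z by (simp add: c_def powr_divide powr_diff)
      have "c powr (1 - p) * Z = Z powr ((1 - p) / p) * Z / A powr ((1 - p) / p)"
        using A Z by (simp add: c_def powr_divide powr_powr)
      also have "\<dots> = Z powr ((1 - p) / p + 1) * A powr (- ((1 - p) / p))"
        using A Z by (simp add: powr_add powr_minus divide_inverse)
      also have "(1 - p) / p + 1 = 1/p"
        using p by (simp add: field_simps)
      also have "- ((1 - p) / p) = 1 - 1/p"
        using p by (simp add: field_simps)
      finally have 2: "c powr (1 - p) * Z = A powr (1 - 1/p) * Z powr (1/p)" by (simp add: mult.commute)
      show ?thesis using 1 2 by (simp add: mult.assoc) (simp add: algebra_simps)
    qed
    finally show ?thesis .
  qed
  have **: "epow p (\<integral>\<^sup>+x. m x * F x \<partial>M) \<le> ennreal (A powr (p - 1) * Z)" if Z: "0 < Z" "Y \<le> Z" for Z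
  proof -
    have "epow p (\<integral>\<^sup>+x. m x * F x \<partial>M) \<le> epow p (ennreal (A powr (1 - 1/p) * Z powr (1/p)))"
      using *[OF Z] p by (intro epow_mono) auto
    also have "\<dots> = ennreal (A powr (p - 1) * Z)"
      using p A Z by (simp add: powr_mult powr_powr algebra_simps)
    finally show ?thesis .
  qed
  have "epow p (\<integral>\<^sup>+x. m x * F x \<partial>M) \<le> ennreal (A powr (p - 1) * Y) + ennreal e" if e: "0 < e" for e
  proof -
    have "epow p (\<integral>\<^sup>+x. m x * F x \<partial>M) \<le> ennreal (A powr (p - 1) * (Y + e / A powr (p - 1)))"
      using A e real by (intro **) (auto intro: add_nonneg_pos)
    also have "A powr (p - 1) * (Y + e / A powr (p - 1)) = A powr (p - 1) * Y + e"
      using A by (simp add: field_simps)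
    finally show ?thesis using e real by (simp add: ennreal_plus)
  qed
  then have "epow p (\<integral>\<^sup>+x. m x * F x \<partial>M) \<le> ennreal (A powr (p - 1) * Y)"
    by (rule ennreal_le_epsilon)
  then show ?thesis using real by (simp add: ennreal_mult')
qed

text \<open>
  Jensen's inequality is applied to \<open>F / w\<close> and the measure \<open>K(s,t) w(t) dt\<close>, so that \<open>p = 1\<close> needs no
  separate treatment.
\<close>

lemma schur_test:
  fixes K :: "real \<Rightarrow> real \<Rightarrow> ennreal" and v w :: "real \<Rightarrow> real"
  assumes p: "1 \<le> p" and A: "0 < A" and B: "0 \<le> B"
    and K [measurable]: "(\<lambda>(s, t). K s t) \<in> borel_measurable (lborel \<Otimes>\<^sub>M lborel)"
    and [measurable]: "v \<in> borel_measurable borel" "w \<in> borel_measurable borel"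
    and F [measurable]: "F \<in> borel_measurable borel"
    and pos: "\<And>s t. K s t \<noteq> 0 \<Longrightarrow> 0 < v s \<and> 0 < w t"
    and 1: "\<And>s. 0 < v s \<Longrightarrow> (\<integral>\<^sup>+t. K s t * ennreal (w t) \<partial>lborel) \<le> ennreal (A * v s)"
    and 2: "\<And>t. 0 < w t \<Longrightarrow> (\<integral>\<^sup>+s. K s t * ennreal (v s powr (p - 1)) \<partial>lborel) \<le> ennreal (B * w t powr (p - 1))"
  shows "(\<integral>\<^sup>+s. epow p (\<integral>\<^sup>+t. K s t * F t \<partial>lborel) \<partial>lborel)
     \<le> ennreal (A powr (p - 1) * B) * (\<integral>\<^sup>+t. epow p (F t) \<partial>lborel)"
proof -
  have pw: "epow p (\<integral>\<^sup>+t. K s t * F t \<partial>lborel) \<le>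
     ennreal (A powr (p - 1)) * (\<integral>\<^sup>+t. K s t * ennreal (v s powr (p - 1)) * (ennreal (w t powr (1 - p)) * epow p (F t)) \<partial>lborel)" for s
  proof (cases "0 < v s")
    case False
    then have "K s t = 0" for t using pos by blast
    then show ?thesis by simp
  next
    case True
    have [measurable]: "(\<lambda>t. K s t) \<in> borel_measurable borel"
      using measurable_compose[OF measurable_Pair1'[of s lborel lborel] K] by simp
    have "(\<integral>\<^sup>+t. K s t * F t \<partial>lborel) = (\<integral>\<^sup>+t. (K s t * ennreal (w t)) * (F t * ennreal (1 / w t)) \<partial>lborel)"
    \<comment> \<open>Where the kernel does not vanish, \<open>pos\<close> makes the weight
      positive, so that \<open>w t * (1 / w t)\<close> is 1.\<close>
    proof (intro nn_integral_cong)
      fix t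
      show "K s t * F t = (K s t * ennreal (w t)) * (F t * ennreal (1 / w t))"
      proof (cases "K s t = 0")
        case False
        then have "0 < w t" using pos by blast
        then have "ennreal (w t) * ennreal (1 / w t) = 1"
          by (simp add: ennreal_mult'[symmetric])
        then show ?thesis
          by (metis (no_types, lifting) mult.assoc mult.commute mult.right_neutral)
      qed simp
    qed
    also have "epow p \<dots> \<le> ennreal ((A * v s) powr (p - 1)) *
       (\<integral>\<^sup>+t. (K s t * ennreal (w t)) * epow p (F t * ennreal (1 / w t)) \<partial>lborel)"
      using A True by (intro nn_integral_jensen p 1) auto
    also have "(\<integral>\<^sup>+t. (K s t * ennreal (w t)) * epow p (F t * ennreal (1 / w t)) \<partial>lborel)
       = (\<integral>\<^sup>+t. K s t * (ennreal (w t powr (1 - p)) * epow p (F t)) \<partial>lborel)"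
    proof (intro nn_integral_cong)
      fix t
      show "(K s t * ennreal (w t)) * epow p (F t * ennreal (1 / w t)) =
         K s t * (ennreal (w t powr (1 - p)) * epow p (F t))"
      proof (cases "K s t = 0")
        case False
        then have w: "0 < w t" using pos by blast
        then have "ennreal (w t) * epow p (F t * ennreal (1 / w t)) = ennreal (w t * (1 / w t) powr p) * epow p (F t)"
          using p by (simp add: epow_mult_right ennreal_mult' mult_ac)
        also have "w t * (1 / w t) powr p = w t powr (1 - p)"
          using w by (simp add: powr_divide powr_diff)
        finally show ?thesis by (simp add: mult.assoc)
      qed simp
    qed
    also have "ennreal ((A * v s) powr (p - 1)) * \<dots> =
      ennreal (A powr (p - 1)) * (\<integral>\<^sup>+t. K s t * ennreal (v s powr (p - 1)) * (ennreal (w t powr (1 - p)) * epow p (F t)) \<partial>lborel)"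
      using A True by (simp add: powr_mult ennreal_mult' nn_integral_cmult[symmetric] mult_ac)
    finally show ?thesis .
  qed
  have "(\<integral>\<^sup>+s. epow p (\<integral>\<^sup>+t. K s t * F t \<partial>lborel) \<partial>lborel) \<le>
    (\<integral>\<^sup>+s. ennreal (A powr (p - 1)) * (\<integral>\<^sup>+t. K s t * ennreal (v s powr (p - 1)) * (ennreal (w t powr (1 - p)) * epow p (F t)) \<partial>lborel) \<partial>lborel)"
    by (intro nn_integral_mono pw)
  also have "\<dots> = ennreal (A powr (p - 1)) * (\<integral>\<^sup>+s. (\<integral>\<^sup>+t. K s t * ennreal (v s powr (p - 1)) * (ennreal (w t powr (1 - p)) * epow p (F t)) \<partial>lborel) \<partial>lborel)"
    by (intro nn_integral_cmult) measurable
  also have "(\<integral>\<^sup>+s. (\<integral>\<^sup>+t. K s t * ennreal (v s powr (p - 1)) * (ennreal (w t powr (1 - p)) * epow p (F t)) \<partial>lborel) \<partial>lborel)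
    = (\<integral>\<^sup>+t. (\<integral>\<^sup>+s. K s t * ennreal (v s powr (p - 1)) * (ennreal (w t powr (1 - p)) * epow p (F t)) \<partial>lborel) \<partial>lborel)"
    by (rule lborel_pair.Fubini'[symmetric]) measurable
  also have "\<dots> \<le> (\<integral>\<^sup>+t. ennreal B * epow p (F t) \<partial>lborel)"
  proof (intro nn_integral_mono)
    fix t
    have [measurable]: "(\<lambda>s. K s t) \<in> borel_measurable borel"
      using measurable_compose[OF measurable_Pair2'[of t lborel lborel] K] by simp
    show "(\<integral>\<^sup>+s. K s t * ennreal (v s powr (p - 1)) * (ennreal (w t powr (1 - p)) * epow p (F t)) \<partial>lborel)
       \<le> ennreal B * epow p (F t)"
    proof (cases "0 < w t")
      case False
      then have "K s t = 0" for s using pos by blast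
      then show ?thesis by simp
    next
      case True
      have "(\<integral>\<^sup>+s. K s t * ennreal (v s powr (p - 1)) * (ennreal (w t powr (1 - p)) * epow p (F t)) \<partial>lborel)
        = (\<integral>\<^sup>+s. K s t * ennreal (v s powr (p - 1)) \<partial>lborel) * (ennreal (w t powr (1 - p)) * epow p (F t))"
        by (intro nn_integral_multc) measurable
      also have "\<dots> \<le> ennreal (B * w t powr (p - 1)) * (ennreal (w t powr (1 - p)) * epow p (F t))"
        by (intro mult_right_mono 2 True) auto
      also have "\<dots> = ennreal (B * (w t powr (p - 1) * w t powr (1 - p))) * epow p (F t)"
        using B by (simp add: ennreal_mult' mult_ac)
      also have "w t powr (p - 1) * w t powr (1 - p) = 1"
        using True by (simp add: powr_add[symmetric])
      finally show ?thesis by simp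
    qed
  qed
  also have "\<dots> = ennreal B * (\<integral>\<^sup>+t. epow p (F t) \<partial>lborel)"
    by (intro nn_integral_cmult) measurable
  finally show ?thesis using A B by (simp add: ennreal_mult' mult.assoc mult_left_mono)
qed

section \<open>Beta integrals and Weyl integrals\<close>

lemma gamma_nn_scaled:
  assumes "0 < b" "0 < (c::real)"
  shows "(\<integral>\<^sup>+x. ennreal (indicator {0<..} x * x powr (b - 1) * exp (- (c * x))) \<partial>lborel) = ennreal (Gamma b * c powr (- b))"
proof -
  let ?I = "\<integral>\<^sup>+x. ennreal (indicator {0<..} x * x powr (b - 1) * exp (- (c * x))) \<partial>lborel"
  have "ennreal (Gamma b) = (\<integral>\<^sup>+t. ennreal (indicator {0..} t * t powr (b - 1) / exp t) \<partial>lborel)"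
    using Gamma_conv_nn_integral_real[OF assms(1)] by simp
  also have "\<dots> = ennreal \<bar>c\<bar> * (\<integral>\<^sup>+x. ennreal (indicator {0..} (0 + c * x) * (0 + c * x) powr (b - 1) / exp (0 + c * x)) \<partial>lborel)"
    using assms by (subst nn_integral_real_affine[where c=c and t=0]) auto
  also have "\<dots> = ennreal c * (\<integral>\<^sup>+x. ennreal (c powr (b - 1)) * ennreal (indicator {0<..} x * x powr (b - 1) * exp (- (c * x))) \<partial>lborel)"
  proof -
    have "ennreal (indicator {0..} (0 + c * x) * (0 + c * x) powr (b - 1) / exp (0 + c * x)) =
       ennreal (c powr (b - 1)) * ennreal (indicator {0<..} x * x powr (b - 1) * exp (- (c * x)))" for x
      using assms by (auto simp: indicator_def ennreal_mult'[symmetric] zero_le_mult_iff powr_mult exp_minus field_simps)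
    then show ?thesis using assms by simp
  qed
  also have "\<dots> = ennreal c * (ennreal (c powr (b - 1)) * ?I)"
    by (subst nn_integral_cmult) simp_all
  also have "\<dots> = ennreal (c * c powr (b - 1)) * ?I"
    using assms by (subst mult.assoc[symmetric], subst ennreal_mult'[symmetric]) auto
  also have "c * c powr (b - 1) = c powr b"
    using assms by (simp add: powr_diff)
  finally have *: "ennreal (c powr b) * ?I = ennreal (Gamma b)" by simp
  have "?I
     = ennreal (c powr (- b)) * (ennreal (c powr b) * ?I)"
    using assms by (simp add: mult.assoc[symmetric] ennreal_mult'[symmetric] powr_add[symmetric])
  also have "\<dots> = ennreal (Gamma b * c powr (- b))"
    unfolding * by (subst ennreal_mult'[symmetric]) (simp_all add: mult.commute)
  finally show ?thesis .
qed

text \<open>In the notation of the overview this is the Riesz kernel \<open>R_s(t)\<close> of order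
  \<open>a\<close>. The division by \<open>Gamma a\<close> makes orders add under
  composition.\<close>

definition wker :: "real \<Rightarrow> real \<Rightarrow> real \<Rightarrow> real" where
  "wker a t s = (if t < s then (s - t) powr (a - 1) / Gamma a else 0)"

lemma wker_nonneg [simp]: "0 < a \<Longrightarrow> 0 \<le> wker a t s"
  by (simp add: wker_def Gamma_real_nonneg)

lemma measurable_wker [measurable]:
  assumes "f \<in> borel_measurable M" "g \<in> borel_measurable M"
  shows "(\<lambda>x. wker a (f x) (g x)) \<in> borel_measurable M"
  using assms unfolding wker_def by measurable

text \<open>The affine substitution that carries \<open>{t<..<s}\<close> to the unit interval leads
  to the Beta integral, which the normalisation of \<open>wker\<close> absorbs.\<close>

lemma wker_convolution:
  assumes ab: "0 < a" "0 < b"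
  shows "(\<integral>\<^sup>+x. ennreal (wker a t x) * ennreal (wker b x s) \<partial>lborel) = ennreal (wker (a + b) t s)"
proof (cases "t < s")
  case False
  then have "wker a t x = 0 \<or> wker b x s = 0" for x by (auto simp: wker_def)
  then have z: "ennreal (wker a t x) * ennreal (wker b x s) = 0" for x by (metis ennreal_0 mult_zero_left mult_zero_right)
  show ?thesis unfolding z using False by (simp add: wker_def)
next
  case True
  define C where "C = (s - t) powr (a - 1) * (s - t) powr (b - 1) / (Gamma a * Gamma b)"
  have C: "0 \<le> C" using ab by (simp add: C_def)
  have *: "(\<integral>\<^sup>+x. ennreal (indicator {0..1} x * (x powr (a - 1) * (1 - x) powr (b - 1))) \<partial>lborel) = ennreal (Beta a b)"
    using nn_integral_has_integral_lebesgue[OF _ has_integral_Beta_real[OF ab]] by (simp add: mult.commute)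
  have "(\<integral>\<^sup>+x. ennreal (wker a t x) * ennreal (wker b x s) \<partial>lborel)
    = ennreal \<bar>s - t\<bar> * (\<integral>\<^sup>+x. ennreal (wker a t (t + (s - t) * x)) * ennreal (wker b (t + (s - t) * x) s) \<partial>lborel)"
    using True by (intro nn_integral_real_affine) auto
  also have "(\<integral>\<^sup>+x. ennreal (wker a t (t + (s - t) * x)) * ennreal (wker b (t + (s - t) * x) s) \<partial>lborel)
    = (\<integral>\<^sup>+x. ennreal C * ennreal (indicator {0..1} x * (x powr (a - 1) * (1 - x) powr (b - 1))) \<partial>lborel)"
  proof (intro nn_integral_cong)
    fix x
    have 1: "t < t + (s - t) * x \<longleftrightarrow> 0 < x" using True by (simp add: zero_less_mult_iff)
    have e: "s - (t + (s - t) * x) = (s - t) * (1 - x)" by (simp add: algebra_simps)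
    have 2: "t + (s - t) * x < s \<longleftrightarrow> x < 1"
      using True e by (metis diff_gt_0_iff_gt mult_less_cancel_left_pos mult.right_neutral right_diff_distrib)
    show "ennreal (wker a t (t + (s - t) * x)) * ennreal (wker b (t + (s - t) * x) s)
       = ennreal C * ennreal (indicator {0..1} x * (x powr (a - 1) * (1 - x) powr (b - 1)))"
    proof (cases "0 < x \<and> x < 1")
      case t: True
      then show ?thesis using True ab C unfolding wker_def 1 2 e
        by (simp add: ennreal_mult'[symmetric] powr_mult C_def)
    next
      case False
      then have "wker a t (t + (s - t) * x) = 0 \<or> wker b (t + (s - t) * x) s = 0"
        unfolding wker_def 1 2 by auto
      \<comment> \<open>At both end points the integrand is 0, because
        \<open>0 powr y = 0\<close>.\<close>
      moreover have "indicator {0..1} x * (x powr (a - 1) * (1 - x) powr (b - 1)) = 0"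
        using False by (cases "x = 0 \<or> x = 1") (auto simp: indicator_def)
      ultimately show ?thesis by auto
    qed
  qed
  also have "\<dots> = ennreal (C * Beta a b)"
    using C by (subst nn_integral_cmult, simp, subst *, subst ennreal_mult', simp_all)
  also have "ennreal \<bar>s - t\<bar> * \<dots> = ennreal (wker (a + b) t s)"
  proof -
    have "Gamma a \<noteq> 0" "Gamma b \<noteq> 0" using Gamma_real_pos[OF ab(1)] Gamma_real_pos[OF ab(2)] by auto
    then have "(s - t) * (C * Beta a b) = (s - t) * ((s - t) powr (a - 1) * (s - t) powr (b - 1)) / Gamma (a + b)"
      by (simp add: C_def Beta_def)
    also have "(s - t) * ((s - t) powr (a - 1) * (s - t) powr (b - 1)) = (s - t) powr (1 + (a - 1) + (b - 1))"
      using True unfolding powr_add by simp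
    also have "1 + (a - 1) + (b - 1) = a + b - 1" by simp
    finally show ?thesis using True by (simp add: ennreal_mult'[symmetric] wker_def)
  qed
  finally show ?thesis .
qed

text \<open>On the positive half-line a power is a multiple of \<open>wker a 0\<close>, so this is
  an instance of the composition rule.\<close>

lemma wker_power_from_0:
  assumes ab: "0 < a" "0 < b" and s: "0 < s"
  shows "(\<integral>\<^sup>+x. ennreal (indicator {0<..} x * x powr (a - 1)) * ennreal (wker b x s) \<partial>lborel)
    = ennreal (Gamma a / Gamma (a + b) * s powr (a + b - 1))"
proof -
  have "(\<integral>\<^sup>+x. ennreal (indicator {0<..} x * x powr (a - 1)) * ennreal (wker b x s) \<partial>lborel)
    = (\<integral>\<^sup>+x. ennreal (Gamma a) * (ennreal (wker a 0 x) * ennreal (wker b x s)) \<partial>lborel)"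
  proof (intro nn_integral_cong)
    fix x
    have "indicator {0<..} x * x powr (a - 1) = Gamma a * wker a 0 x"
      using Gamma_real_pos[OF ab(1)] by (simp add: wker_def indicator_def)
    then show "ennreal (indicator {0<..} x * x powr (a - 1)) * ennreal (wker b x s)
      = ennreal (Gamma a) * (ennreal (wker a 0 x) * ennreal (wker b x s))"
      using ab by (simp add: ennreal_mult' mult.assoc)
  qed
  also have "\<dots> = ennreal (Gamma a) * ennreal (wker (a + b) 0 s)"
    using ab by (simp add: nn_integral_cmult wker_convolution)
  finally show ?thesis using ab s by (simp add: wker_def ennreal_mult'[symmetric])
qed

text \<open>
  Writing \<open>s\<^bsup>-b\<^esup>\<close> as a Gamma integral avoids the substitution \<open>s = t / x\<close>.
\<close>

lemma wker_power_to_infinity: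
  assumes a: "0 < a" "a < b" and t: "0 < t"
  shows "(\<integral>\<^sup>+s. ennreal (wker a t s) * ennreal (s powr (- b)) \<partial>lborel)
    = ennreal (Gamma (b - a) / Gamma b * t powr (a - b))"
proof -
  have b: "0 < b" using a by simp
  let ?e = "\<lambda>x. indicator {0<..} x * x powr (b - 1)"
  let ?F = "\<lambda>s x. ennreal (wker a t s) * ennreal (1 / Gamma b) * ennreal (?e x * exp (- (s * x)))"
  have "(\<integral>\<^sup>+s. ennreal (wker a t s) * ennreal (s powr (- b)) \<partial>lborel)
    = (\<integral>\<^sup>+s. (\<integral>\<^sup>+x. ?F s x \<partial>lborel) \<partial>lborel)"
  proof (intro nn_integral_cong)
    fix s
    show "ennreal (wker a t s) * ennreal (s powr (- b)) =
      (\<integral>\<^sup>+x. ?F s x \<partial>lborel)"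
    proof (cases "t < s")
      case True
      then have "0 < s" using t by simp
      then have "(\<integral>\<^sup>+x. ?F s x \<partial>lborel)
        = ennreal (wker a t s) * ennreal (1 / Gamma b) * (\<integral>\<^sup>+x. ennreal (?e x * exp (- (s * x))) \<partial>lborel)"
        by (intro nn_integral_cmult) measurable
      also have "(\<integral>\<^sup>+x. ennreal (?e x * exp (- (s * x))) \<partial>lborel) = ennreal (Gamma b * s powr (- b))"
        using b \<open>0 < s\<close> by (rule gamma_nn_scaled)
      also have "ennreal (wker a t s) * ennreal (1 / Gamma b) * \<dots> = ennreal (wker a t s) * (ennreal (1 / Gamma b) * ennreal (Gamma b * s powr (- b)))"
        by (simp only: mult.assoc)
      also have "ennreal (1 / Gamma b) * ennreal (Gamma b * s powr (- b)) = ennreal (s powr (- b))"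
        using Gamma_real_pos[OF b] by (simp add: ennreal_mult'[symmetric])
      finally show ?thesis by simp
    qed (simp add: wker_def)
  qed
  \<comment> \<open>After the exchange, the inner integral becomes a Gamma integral of order
    \<open>a\<close> by the shift \<open>s = t + y\<close>, and the outer one is a Gamma integral of
    order \<open>b - a\<close>.\<close>
  also have "\<dots> = (\<integral>\<^sup>+x. (\<integral>\<^sup>+s. ?F s x \<partial>lborel) \<partial>lborel)"
    by (rule lborel_pair.Fubini'[symmetric]) measurable
  also have "\<dots> = (\<integral>\<^sup>+x. ennreal (1 / Gamma b) * ennreal (indicator {0<..} x * x powr ((b - a) - 1) * exp (- (t * x))) \<partial>lborel)"
  proof (intro nn_integral_cong)
    fix x :: real
    show "(\<integral>\<^sup>+s. ?F s x \<partial>lborel)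
      = ennreal (1 / Gamma b) * ennreal (indicator {0<..} x * x powr ((b - a) - 1) * exp (- (t * x)))"
    proof (cases "0 < x")
      case True
      have "(\<integral>\<^sup>+s. ?F s x \<partial>lborel)
        = (\<integral>\<^sup>+y. ennreal (wker a t (t + 1 * y)) * ennreal (1 / Gamma b) * ennreal (?e x * exp (- ((t + 1 * y) * x))) \<partial>lborel)"
        by (subst nn_integral_real_affine[where c=1 and t=t]) auto
      also have "\<dots> = (\<integral>\<^sup>+y. ennreal (x powr (b - 1) * exp (- (t * x)) / Gamma b / Gamma a) * ennreal (indicator {0<..} y * y powr (a - 1) * exp (- (x * y))) \<partial>lborel)"
      proof (intro nn_integral_cong)
        fix y
        show "ennreal (wker a t (t + 1 * y)) * ennreal (1 / Gamma b) * ennreal (?e x * exp (- ((t + 1 * y) * x)))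
          = ennreal (x powr (b - 1) * exp (- (t * x)) / Gamma b / Gamma a) * ennreal (indicator {0<..} y * y powr (a - 1) * exp (- (x * y)))"
          using True a b Gamma_real_pos[OF a(1)] Gamma_real_pos[OF b]
          by (auto simp: wker_def indicator_def ennreal_mult'[symmetric] exp_add[symmetric] algebra_simps)
      qed
      also have "\<dots> = ennreal (x powr (b - 1) * exp (- (t * x)) / Gamma b / Gamma a) * ennreal (Gamma a * x powr (- a))"
        using True a by (simp add: nn_integral_cmult gamma_nn_scaled)
      also have "\<dots> = ennreal (1 / Gamma b) * ennreal (x powr (b - 1) * x powr (- a) * exp (- (t * x)))"
        using Gamma_real_pos[OF a(1)] Gamma_real_pos[OF b] by (simp add: ennreal_mult'[symmetric] field_simps)
      also have "x powr (b - 1) * x powr (- a) = x powr ((b - a) - 1)"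
        by (simp add: powr_add[symmetric] algebra_simps)
      finally show ?thesis using True by simp
    qed simp
  qed
  also have "\<dots> = ennreal (1 / Gamma b) * ennreal (Gamma (b - a) * t powr (- (b - a)))"
    using a t by (simp add: nn_integral_cmult gamma_nn_scaled)
  finally show ?thesis using Gamma_real_pos[OF b] a by (simp add: ennreal_mult'[symmetric])
qed

section \<open>Weyl integrals of Borel functions\<close>

definition wint :: "real \<Rightarrow> (real \<Rightarrow> complex) \<Rightarrow> real \<Rightarrow> complex" where
  "wint a h t = (LINT s|lborel. wker a t s *\<^sub>R h s)"

text \<open>The Weyl integral with values in \<open>ennreal\<close>, which always exists; absolute
  convergence of \<open>wint a h t\<close> is stated as finiteness of \<open>wnn a\<close> applied
  to the norm of \<open>h\<close>.\<close>

definition wnn :: "real \<Rightarrow> (real \<Rightarrow> ennreal) \<Rightarrow> real \<Rightarrow> ennreal" where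
  "wnn a h t = (\<integral>\<^sup>+s. ennreal (wker a t s) * h s \<partial>lborel)"

lemma measurable_wint [measurable]:
  assumes [measurable]: "h \<in> borel_measurable borel" shows "wint a h \<in> borel_measurable borel"
  unfolding wint_def[abs_def] by measurable

lemma measurable_wnn [measurable]:
  assumes [measurable]: "h \<in> borel_measurable borel" shows "wnn a h \<in> borel_measurable borel"
  unfolding wnn_def[abs_def] by measurable

lemma wnn_semigroup:
  assumes ab: "0 < a" "0 < b" and [measurable]: "h \<in> borel_measurable borel"
  shows "wnn a (wnn b h) t = wnn (a + b) h t"
proof -
  have "wnn a (wnn b h) t = (\<integral>\<^sup>+x. (\<integral>\<^sup>+s. ennreal (wker a t x) * ennreal (wker b x s) * h s \<partial>lborel) \<partial>lborel)"
    unfolding wnn_def by (simp add: nn_integral_cmult mult.assoc)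
  also have "\<dots> = (\<integral>\<^sup>+s. (\<integral>\<^sup>+x. ennreal (wker a t x) * ennreal (wker b x s) * h s \<partial>lborel) \<partial>lborel)"
    by (rule lborel_pair.Fubini'[symmetric]) measurable
  also have "\<dots> = wnn (a + b) h t"
    unfolding wnn_def using ab by (simp add: nn_integral_multc wker_convolution)
  finally show ?thesis .
qed

lemma ennreal_norm_scaleR: "0 \<le> c \<Longrightarrow> ennreal (norm (c *\<^sub>R x)) = ennreal c * ennreal (norm x)"
  by (simp add: ennreal_mult')

lemma integrable_wker_iff:
  assumes [measurable]: "h \<in> borel_measurable borel" and "0 < a"
  shows "integrable lborel (\<lambda>s. wker a t s *\<^sub>R (h s :: complex)) \<longleftrightarrow> wnn a (\<lambda>s. ennreal (norm (h s))) t < top"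
  unfolding integrable_iff_bounded wnn_def using assms by (simp add: ennreal_norm_scaleR ennreal_mult' top.not_eq_extremum[symmetric])

text \<open>A divergent integral is 0 by convention, and in that case the right-hand side is
  \<open>top\<close>.\<close>

lemma norm_wint_le:
  assumes [measurable]: "h \<in> borel_measurable borel" and "0 < a"
  shows "ennreal (norm (wint a h t)) \<le> wnn a (\<lambda>s. ennreal (norm (h s))) t"
proof (cases "wnn a (\<lambda>s. ennreal (norm (h s))) t < top")
  case True
  then have "ennreal (norm (wint a h t)) \<le> (\<integral>\<^sup>+s. ennreal (norm (wker a t s *\<^sub>R h s)) \<partial>lborel)"
    unfolding wint_def using assms by (intro integral_norm_bound_ennreal) (simp add: integrable_wker_iff)
  then show ?thesis using assms unfolding wnn_def by (simp add: ennreal_mult')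
qed (simp add: top.not_eq_extremum[symmetric])

text \<open>Integrability is asked for as one finite iterated integral of the norm, which is what
  the computations in \<open>ennreal\<close> supply. The spaces are general because the second
  variable will also be a point of the plane.\<close>

lemma lborel_Fubini:
  fixes f :: "'a::euclidean_space \<Rightarrow> 'b::euclidean_space \<Rightarrow> complex"
  assumes [measurable]: "(\<lambda>(x, y). f x y) \<in> borel_measurable (lborel \<Otimes>\<^sub>M lborel)"
    and "(\<integral>\<^sup>+x. (\<integral>\<^sup>+y. ennreal (norm (f x y)) \<partial>lborel) \<partial>lborel) < top"
  shows "(LINT x|lborel. (LINT y|lborel. f x y)) = (LINT y|lborel. (LINT x|lborel. f x y))"
proof -
  have "integrable (lborel \<Otimes>\<^sub>M lborel) (\<lambda>(x, y). f x y)"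
    unfolding integrable_iff_bounded
    using assms(2) by (simp add: lborel.nn_integral_fst[symmetric] case_prod_unfold)
  from lborel_pair.Fubini_integral[OF this] show ?thesis by simp
qed

text \<open>Finiteness at order \<open>a + b\<close> is, by \<open>wnn_semigroup\<close>, exactly
  the absolute convergence of the double integral, so Fubini reduces the claim to
  \<open>wker_convolution\<close>.\<close>

lemma wint_semigroup:
  assumes ab: "0 < a" "0 < b" and [measurable]: "h \<in> borel_measurable borel"
    and fin: "wnn (a + b) (\<lambda>s. ennreal (norm (h s))) t < top"
  shows "wint a (wint b h) t = wint (a + b) h t"
proof -
  have "wint a (wint b h) t = (LINT x|lborel. (LINT s|lborel. (wker a t x * wker b x s) *\<^sub>R h s))"
    unfolding wint_def by (simp flip: integral_scaleR_right scaleR_scaleR)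
  also have "\<dots> = (LINT s|lborel. (LINT x|lborel. (wker a t x * wker b x s) *\<^sub>R h s))"
  proof (rule lborel_Fubini)
    have "(\<integral>\<^sup>+x. (\<integral>\<^sup>+y. ennreal (norm ((wker a t x * wker b x y) *\<^sub>R h y)) \<partial>lborel) \<partial>lborel)
      = wnn a (wnn b (\<lambda>s. ennreal (norm (h s)))) t"
      unfolding wnn_def using ab by (simp add: nn_integral_cmult[symmetric] ennreal_mult' mult.assoc abs_mult)
    also have "\<dots> < top" using fin ab by (simp add: wnn_semigroup)
    finally show "(\<integral>\<^sup>+x. (\<integral>\<^sup>+y. ennreal (norm ((wker a t x * wker b x y) *\<^sub>R h y)) \<partial>lborel) \<partial>lborel) < top" .
  qed measurable
  also have "\<dots> = wint (a + b) h t"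
    unfolding wint_def
  proof (intro Bochner_Integration.integral_cong refl)
    fix s
    have "(\<integral>\<^sup>+x. ennreal (wker a t x * wker b x s) \<partial>lborel) = ennreal (wker (a + b) t s)"
      using wker_convolution[OF ab, of t s] ab by (simp add: ennreal_mult')
    then have "has_bochner_integral lborel (\<lambda>x. wker a t x * wker b x s) (wker (a + b) t s)"
      using ab by (intro has_bochner_integral_nn_integral) auto
    then show "(LINT x|lborel. (wker a t x * wker b x s) *\<^sub>R h s) = wker (a + b) t s *\<^sub>R h s"
      by (intro has_bochner_integral_integral_eq has_bochner_integral_scaleR_left) auto
  qed
  finally show ?thesis .
qed

section \<open>Homogeneous kernels and weighted bounds\<close>

definition weyl_const :: "real \<Rightarrow> real \<Rightarrow> real \<Rightarrow> real" where
  "weyl_const p \<alpha> \<mu> = Gamma (\<alpha> + 1 / p) / Gamma (\<alpha> + \<mu> + 1 / p)"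

text \<open>Both Schur conditions hold with the constant \<open>weyl_const\<close>: the row integral
  is \<open>wker_power_to_infinity\<close>, the column integral is \<open>wker_power_from_0\<close>,
  and for the weight with exponent \<open>- (1 / p)\<close> their Gamma quotients coincide.\<close>

lemma weyl_schur:
  assumes p: "1 \<le> p" and \<alpha>: "0 < \<alpha> + 1 / p" and \<mu>: "0 < \<mu>"
    and [measurable]: "F \<in> borel_measurable borel"
  shows "(\<integral>\<^sup>+t. epow p (\<integral>\<^sup>+s. ennreal (indicator {0<..} t * t powr \<alpha> * wker \<mu> t s * s powr (- (\<alpha> + \<mu>))) * F s \<partial>lborel) \<partial>lborel)
    \<le> ennreal (weyl_const p \<alpha> \<mu> powr p) * (\<integral>\<^sup>+t. epow p (F t) \<partial>lborel)"
proof -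
  let ?K = "\<lambda>s t. ennreal (indicator {0<..} s * s powr \<alpha> * wker \<mu> s t * t powr (- (\<alpha> + \<mu>)))"
  \<comment> \<open>The value 0 off the half-line encodes the support of the kernel, as
    \<open>schur_test\<close> expects it from its weights.\<close>
  define w where "w = (\<lambda>t::real. if 0 < t then t powr (- (1 / p)) else 0)"
  have wm [measurable]: "w \<in> borel_measurable borel" unfolding w_def by measurable
  have w_pos: "0 < w t \<longleftrightarrow> 0 < t" for t by (simp add: w_def)
  define A where "A = weyl_const p \<alpha> \<mu>"
  have A: "0 < A" using \<alpha> \<mu> by (simp add: A_def weyl_const_def Gamma_real_pos)
  have ge: "A powr p = A powr (p - 1) * A"
    using A by (metis diff_add_cancel powr_add powr_one less_eq_real_def)
  show ?thesis unfolding A_def[symmetric] ge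
  proof (rule schur_test[where v=w and w=w, OF p A])
    fix s t :: real
    assume "?K s t \<noteq> 0"
    then have "indicator {0<..} s \<noteq> (0::real)" "wker \<mu> s t \<noteq> 0" by auto
    then show "0 < w s \<and> 0 < w t" unfolding w_pos by (auto simp: indicator_def wker_def split: if_splits)
  next
    fix s :: real assume "0 < w s"
    then have s: "0 < s" by (simp add: w_pos)
    have "(\<integral>\<^sup>+t. ?K s t * ennreal (w t) \<partial>lborel)
      = (\<integral>\<^sup>+t. ennreal (s powr \<alpha>) * (ennreal (wker \<mu> s t) * ennreal (t powr (- (\<alpha> + \<mu> + 1 / p)))) \<partial>lborel)"
    proof (intro nn_integral_cong)
      fix t
      show "?K s t * ennreal (w t)
        = ennreal (s powr \<alpha>) * (ennreal (wker \<mu> s t) * ennreal (t powr (- (\<alpha> + \<mu> + 1 / p))))"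
      proof (cases "s < t")
        case True
        have "t powr (- (\<alpha> + \<mu>)) * w t = t powr (- (\<alpha> + \<mu> + 1 / p))"
          using True s by (simp add: w_def powr_add[symmetric])
        then have "s powr \<alpha> * wker \<mu> s t * t powr (- (\<alpha> + \<mu>)) * w t = s powr \<alpha> * (wker \<mu> s t * t powr (- (\<alpha> + \<mu> + 1 / p)))"
          by (metis (no_types, lifting) mult.assoc)
        note eq = this
        have "?K s t * ennreal (w t)
          = ennreal (s powr \<alpha> * wker \<mu> s t * t powr (- (\<alpha> + \<mu>)) * w t)"
          using s \<mu> by (simp add: ennreal_mult')
        also have "\<dots> = ennreal (s powr \<alpha>) * (ennreal (wker \<mu> s t) * ennreal (t powr (- (\<alpha> + \<mu> + 1 / p))))"
          unfolding eq using \<mu> by (simp add: ennreal_mult')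
        finally show ?thesis .
      qed (simp add: wker_def)
    qed
    also have "\<dots> = ennreal (s powr \<alpha>) * ennreal (Gamma (\<alpha> + \<mu> + 1 / p - \<mu>) / Gamma (\<alpha> + \<mu> + 1 / p) * s powr (\<mu> - (\<alpha> + \<mu> + 1 / p)))"
      using \<alpha> \<mu> s by (subst nn_integral_cmult, measurable, subst wker_power_to_infinity) auto
    also have "\<dots> = ennreal (A * (s powr \<alpha> * s powr (\<mu> - (\<alpha> + \<mu> + 1 / p))))"
      by (simp add: ennreal_mult'[symmetric] A_def weyl_const_def mult_ac add_ac)
    also have "s powr \<alpha> * s powr (\<mu> - (\<alpha> + \<mu> + 1 / p)) = w s"
      using s by (simp add: w_def powr_add[symmetric])
    finally show "(\<integral>\<^sup>+t. ?K s t * ennreal (w t) \<partial>lborel) \<le> ennreal (A * w s)" by simp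
  next
    fix t :: real assume "0 < w t"
    then have t: "0 < t" by (simp add: w_pos)
    have pp: "- (1 / p) * (p - 1) = 1 / p - 1" using p by (simp add: field_simps)
    have "(\<integral>\<^sup>+s. ?K s t * ennreal (w s powr (p - 1)) \<partial>lborel)
      = (\<integral>\<^sup>+s. ennreal (t powr (- (\<alpha> + \<mu>))) * (ennreal (indicator {0<..} s * s powr ((\<alpha> + 1 / p) - 1)) * ennreal (wker \<mu> s t)) \<partial>lborel)"
    proof (intro nn_integral_cong)
      fix s
      show "?K s t * ennreal (w s powr (p - 1))
        = ennreal (t powr (- (\<alpha> + \<mu>))) * (ennreal (indicator {0<..} s * s powr ((\<alpha> + 1 / p) - 1)) * ennreal (wker \<mu> s t))"
      proof (cases "0 < s")
        case True
        have "s powr \<alpha> * w s powr (p - 1) = s powr ((\<alpha> + 1 / p) - 1)"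
        proof -
          have "w s powr (p - 1) = s powr (1 / p - 1)"
            using True by (simp only: w_def if_True powr_powr pp)
          then show ?thesis by (simp only: powr_add[symmetric] add_diff_eq)
        qed
        then have "(s powr \<alpha> * wker \<mu> s t * t powr (- (\<alpha> + \<mu>))) * (w s powr (p - 1)) = t powr (- (\<alpha> + \<mu>)) * (s powr ((\<alpha> + 1 / p) - 1) * wker \<mu> s t)"
          by (metis (no_types, lifting) mult.assoc mult.commute)
        then show ?thesis using True \<mu> by (simp add: ennreal_mult'[symmetric])
      qed simp
    qed
    also have "\<dots> = ennreal (t powr (- (\<alpha> + \<mu>))) * ennreal (Gamma (\<alpha> + 1 / p) / Gamma (\<alpha> + 1 / p + \<mu>) * t powr (\<alpha> + 1 / p + \<mu> - 1))"
      using \<alpha> \<mu> t by (subst nn_integral_cmult) (simp_all only: wker_power_from_0, auto)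
    also have "\<dots> = ennreal (A * (t powr (- (\<alpha> + \<mu>)) * t powr (\<alpha> + 1 / p + \<mu> - 1)))"
      by (simp add: ennreal_mult'[symmetric] A_def weyl_const_def mult_ac add_ac)
    also have "t powr (- (\<alpha> + \<mu>)) * t powr (\<alpha> + 1 / p + \<mu> - 1) = w t powr (p - 1)"
    proof -
      have "w t powr (p - 1) = t powr (1 / p - 1)"
        using t by (simp only: w_def if_True powr_powr pp)
      then show ?thesis by (simp add: powr_add[symmetric] algebra_simps)
    qed
    finally show "(\<integral>\<^sup>+s. ?K s t * ennreal (w s powr (p - 1)) \<partial>lborel) \<le> ennreal (A * w t powr (p - 1))" by simp
  qed (use A in auto)
qed

text \<open>The \<open>p\<close>-th power of the weighted norm is kept in \<open>ennreal\<close>, so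
  that membership is finiteness and the root is taken only when \<open>T_norm\<close> is reached.
  The integral runs over the whole line; it is meant for functions that vanish on
  \<open>{..0}\<close>.\<close>

definition Npow :: "real \<Rightarrow> real \<Rightarrow> (real \<Rightarrow> complex) \<Rightarrow> ennreal" where
  "Npow p \<alpha> u = (\<integral>\<^sup>+t. epow p (ennreal (t powr \<alpha> * norm (u t))) \<partial>lborel)"

definition wLp :: "real \<Rightarrow> real \<Rightarrow> (real \<Rightarrow> complex) set" where
  "wLp p \<alpha> = {u \<in> borel_measurable borel. (\<forall>t\<le>0. u t = 0) \<and> Npow p \<alpha> u < top}"

lemma wLp_measurable [measurable_dest]: "u \<in> wLp p \<alpha> \<Longrightarrow> u \<in> borel_measurable borel"
  by (simp add: wLp_def)

text \<open>A factor \<open>s powr (\<alpha> + \<mu>)\<close> and its inverse are inserted, so that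
  \<open>weyl_schur\<close> applies to the function measured by
  \<open>Npow p (\<alpha> + \<mu>) u\<close>. The vanishing of \<open>u\<close> on
  \<open>{..0}\<close> settles the points where the two factors need not cancel.\<close>

lemma weyl_bound:
  assumes p: "1 \<le> p" and \<alpha>: "0 < \<alpha> + 1 / p" and \<mu>: "0 < \<mu>"
    and [measurable]: "u \<in> borel_measurable borel" and u0: "\<forall>t\<le>0. u t = 0"
  shows "(\<integral>\<^sup>+t. epow p (ennreal (indicator {0<..} t * t powr \<alpha>) * wnn \<mu> (\<lambda>s. ennreal (norm (u s))) t) \<partial>lborel)
    \<le> ennreal (weyl_const p \<alpha> \<mu> powr p) * Npow p (\<alpha> + \<mu>) u"
proof -
  let ?w = "\<lambda>t. indicator {0<..} t * t powr \<alpha> :: real" and ?k = "\<lambda>t s. indicator {0<..} t * t powr \<alpha> * wker \<mu> t s * s powr (- (\<alpha> + \<mu>))"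
  have "ennreal (?w t) * wnn \<mu> (\<lambda>s. ennreal (norm (u s))) t =
     (\<integral>\<^sup>+s. ennreal (?k t s) * ennreal (s powr (\<alpha> + \<mu>) * norm (u s)) \<partial>lborel)" for t
  proof -
    have "ennreal (?w t) * wnn \<mu> (\<lambda>s. ennreal (norm (u s))) t =
      (\<integral>\<^sup>+s. ennreal (?w t) * (ennreal (wker \<mu> t s) * ennreal (norm (u s))) \<partial>lborel)"
      unfolding wnn_def by (simp add: nn_integral_cmult)
    also have "\<dots> = (\<integral>\<^sup>+s. ennreal (?k t s) * ennreal (s powr (\<alpha> + \<mu>) * norm (u s)) \<partial>lborel)"
    proof (intro nn_integral_cong)
      fix s
      show "ennreal (?w t) * (ennreal (wker \<mu> t s) * ennreal (norm (u s)))
        = ennreal (?k t s) * ennreal (s powr (\<alpha> + \<mu>) * norm (u s))"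
      proof (cases "0 < s")
        case True
        then have "s powr (- (\<alpha> + \<mu>)) * s powr (\<alpha> + \<mu>) = 1" by (simp add: powr_add[symmetric])
        moreover have "x * n = (x * a) * (b * n)" if "a * b = 1" for a b x n :: real
          using that by (metis mult.assoc mult.left_commute mult.right_neutral)
        ultimately have "?w t * wker \<mu> t s * norm (u s) =
          (?k t s) * (s powr (\<alpha> + \<mu>) * norm (u s))"
          by blast
        then show ?thesis using \<mu> by (simp add: ennreal_mult'[symmetric] mult.assoc)
      qed (use u0 in simp)
    qed
    finally show ?thesis .
  qed
  then show ?thesis unfolding Npow_def using weyl_schur[OF p \<alpha> \<mu>, of "\<lambda>s. ennreal (s powr (\<alpha> + \<mu>) * norm (u s))"] by simp
qed

text \<open>A function whose \<open>p\<close>-th power has a finite integral is finite almost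
  everywhere. This is the source of absolute convergence for Weyl integrals at almost every
  point.\<close>

lemma wnn_finite_AE:
  assumes p: "1 \<le> p" and \<alpha>: "0 < \<alpha> + 1 / p" and \<mu>: "0 < \<mu>" and u: "u \<in> wLp p (\<alpha> + \<mu>)"
  shows "AE t in lborel. 0 < t \<longrightarrow> wnn \<mu> (\<lambda>s. ennreal (norm (u s))) t < top"
proof -
  have [measurable]: "u \<in> borel_measurable borel" using u by measurable
  have "ennreal (weyl_const p \<alpha> \<mu> powr p) * Npow p (\<alpha> + \<mu>) u < top"
    using u by (simp add: wLp_def ennreal_mult_less_top)
  with weyl_bound[OF p \<alpha> \<mu>, of u] u
  have "(\<integral>\<^sup>+t. epow p (ennreal (indicator {0<..} t * t powr \<alpha>) * wnn \<mu> (\<lambda>s. ennreal (norm (u s))) t) \<partial>lborel) \<noteq> \<infinity>"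
    by (auto simp: wLp_def top_unique)
  from nn_integral_PInf_AE[OF _ this]
  have "AE t in lborel. epow p (ennreal (indicator {0<..} t * t powr \<alpha>) * wnn \<mu> (\<lambda>s. ennreal (norm (u s))) t) \<noteq> \<infinity>"
    by simp
  then show ?thesis
    by eventually_elim (auto simp: ennreal_mult_eq_top_iff top.not_eq_extremum[symmetric])
qed

text \<open>
  Representatives are normalised to vanish on \<open>{..0}\<close>, where the Weyl integral itself need not.
\<close>

definition wext :: "real \<Rightarrow> (real \<Rightarrow> complex) \<Rightarrow> real \<Rightarrow> complex" where
  "wext \<mu> u t = (if 0 < t then wint \<mu> u t else 0)"

lemma measurable_wext [measurable]:
  assumes [measurable]: "h \<in> borel_measurable borel" shows "wext a h \<in> borel_measurable borel"
  unfolding wext_def[abs_def] by measurable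

lemma Npow_wext_le:
  assumes p: "1 \<le> p" and \<alpha>: "0 < \<alpha> + 1 / p" and \<mu>: "0 < \<mu>"
   and [measurable]: "u \<in> borel_measurable borel" and u0: "\<forall>t\<le>0. u t = 0"
  shows "Npow p \<alpha> (wext \<mu> u) \<le> ennreal (weyl_const p \<alpha> \<mu> powr p) * Npow p (\<alpha> + \<mu>) u"
proof -
  have "Npow p \<alpha> (wext \<mu> u) \<le> (\<integral>\<^sup>+t. epow p (ennreal (indicator {0<..} t * t powr \<alpha>) * wnn \<mu> (\<lambda>s. ennreal (norm (u s))) t) \<partial>lborel)"
    unfolding Npow_def
  proof (intro nn_integral_mono epow_mono)
    fix t
    show "ennreal (t powr \<alpha> * norm (wext \<mu> u t)) \<le> ennreal (indicator {0<..} t * t powr \<alpha>) * wnn \<mu> (\<lambda>s. ennreal (norm (u s))) t"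
      using norm_wint_le[of u \<mu> t] \<mu> by (simp add: wext_def ennreal_mult' mult_left_mono)
  qed (use p in simp)
  also have "\<dots> \<le> ennreal (weyl_const p \<alpha> \<mu> powr p) * Npow p (\<alpha> + \<mu>) u"
    using assms by (intro weyl_bound) auto
  finally show ?thesis .
qed

lemma wext_in_wLp:
  assumes p: "1 \<le> p" and \<alpha>: "0 < \<alpha> + 1 / p" and \<mu>: "0 < \<mu>" and u: "u \<in> wLp p (\<alpha> + \<mu>)"
  shows "wext \<mu> u \<in> wLp p \<alpha>"
proof -
  have [measurable]: "u \<in> borel_measurable borel" using u by measurable
  have "ennreal (weyl_const p \<alpha> \<mu> powr p) * Npow p (\<alpha> + \<mu>) u < top"
    using u by (simp add: wLp_def ennreal_mult_less_top)
  with Npow_wext_le[OF p \<alpha> \<mu>, of u] u show ?thesis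
    unfolding wLp_def by (auto simp: wext_def)
qed

section \<open>Injectivity of the Weyl integral\<close>

lemma AE_lborel_pos_ex:
  assumes "AE t in lborel. 0 < t \<longrightarrow> P (t::real)" shows "\<exists>t>0. P t"
proof (rule ccontr)
  assume no: "\<not> (\<exists>t>0. P t)"
  from assms obtain N where N: "{t. \<not> (0 < t \<longrightarrow> P t)} \<subseteq> N" "N \<in> null_sets lborel"
    by (auto elim!: AE_E simp: null_sets_def)
  with no have "{0<..1} \<subseteq> N" by auto
  with N have "emeasure lborel {0<..(1::real)} \<le> 0"
    by (metis emeasure_mono null_setsD1 null_setsD2)
  then show False by simp
qed

text \<open>
  These test functions have an explicit fractional integral; they decay like \<open>t\<^bsup>-a-1\<^esup>\<close>, fast enough to be
  paired with Weyl integrals of functions in the weighted spaces.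
\<close>

lemma exp_reciprocal_wker:
  assumes a: "0 < a" and c: "0 < c" and s: "0 < s"
  shows "(\<integral>\<^sup>+t. ennreal (indicator {0<..} t * (t powr (- a - 1) * exp (- c / t))) * ennreal (wker a t s) \<partial>lborel)
    = ennreal (c powr (- a) * s powr (a - 1) * exp (- c / s))"
proof -
  let ?\<phi> = "\<lambda>t. indicator {0<..} t * (t powr (- a - 1) * exp (- c / t))"
  define S where "S = {1 / s<..}"
  define F where "F = (\<lambda>t. (s - t) powr (a - 1) * (t powr (- a - 1) * exp (- c / t)))"
  define R where "R = Gamma a * c powr (- a) * s powr (a - 1) * exp (- c / s)"
  define f where "f = (\<lambda>x. indicator S x * (s powr (a - 1) * ((x - 1 / s) powr (a - 1) * exp (- (c * x)))))"
  have [measurable]: "f \<in> borel_measurable borel" unfolding f_def S_def by measurable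
  have Ga: "0 < Gamma a" using a by (rule Gamma_real_pos)
  \<comment> \<open>In the variable \<open>x = 1 / t\<close> the integral is a Gamma integral
    shifted by \<open>1 / s\<close>, which can be evaluated.\<close>
  have f_int: "(\<integral>\<^sup>+x. ennreal (f x) \<partial>lborel) = ennreal R"
  proof -
    have "(\<integral>\<^sup>+x. ennreal (f x) \<partial>lborel) = ennreal \<bar>1\<bar> * (\<integral>\<^sup>+x. ennreal (f (1 / s + 1 * x)) \<partial>lborel)"
      by (rule nn_integral_real_affine) auto
    also have "(\<integral>\<^sup>+x. ennreal (f (1 / s + 1 * x)) \<partial>lborel) =
      (\<integral>\<^sup>+x. ennreal (s powr (a - 1) * exp (- c / s)) * ennreal (indicator {0<..} x * x powr (a - 1) * exp (- (c * x))) \<partial>lborel)"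
      by (intro nn_integral_cong)
        (auto simp: f_def S_def indicator_def ennreal_mult'[symmetric] exp_add[symmetric] algebra_simps)
    also have "\<dots> = ennreal (s powr (a - 1) * exp (- c / s)) * ennreal (Gamma a * c powr (- a))"
      using a c by (subst nn_integral_cmult, measurable, subst gamma_nn_scaled) auto
    finally show ?thesis using Ga by (simp add: ennreal_mult'[symmetric] R_def mult_ac)
  qed
  have R: "0 \<le> R" using Ga by (simp add: R_def)
  have "(f has_integral R) UNIV"
    by (rule nn_integral_has_integral[OF _ _ f_int R]) (measurable, simp add: f_def)
  \<comment> \<open>\<open>F\<close> is the integrand in \<open>t\<close>; the substitution
    \<open>t = 1 / x\<close> contributes the Jacobian \<open>1 / x\<^sup>2\<close> and maps
    \<open>S\<close> onto \<open>{0<..<s}\<close>.\<close>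
  moreover have "f = (\<lambda>x. if x \<in> S then \<bar>- (1 / x\<^sup>2)\<bar> * F (1 / x) else 0)"
  proof
    fix x
    show "f x = (if x \<in> S then \<bar>- (1 / x\<^sup>2)\<bar> * F (1 / x) else 0)"
    proof (cases "x \<in> S")
      case True
      then have x: "0 < x" "1 / s < x" using s by (auto simp: S_def intro: less_trans[of 0 "1/s"])
      have "s - 1 / x = s * (x - 1 / s) / x" using x s by (simp add: field_simps)
      then have "(s - 1 / x) powr (a - 1) = s powr (a - 1) * (x - 1 / s) powr (a - 1) * x powr (1 - a)"
        using x s by (simp add: powr_mult powr_divide powr_diff)
      moreover have "(1 / x) powr (- a - 1) = x powr (a + 1)"
        using x by (simp add: powr_divide powr_minus_divide[symmetric] add.commute)
      moreover have "1 / x\<^sup>2 = x powr (- 2)" using x by (simp add: powr_minus_divide)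
      moreover have "x powr (- 2) * (x powr (1 - a) * x powr (a + 1)) = 1"
        unfolding powr_add[symmetric] using x by simp
      ultimately have "\<bar>- (1 / x\<^sup>2)\<bar> * F (1 / x) = (x powr (- 2) * (x powr (1 - a) * x powr (a + 1))) * (s powr (a - 1) * ((x - 1 / s) powr (a - 1) * exp (- (c * x))))"
        using x by (simp add: F_def)
      also have "\<dots> = f x" unfolding \<open>x powr (- 2) * (x powr (1 - a) * x powr (a + 1)) = 1\<close>
        using True by (simp add: f_def)
      finally show ?thesis using True by simp
    qed (simp add: f_def)
  qed
  ultimately have hi: "((\<lambda>x. \<bar>- (1 / x\<^sup>2)\<bar> * F (1 / x)) has_integral R) S"
    using has_integral_restrict_UNIV[of S "\<lambda>x. \<bar>- (1 / x\<^sup>2)\<bar> * F (1 / x)" R] by simp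
  have img: "(\<lambda>x. 1 / x) ` S = {0<..<s}"
  proof (intro equalityI subsetI)
    fix y assume "y \<in> {0<..<s}"
    then have "1 / y \<in> S" "y = 1 / (1 / y)" using s by (simp_all add: S_def frac_less2)
    then show "y \<in> (\<lambda>x. 1 / x) ` S" by blast
  next
    fix y assume "y \<in> (\<lambda>x. 1 / x) ` S"
    then obtain x where x: "1 / s < x" "y = 1 / x" by (auto simp: S_def)
    then have "0 < x" using s by (auto intro: less_trans[of 0 "1/s"])
    then have "0 < 1 / x" "1 / x < s" using x(1) s by (simp_all add: field_simps)
    with x show "y \<in> {0<..<s}" by simp
  qed
  have "0 < 1 / s" using s by simp
  then have nz: "x \<noteq> 0" if "x \<in> S" for x using that unfolding S_def by (metis greaterThan_iff less_asym)
  have "(\<lambda>x. \<bar>- (1 / x\<^sup>2)\<bar> * F (1 / x)) absolutely_integrable_on S"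
    using hi by (intro nonnegative_absolutely_integrable_1) (auto simp: F_def integrable_on_def)
  then have "F absolutely_integrable_on (\<lambda>x. 1 / x) ` S \<and> integral ((\<lambda>x. 1 / x) ` S) F = R"
    using hi nz by (subst has_absolute_integral_change_of_variables_1'[where g'="\<lambda>x. - (1 / x\<^sup>2)", symmetric])
      (auto simp: S_def integral_unique inj_on_def power2_eq_square intro!: derivative_eq_intros)
  then have "(F has_integral R) {0<..<s}"
    unfolding img by (metis set_lebesgue_integral_eq_integral(1) has_integral_integrable_integral)
  then have "(\<integral>\<^sup>+x. indicator {0<..<s} x * F x \<partial>lborel) = ennreal R"
    by (intro nn_integral_has_integral_lebesgue) (auto simp: F_def)
  moreover have [measurable]: "F \<in> borel_measurable borel" unfolding F_def by measurable
  moreover have *: "ennreal (?\<phi> t) * ennreal (wker a t s)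
     = ennreal (1 / Gamma a) * ennreal (indicator {0<..<s} t * F t)" for t
    using Ga by (auto simp: wker_def F_def indicator_def ennreal_mult'[symmetric] mult_ac)
  ultimately have "(\<integral>\<^sup>+t. ennreal (?\<phi> t) * ennreal (wker a t s) \<partial>lborel)
    = ennreal (1 / Gamma a) * ennreal R"
    unfolding * by (subst nn_integral_cmult) simp_all
  then show ?thesis using Ga by (simp add: ennreal_mult'[symmetric] R_def)
qed

text \<open>The positive and the negative part of \<open>g\<close> are densities of finite measures
  that agree on all rays. Rays determine such measures, so the two densities agree almost
  everywhere.\<close>

lemma AE_zero_if_integrals_rays_zero_real:
  fixes g :: "real \<Rightarrow> real"
  assumes g: "integrable lborel g" and 0: "\<And>b. (LINT s|lborel. indicator {b<..} s * g s) = 0"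
  shows "AE s in lborel. g s = 0"
proof -
  let ?P = "\<lambda>b. \<integral>\<^sup>+s. ennreal (g s) * indicator {b<..} s \<partial>lborel" and ?N = "\<lambda>b. \<integral>\<^sup>+s. ennreal (- g s) * indicator {b<..} s \<partial>lborel"
  have [measurable]: "g \<in> borel_measurable borel" using g by auto
  have gi: "integrable lborel (\<lambda>s. indicator {b<..} s * g s)" for b
    using integrable_mult_indicator[OF _ g, of "{b<..}"] by simp
  have fin: "(\<integral>\<^sup>+s. ennreal (g s) \<partial>lborel) < top" "(\<integral>\<^sup>+s. ennreal (- g s) \<partial>lborel) < top"
    using g by (auto simp: real_integrable_def top.not_eq_extremum)
  have eq: "?P b = ?N b" for b
  proof -
    have *: "ennreal (indicator {b<..} s * g s) = ennreal (g s) * indicator {b<..} s"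
       "ennreal (- (indicator {b<..} s * g s)) = ennreal (- g s) * indicator {b<..} s" for s
      by (auto simp: indicator_def)
    have le: "?P b < top" "?N b < top"
      using gi[of b] by (auto simp: real_integrable_def * top.not_eq_extremum)
    have "enn2real (?P b) = enn2real (?N b)"
      using real_lebesgue_integral_def[OF gi[of b]] 0[of b] by (simp add: *)
    with le show ?thesis by (metis ennreal_enn2real)
  qed
  have "density lborel (\<lambda>s. ennreal (g s)) = density lborel (\<lambda>s. ennreal (- g s))"
  proof (rule measure_eqI_lessThan)
    fix x
    have "?P x \<le> (\<integral>\<^sup>+s. ennreal (g s) \<partial>lborel)"
      by (intro nn_integral_mono) (auto simp: indicator_def)
    then show "emeasure (density lborel (\<lambda>s. ennreal (g s))) {x<..} < \<infinity>"
      using fin by (simp add: emeasure_density)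
  qed (auto simp: emeasure_density eq)
  then have "AE s in lborel. ennreal (g s) = ennreal (- g s)"
    by (intro sigma_finite_measure.density_unique[OF sigma_finite_lborel]) auto
  then show ?thesis
    by eventually_elim (metis ennreal_eq_0_iff ennreal_inj linear neg_0_le_iff_le neg_equal_iff_equal neg_le_0_iff_le neg_equal_zero order_antisym)
qed

lemma AE_zero_if_integrals_rays_zero:
  fixes g :: "real \<Rightarrow> complex"
  assumes g: "integrable lborel g" and 0: "\<And>b. (LINT s|lborel. indicator {b<..} s *\<^sub>R g s) = 0"
  shows "AE s in lborel. g s = 0"
proof -
  have i: "integrable lborel (\<lambda>s. indicator {b<..} s *\<^sub>R g s)" for b
    using integrable_mult_indicator[OF _ g, of "{b<..}"] by simp
  have "AE s in lborel. Re (g s) = 0"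
  proof (rule AE_zero_if_integrals_rays_zero_real)
    show "(LINT s|lborel. indicator {b<..} s * Re (g s)) = 0" for b
      using integral_Re[OF i[of b]] 0[of b] by simp
  qed (use g in auto)
  moreover have "AE s in lborel. Im (g s) = 0"
  proof (rule AE_zero_if_integrals_rays_zero_real)
    show "(LINT s|lborel. indicator {b<..} s * Im (g s)) = 0" for b
      using integral_Im[OF i[of b]] 0[of b] by simp
  qed (use g in auto)
  ultimately show ?thesis by eventually_elim (simp add: complex_eq_iff)
qed

text \<open>In the variable \<open>y = exp (- 1 / s)\<close>, which lies in the unit interval for
  \<open>s > 0\<close>, all moments of \<open>G\<close> vanish. Polynomial approximation extends
  this to continuous functions of \<open>y\<close>, and dominated convergence to indicators of rays
  in \<open>y\<close>. These are rays in \<open>s\<close>, since \<open>y\<close> is increasing on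
  the half-line.\<close>

lemma AE_zero_if_exp_moments_zero:
  fixes G :: "real \<Rightarrow> complex"
  assumes G: "integrable lborel G" and G0: "\<forall>s\<le>0. G s = 0"
    and mom: "\<And>n::nat. (LINT s|lborel. exp (- 1 / s) ^ n *\<^sub>R G s) = 0"
  shows "AE s in lborel. G s = 0"
proof (rule AE_zero_if_integrals_rays_zero[OF G])
  have [measurable]: "G \<in> borel_measurable borel" using G by auto
  define y where "y = (\<lambda>s::real. exp (- 1 / s))"
  let ?I = "\<lambda>h. LINT s|lborel. (h (y s) :: real) *\<^sub>R G s"
  have [measurable]: "y \<in> borel_measurable borel" unfolding y_def by measurable
  have y01: "y s \<in> {0..1}" if "0 < s" for s using that by (simp add: y_def)
  have bnd: "integrable lborel (\<lambda>s. h (y s) *\<^sub>R G s)" if [measurable]: "h \<in> borel_measurable borel" and C: "\<And>x. x \<in> {0..1} \<Longrightarrow> \<bar>h x\<bar> \<le> C" for h :: "real \<Rightarrow> real" and C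
  proof (rule Bochner_Integration.integrable_bound)
    show "integrable lborel (\<lambda>s. C *\<^sub>R G s)" using G by simp
    show "AE s in lborel. norm (h (y s) *\<^sub>R G s) \<le> norm (C *\<^sub>R G s)"
    proof (intro AE_I2)
      fix s
      show "norm (h (y s) *\<^sub>R G s) \<le> norm (C *\<^sub>R G s)"
        using C[OF y01[of s]] G0 by (cases "0 < s") (auto intro!: mult_right_mono)
    qed
  qed measurable
  have pow_int: "integrable lborel (\<lambda>s. y s ^ n *\<^sub>R G s)" for n :: nat
    by (rule bnd[of "\<lambda>x. x ^ n" 1]) (auto simp: power_le_one)
  have poly0: "(LINT s|lborel. (\<Sum>i\<le>n. a i * y s ^ i) *\<^sub>R G s) = 0" for a :: "nat \<Rightarrow> real" and n
  proof -
    have "(LINT s|lborel. (\<Sum>i\<le>n. a i * y s ^ i) *\<^sub>R G s) = (LINT s|lborel. (\<Sum>i\<le>n. a i *\<^sub>R (y s ^ i *\<^sub>R G s)))"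
      by (simp add: scaleR_sum_left)
    also have "\<dots> = (\<Sum>i\<le>n. LINT s|lborel. a i *\<^sub>R (y s ^ i *\<^sub>R G s))"
      using pow_int by (intro Bochner_Integration.integral_sum integrable_scaleR_right)
    also have "\<dots> = 0" using mom by (simp only: integral_scaleR_right y_def) simp
    finally show ?thesis .
  qed
  have cont0: "?I h = 0" if h: "continuous_on UNIV h" for h :: "real \<Rightarrow> real"
  proof -
    have hm [measurable]: "h \<in> borel_measurable borel" using h by (simp add: borel_measurable_continuous_onI)
    have le_e: "norm (?I h) \<le> e * (LINT s|lborel. norm (G s))" if e: "0 < e" for e
    proof -
      obtain q where q: "real_polynomial_function q" "\<And>x. x \<in> {0..1} \<Longrightarrow> \<bar>h x - q x\<bar> < e"
        using Stone_Weierstrass_real_polynomial_function[of "{0..1}" h e] h e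
        by (metis compact_Icc continuous_on_subset subset_UNIV)
      then obtain a n where an: "q = (\<lambda>x. \<Sum>i\<le>n. a i * x ^ i)" unfolding real_polynomial_function_iff_sum by blast
      have [measurable]: "q \<in> borel_measurable borel" unfolding an by measurable
      obtain C where "\<forall>x\<in>{0..1}. \<bar>h x\<bar> \<le> C"
        using compact_imp_bounded[OF compact_continuous_image[OF continuous_on_subset[OF h subset_UNIV] compact_Icc[of 0 1]]]
        by (auto simp: bounded_iff)
      then have C: "\<And>x. x \<in> {0..1} \<Longrightarrow> \<bar>h x\<bar> \<le> C" by blast
      have ih: "integrable lborel (\<lambda>s. h (y s) *\<^sub>R G s)" by (rule bnd[OF hm C])
      have iq: "integrable lborel (\<lambda>s. q (y s) *\<^sub>R G s)"
      proof (rule bnd)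
        fix x :: real assume "x \<in> {0..1}" then show "\<bar>q x\<bar> \<le> C + e" using C[of x] q(2)[of x] by linarith
      qed measurable
      have "?I h = ?I h - ?I q"
        using poly0[of a n] by (simp add: an)
      also have "\<dots> = (LINT s|lborel. (h (y s) - q (y s)) *\<^sub>R G s)"
        using ih iq by (simp add: scaleR_diff_left)
      also have "norm \<dots> \<le> (LINT s|lborel. norm ((h (y s) - q (y s)) *\<^sub>R G s))"
        by (rule integral_norm_bound)
      also have "\<dots> \<le> (LINT s|lborel. e * norm (G s))"
      proof (rule integral_mono)
        show "integrable lborel (\<lambda>s. norm ((h (y s) - q (y s)) *\<^sub>R G s))"
          using ih iq by (intro integrable_norm) (simp add: scaleR_diff_left)
        show "norm ((h (y s) - q (y s)) *\<^sub>R G s) \<le> e * norm (G s)" for s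
          using q(2)[OF y01[of s]] G0 by (cases "0 < s") (auto intro!: mult_right_mono)
      qed (use G in simp)
      finally show ?thesis by simp
    qed
    have "norm (?I h) \<le> 0 + d" if "0 < d" for d
    proof -
      define I where "I = (LINT s|lborel. norm (G s))"
      have I: "0 \<le> I" by (simp add: I_def)
      then have "d / (I + 1) * I \<le> d" using \<open>0 < d\<close> by (simp add: field_simps)
      moreover have "0 < d / (I + 1)" using I \<open>0 < d\<close> by simp
      from le_e[OF this] have "norm (?I h) \<le> d / (I + 1) * I"
        by (simp only: I_def)
      ultimately show ?thesis by simp
    qed
    then have "norm (?I h) \<le> 0" by (rule field_le_epsilon)
    then show ?thesis by simp
  qed
  fix b :: real
  show "(LINT s|lborel. indicator {b<..} s *\<^sub>R G s) = 0"
  proof (cases "0 < b")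
    case False
    then have "indicator {b<..} s *\<^sub>R G s = G s" for s using G0 by (auto simp: indicator_def)
    then show ?thesis using mom[of 0] by simp
  next
    case True
    \<comment> \<open>Ramps of slope \<open>k\<close> starting at \<open>y b\<close>; composed with
      \<open>y\<close> they converge to the indicator of the ray \<open>{b<..}\<close> at every
      \<open>s > 0\<close>.\<close>
    define h where "h = (\<lambda>(k::nat) x. max 0 (min 1 (real k * (x - y b))))"
    have hc: "continuous_on UNIV (h k)" for k unfolding h_def by (intro continuous_intros)
    then have [measurable]: "h k \<in> borel_measurable borel" for k by (simp add: borel_measurable_continuous_onI)
    have "(\<lambda>k. LINT s|lborel. h k (y s) *\<^sub>R G s) \<longlonglongrightarrow> (LINT s|lborel. indicator {b<..} s *\<^sub>R G s)"
    proof (rule integral_dominated_convergence[where w="\<lambda>s. norm (G s)"])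
      show "AE s in lborel. (\<lambda>k. h k (y s) *\<^sub>R G s) \<longlonglongrightarrow> indicator {b<..} s *\<^sub>R G s"
      proof (intro AE_I2)
        fix s
        show "(\<lambda>k. h k (y s) *\<^sub>R G s) \<longlonglongrightarrow> indicator {b<..} s *\<^sub>R G s"
        proof (cases "0 < s")
          case False then show ?thesis using G0 by simp
        next
          case s: True
          have mono: "y b < y s \<longleftrightarrow> b < s" using s True by (simp add: y_def field_simps)
          have "(\<lambda>k. h k (y s)) \<longlonglongrightarrow> indicator {b<..} s"
          proof (cases "b < s")
            case False
            then have "y s - y b \<le> 0" using mono by simp
            then have "real k * (y s - y b) \<le> 0" for k by (simp add: mult_nonneg_nonpos)
            then have "h k (y s) = 0" for k
              unfolding h_def by (meson max.absorb1 min.coboundedI2)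
            then show ?thesis using False by simp
          next
            case bs: True
            then have pos: "0 < y s - y b" using mono by simp
            obtain k0 where k0: "1 < real k0 * (y s - y b)" using reals_Archimedean3[OF pos] by blast
            have "eventually (\<lambda>k. h k (y s) = 1) sequentially"
              using eventually_ge_at_top[of k0]
            proof eventually_elim
              case (elim k)
              then have "real k0 * (y s - y b) \<le> real k * (y s - y b)" using pos by (intro mult_right_mono) auto
              with k0 show ?case by (simp add: h_def)
            qed
            then show ?thesis using bs by (simp add: tendsto_eventually)
          qed
          then show ?thesis by (intro tendsto_scaleR tendsto_const)
        qed
      qed
      show "AE s in lborel. norm (h k (y s) *\<^sub>R G s) \<le> norm (G s)" for k
        by (intro AE_I2) (auto simp: h_def intro!: mult_left_le_one_le)
    qed (use G in auto)
    moreover have "?I (h k) = 0" for k by (rule cont0[OF hc])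
    ultimately show ?thesis by (simp add: LIMSEQ_const_iff)
  qed
qed

text \<open>The Laplace transform is only needed at positive integers: its values there are the
  moments in \<open>AE_zero_if_exp_moments_zero\<close>.\<close>

lemma wint_injective:
  assumes p: "1 \<le> p" and a: "0 < a" and u: "u \<in> wLp p a"
    and z: "AE t in lborel. 0 < t \<longrightarrow> wint a u t = 0"
  shows "AE t in lborel. u t = 0"
proof -
  let ?U = "\<lambda>s. ennreal (norm (u s))" and ?P = "\<lambda>s. epow p (ennreal (s powr a * norm (u s)))"
  have [measurable]: "u \<in> borel_measurable borel" using u by measurable
  have u0: "\<forall>t\<le>0. u t = 0" using u by (simp add: wLp_def)
  define e where "e = (\<lambda>c s::real. s powr (a - 1) * exp (- c / s))"
  have [measurable]: "e c \<in> borel_measurable borel" for c unfolding e_def by measurable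
  \<comment> \<open>The integral is split at some \<open>t\<close>. Beyond it,
    \<open>s powr (a - 1) * norm (u s)\<close> is integrable because its Weyl integral of order 1
    converges somewhere. Below it, \<open>exp (- c / s) \<le> s / c\<close> leaves
    \<open>s powr a * norm (u s)\<close> on a bounded interval, which \<open>le_1_add_epow\<close>
    controls.\<close>
  have fin: "(\<integral>\<^sup>+s. ennreal (e c s) * ?U s \<partial>lborel) < top" if c: "0 < c" for c
  proof -
    define v where "v = (\<lambda>s. s powr (a - 1) *\<^sub>R u s)"
    have vm [measurable]: "v \<in> borel_measurable borel" unfolding v_def by measurable
    have "s powr 1 * norm (v s) = s powr a * norm (u s)" for s
      using u0 by (cases "0 < s") (auto simp: v_def powr_diff)
    then have "v \<in> wLp p (0 + 1)"
      using u by (simp add: wLp_def Npow_def) (auto simp: v_def)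
    from wnn_finite_AE[OF p _ _ this] p have "AE t in lborel. 0 < t \<longrightarrow> wnn 1 (\<lambda>s. ennreal (norm (v s))) t < top"
      by simp
    then obtain t where t: "0 < t" "wnn 1 (\<lambda>s. ennreal (norm (v s))) t < top" using AE_lborel_pos_ex[of "\<lambda>t. wnn 1 (\<lambda>s. ennreal (norm (v s))) t < top"] by auto
    have "(\<integral>\<^sup>+s. ennreal (e c s) * ?U s \<partial>lborel) \<le>
      (\<integral>\<^sup>+s. ennreal (wker 1 t s) * ennreal (norm (v s)) + ennreal (1 / c) * (indicator {0<..t} s + ?P s) \<partial>lborel)"
    proof (intro nn_integral_mono)
      fix s
      show "ennreal (e c s) * ?U s \<le> ennreal (wker 1 t s) * ennreal (norm (v s)) + ennreal (1 / c) * (indicator {0<..t} s + ?P s)"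
      proof (cases "0 < s")
        case True
        show ?thesis
        proof (cases "t < s")
          case ts: True
          have "e c s * norm (u s) \<le> s powr (a - 1) * norm (u s)"
            unfolding e_def using True c by (intro mult_right_mono mult_right_le_one_le) auto
          then have "ennreal (e c s) * ?U s \<le> ennreal (wker 1 t s) * ennreal (norm (v s))"
            using ts by (simp add: ennreal_mult'[symmetric] e_def wker_def v_def)
          then show ?thesis by (simp add: add_increasing2)
        next
          case False
          have "c / s \<le> exp (c / s)" using exp_ge_add_one_self[of "c / s"] by linarith
          then have "(c / s) * exp (- (c / s)) \<le> exp (c / s) * exp (- (c / s))" by (rule mult_right_mono) simp
          then have "(c / s) * exp (- c / s) \<le> 1" by (simp add: exp_add[symmetric])
          then have "exp (- c / s) \<le> s / c" using True c by (simp add: field_simps)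
          then have "e c s \<le> s powr (a - 1) * (s / c)" unfolding e_def by (intro mult_left_mono) auto
          also have "\<dots> = (1 / c) * s powr a" using True by (simp add: powr_diff)
          finally have "e c s * norm (u s) \<le> (1 / c) * (s powr a * norm (u s))"
            by (metis mult.assoc mult_right_mono norm_ge_zero)
          then have "ennreal (e c s) * ?U s \<le> ennreal (1 / c) * ennreal (s powr a * norm (u s))"
            using c by (simp add: ennreal_mult'[symmetric] e_def)
          also have "\<dots> \<le> ennreal (1 / c) * (1 + ?P s)"
            by (intro mult_left_mono le_1_add_epow p) auto
          also have "(1::ennreal) = indicator {0<..t} s" using True False by simp
          finally show ?thesis by (simp add: add_increasing)
        qed
      qed (use u0 in simp)
    qed
    also have "\<dots> = wnn 1 (\<lambda>s. ennreal (norm (v s))) t + ennreal (1 / c) * (ennreal t + Npow p a u)"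
      unfolding wnn_def Npow_def using t by (simp add: nn_integral_add nn_integral_cmult)
    also have "\<dots> < top" using t u by (simp add: wLp_def ennreal_mult_less_top)
    finally show ?thesis .
  qed
  have zero: "(LINT s|lborel. e c s *\<^sub>R u s) = 0" if c: "0 < c" for c
  proof -
    define \<phi> where "\<phi> = (\<lambda>t. indicator {0<..} t * (t powr (- a - 1) * exp (- c / t)) :: real)"
    have [measurable]: "\<phi> \<in> borel_measurable borel" unfolding \<phi>_def by measurable
    have \<phi>0: "0 \<le> \<phi> t" for t by (simp add: \<phi>_def)
    have nn: "(\<integral>\<^sup>+t. ennreal (\<phi> t * wker a t s) \<partial>lborel) = ennreal (c powr (- a) * e c s)" if "0 < s" for s
      using exp_reciprocal_wker[OF a c that] \<phi>0 a by (simp add: \<phi>_def e_def ennreal_mult' mult.assoc)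
    have "0 = (LINT t|lborel. \<phi> t *\<^sub>R wint a u t)"
    proof -
      have "AE t in lborel. \<phi> t *\<^sub>R wint a u t = 0"
        using z by eventually_elim (auto simp: \<phi>_def)
      then show ?thesis by (subst integral_eq_zero_AE) auto
    qed
    also have "\<dots> = (LINT t|lborel. LINT s|lborel. (\<phi> t * wker a t s) *\<^sub>R u s)"
      unfolding wint_def by (simp flip: integral_scaleR_right scaleR_scaleR)
    also have "\<dots> = (LINT s|lborel. LINT t|lborel. (\<phi> t * wker a t s) *\<^sub>R u s)"
    proof (rule lborel_Fubini)
      have "(\<integral>\<^sup>+t. \<integral>\<^sup>+s. ennreal (norm ((\<phi> t * wker a t s) *\<^sub>R u s)) \<partial>lborel \<partial>lborel)
        = (\<integral>\<^sup>+s. \<integral>\<^sup>+t. ennreal (norm ((\<phi> t * wker a t s) *\<^sub>R u s)) \<partial>lborel \<partial>lborel)"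
        by (rule lborel_pair.Fubini'[symmetric]) measurable
      also have "\<dots> = (\<integral>\<^sup>+s. ennreal (c powr (- a)) * (ennreal (e c s) * ?U s) \<partial>lborel)"
      proof (intro nn_integral_cong)
        fix s
        show "(\<integral>\<^sup>+t. ennreal (norm ((\<phi> t * wker a t s) *\<^sub>R u s)) \<partial>lborel) = ennreal (c powr (- a)) * (ennreal (e c s) * ?U s)"
        proof (cases "0 < s")
          case True
          have "(\<integral>\<^sup>+t. ennreal (norm ((\<phi> t * wker a t s) *\<^sub>R u s)) \<partial>lborel) = (\<integral>\<^sup>+t. ennreal (\<phi> t * wker a t s) * ?U s \<partial>lborel)"
            using \<phi>0 a by (intro nn_integral_cong) (simp only: ennreal_norm_scaleR mult_nonneg_nonneg wker_nonneg)
          also have "\<dots> = ennreal (c powr (- a) * e c s) * ?U s"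
            by (subst nn_integral_multc, measurable, subst nn[OF True]) simp
          finally show ?thesis by (simp add: ennreal_mult' mult.assoc)
        qed (use u0 in simp)
      qed
      also have "\<dots> < top" using fin[OF c] by (simp add: nn_integral_cmult ennreal_mult_less_top)
      finally show "(\<integral>\<^sup>+t. \<integral>\<^sup>+s. ennreal (norm ((\<phi> t * wker a t s) *\<^sub>R u s)) \<partial>lborel \<partial>lborel) < top" .
    qed measurable
    also have "\<dots> = (LINT s|lborel. c powr (- a) *\<^sub>R (e c s *\<^sub>R u s))"
    proof (intro Bochner_Integration.integral_cong refl)
      fix s
      show "(LINT t|lborel. (\<phi> t * wker a t s) *\<^sub>R u s) = c powr (- a) *\<^sub>R (e c s *\<^sub>R u s)"
      proof (cases "0 < s")
        case True
        have "has_bochner_integral lborel (\<lambda>t. \<phi> t * wker a t s) (c powr (- a) * e c s)"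
          using nn[OF True] \<phi>0 a by (intro has_bochner_integral_nn_integral) (auto simp: e_def)
        then have "(LINT t|lborel. (\<phi> t * wker a t s) *\<^sub>R u s) = (c powr (- a) * e c s) *\<^sub>R u s"
          by (intro has_bochner_integral_integral_eq has_bochner_integral_scaleR_left) auto
        then show ?thesis by simp
      qed (use u0 in simp)
    qed
    also have "\<dots> = c powr (- a) *\<^sub>R (LINT s|lborel. e c s *\<^sub>R u s)"
      by (rule integral_scaleR_right)
    finally show ?thesis using c by simp
  qed
  \<comment> \<open>One factor \<open>exp (- 1 / s)\<close> stays inside \<open>G\<close> to make it
    integrable, so the moment of order \<open>n\<close> corresponds to
    \<open>c = n + 1\<close>.\<close>
  define G where "G = (\<lambda>s. e 1 s *\<^sub>R u s)"
  have "AE s in lborel. G s = 0"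
  proof (rule AE_zero_if_exp_moments_zero)
    show "integrable lborel G"
      unfolding G_def integrable_iff_bounded using fin[of 1] by (simp add: e_def ennreal_mult')
    show "\<forall>s\<le>0. G s = 0" using u0 by (simp add: G_def)
    fix n :: nat
    have "exp (- 1 / s) ^ n *\<^sub>R G s = e (real n + 1) s *\<^sub>R u s" for s
      by (simp add: G_def e_def exp_of_nat_mult[symmetric] exp_add[symmetric] mult_ac add_divide_distrib)
    then show "(LINT s|lborel. exp (- 1 / s) ^ n *\<^sub>R G s) = 0" using zero[of "real n + 1"] by simp
  qed
  then show ?thesis
  proof eventually_elim
    case (elim s)
    then show ?case using u0 by (cases "0 < s") (auto simp: G_def e_def)
  qed
qed

section \<open>Borel representatives\<close>

lemma AE_Rpos_iff: "(AE t in Rpos. P t) \<longleftrightarrow> (AE t in lborel. 0 < t \<longrightarrow> P t)"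
  by (subst AE_restrict_space_iff) (auto simp: AE_completion_iff)

text \<open>The definitions integrate over \<open>lebesgue\<close>, while iterated integrals are
  handled over \<open>lborel\<close>. Equality almost everywhere carries measurability,
  integrability and the integral across.\<close>

lemma lebesgue_borel_version:
  fixes G :: "real \<Rightarrow> 'b::euclidean_space"
  assumes k: "k \<in> borel_measurable borel" and ae: "AE s in lborel. G s = k s"
  shows "G \<in> borel_measurable lebesgue"
    and "integrable lebesgue G \<longleftrightarrow> integrable lborel k"
    and "integral\<^sup>L lebesgue G = integral\<^sup>L lborel k"
proof -
  have ae': "AE s in lebesgue. k s = G s"
    using ae by (auto simp: AE_completion_iff elim: eventually_mono)
  have km: "k \<in> borel_measurable lebesgue" using k by (intro measurable_completion) simp
  show Gm: "G \<in> borel_measurable lebesgue" by (rule borel_measurable_AE[OF km ae'])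
  have "integrable lebesgue G \<longleftrightarrow> integrable lebesgue k"
    by (intro integrable_cong_AE Gm km) (use ae' in \<open>auto elim: eventually_mono\<close>)
  also have "\<dots> \<longleftrightarrow> integrable lborel k" using k by (intro integrable_completion) simp
  finally show "integrable lebesgue G \<longleftrightarrow> integrable lborel k" .
  have "integral\<^sup>L lebesgue G = integral\<^sup>L lebesgue k"
    by (intro integral_cong_AE Gm km) (use ae' in \<open>auto elim: eventually_mono\<close>)
  also have "\<dots> = integral\<^sup>L lborel k" using k by (intro integral_completion) simp
  finally show "integral\<^sup>L lebesgue G = integral\<^sup>L lborel k" .
qed

text \<open>
  Iterated integrals are only handled conveniently for Borel functions, so that each element of an
  \<open>L\<^sub>p\<close>-type space is replaced by a Borel representative that vanishes on \<open>{..0}\<close>.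
\<close>

definition borel_version :: "(real \<Rightarrow> complex) \<Rightarrow> (real \<Rightarrow> complex) \<Rightarrow> bool" where
  "borel_version f f' \<longleftrightarrow> f' \<in> borel_measurable borel \<and> (\<forall>t\<le>0. f' t = 0) \<and> (AE t in lborel. 0 < t \<longrightarrow> f t = f' t)"

lemma borel_version_ex:
  assumes "f \<in> borel_measurable Rpos" shows "\<exists>f'. borel_version f f'"
proof -
  define g where "g = (\<lambda>x. if x \<in> {0<..} then f x else 0)"
  have g: "g \<in> borel_measurable lebesgue"
    unfolding g_def using assms by (subst borel_measurable_if) auto
  obtain r where r: "r \<in> borel_measurable borel" "AE x in lborel. Re (g x) = r x"
    using completion_ex_borel_measurable_real[of "\<lambda>x. Re (g x)" lborel] g by auto
  obtain i where i: "i \<in> borel_measurable borel" "AE x in lborel. Im (g x) = i x"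
    using completion_ex_borel_measurable_real[of "\<lambda>x. Im (g x)" lborel] g by auto
  have "borel_version f (\<lambda>x. indicator {0<..} x *\<^sub>R Complex (r x) (i x))"
    unfolding borel_version_def
  proof (intro conjI)
    show "(\<lambda>x. indicator {0<..} x *\<^sub>R Complex (r x) (i x)) \<in> borel_measurable borel"
      unfolding Complex_eq using r(1) i(1) by measurable
    show "AE t in lborel. 0 < t \<longrightarrow> f t = indicator {0<..} t *\<^sub>R Complex (r t) (i t)"
      using r(2) i(2) by eventually_elim (auto simp: g_def complex_eq_iff)
  qed auto
  then show ?thesis by blast
qed

lemma borel_version_measurable_Rpos:
  assumes "borel_version f f'" shows "f \<in> borel_measurable Rpos"
proof -
  have "(\<lambda>x. if x \<in> {0<..} then f x else 0) \<in> borel_measurable lebesgue"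
  proof (rule lebesgue_borel_version(1))
    show "f' \<in> borel_measurable borel" using assms by (simp add: borel_version_def)
    have "AE t in lborel. 0 < t \<longrightarrow> f t = f' t" using assms by (simp add: borel_version_def)
    then show "AE s in lborel. (if s \<in> {0<..} then f s else 0) = f' s"
      by eventually_elim (use assms in \<open>auto simp: borel_version_def\<close>)
  qed
  then show ?thesis by (rule borel_measurable_if_D)
qed

lemma Npow_0:
  assumes "\<forall>t\<le>0. u t = 0"
  shows "Npow p 0 u = (\<integral>\<^sup>+t. ennreal (norm (u t) powr p) \<partial>lborel)"
  unfolding Npow_def using assms by (intro nn_integral_cong) (metis epow_ennreal linorder_not_less mult_1 mult_zero_right norm_ge_zero norm_zero order.strict_iff_not powr_zero_eq_one)

lemma powr_integral_Npow:
  assumes f: "borel_version f f'"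
  shows "integrable Rpos (\<lambda>t. norm (f t) powr p) \<longleftrightarrow> Npow p 0 f' < top" (is ?A)
    and "(LINT t|Rpos. norm (f t) powr p) = enn2real (Npow p 0 f')" (is ?B)
proof -
  have [measurable]: "f' \<in> borel_measurable borel" and f0: "\<forall>t\<le>0. f' t = 0" using f by (auto simp: borel_version_def)
  have "AE t in lborel. 0 < t \<longrightarrow> f t = f' t" using f by (simp add: borel_version_def)
  then have ae: "AE t in lborel. indicator {0<..} t *\<^sub>R (norm (f t) powr p) = norm (f' t) powr p"
    by eventually_elim (use f0 in \<open>auto simp: indicator_def\<close>)
  have m: "(\<lambda>t. norm (f' t) powr p) \<in> borel_measurable borel" by measurable
  have "integrable Rpos (\<lambda>t. norm (f t) powr p) \<longleftrightarrow> integrable lborel (\<lambda>t. norm (f' t) powr p)"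
    by (subst integrable_restrict_space) (simp, rule lebesgue_borel_version(2)[OF m ae])
  also have "\<dots> \<longleftrightarrow> Npow p 0 f' < top"
    unfolding integrable_iff_bounded by (simp add: Npow_0 f0)
  finally show ?A .
  have "(LINT t|Rpos. norm (f t) powr p) = (LINT t|lborel. norm (f' t) powr p)"
    by (subst integral_restrict_space) (simp, rule lebesgue_borel_version(3)[OF m ae])
  also have "\<dots> = enn2real (\<integral>\<^sup>+t. ennreal (norm (f' t) powr p) \<partial>lborel)"
    by (intro integral_eq_nn_integral) auto
  finally show ?B by (simp add: Npow_0 f0)
qed

lemma Lp_iff_borel_version:
  "f \<in> Lp p \<longleftrightarrow> (\<exists>f'. borel_version f f' \<and> f' \<in> wLp p 0)"
proof
  assume "f \<in> Lp p"
  then have f: "f \<in> borel_measurable Rpos" "integrable Rpos (\<lambda>t. norm (f t) powr p)" by (auto simp: Lp_def)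
  obtain f' where f': "borel_version f f'" using borel_version_ex[OF f(1)] by blast
  with f(2) show "\<exists>f'. borel_version f f' \<and> f' \<in> wLp p 0"
    by (auto simp: powr_integral_Npow[OF f'] wLp_def borel_version_def)
next
  assume "\<exists>f'. borel_version f f' \<and> f' \<in> wLp p 0"
  then obtain f' where f': "borel_version f f'" "f' \<in> wLp p 0" by blast
  then show "f \<in> Lp p"
    unfolding Lp_def using powr_integral_Npow[OF f'(1)] borel_version_measurable_Rpos by (auto simp: wLp_def)
qed

lemma Lp_norm_borel_version:
  assumes "borel_version f f'" shows "Lp_norm p f = enn2real (Npow p 0 f') powr (1 / p)"
  unfolding Lp_norm_def powr_integral_Npow(2)[OF assms] ..

lemma Npow_weight: "Npow p 0 (\<lambda>t. t powr \<alpha> *\<^sub>R u t) = Npow p \<alpha> u" if "\<forall>t\<le>0. u t = 0"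
  unfolding Npow_def using that by (intro nn_integral_cong arg_cong[where f="epow p"] arg_cong[where f=ennreal])
    (metis abs_of_nonneg linorder_not_less mult_1 mult_zero_right norm_scaleR norm_zero order.strict_iff_not powr_ge_zero powr_zero_eq_one)

lemma borel_version_mult:
  assumes f: "borel_version f f'" and c: "c \<in> borel_measurable borel"
  shows "borel_version (\<lambda>t. (c t :: real) *\<^sub>R f t) (\<lambda>t. c t *\<^sub>R f' t)"
proof -
  have [measurable]: "f' \<in> borel_measurable borel" "c \<in> borel_measurable borel" using assms by (auto simp: borel_version_def)
  have "AE t in lborel. 0 < t \<longrightarrow> f t = f' t" using f by (simp add: borel_version_def)
  then have "AE t in lborel. 0 < t \<longrightarrow> c t *\<^sub>R f t = c t *\<^sub>R f' t" by eventually_elim auto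
  then show ?thesis using f by (auto simp: borel_version_def)
qed

lemma Lp_weighted_iff_borel_version:
  "h \<in> Lp_weighted p \<alpha> \<longleftrightarrow> (\<exists>h'. borel_version h h' \<and> h' \<in> wLp p \<alpha>)"
proof
  assume "h \<in> Lp_weighted p \<alpha>"
  then have h: "h \<in> borel_measurable Rpos" "(\<lambda>t. t powr \<alpha> *\<^sub>R h t) \<in> Lp p" by (auto simp: Lp_weighted_def)
  obtain h' where h': "borel_version h h'" using borel_version_ex[OF h(1)] by blast
  then have b: "borel_version (\<lambda>t. t powr \<alpha> *\<^sub>R h t) (\<lambda>t. t powr \<alpha> *\<^sub>R h' t)" by (rule borel_version_mult) measurable
  from h(2) have "integrable Rpos (\<lambda>t. norm (t powr \<alpha> *\<^sub>R h t) powr p)" by (simp add: Lp_def del: norm_scaleR)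
  then have "Npow p 0 (\<lambda>t. t powr \<alpha> *\<^sub>R h' t) < top" unfolding powr_integral_Npow(1)[OF b] .
  then show "\<exists>h'. borel_version h h' \<and> h' \<in> wLp p \<alpha>"
    using h' by (auto simp: wLp_def borel_version_def Npow_weight)
next
  assume "\<exists>h'. borel_version h h' \<and> h' \<in> wLp p \<alpha>"
  then obtain h' where h': "borel_version h h'" "h' \<in> wLp p \<alpha>" by blast
  have b: "borel_version (\<lambda>t. t powr \<alpha> *\<^sub>R h t) (\<lambda>t. t powr \<alpha> *\<^sub>R h' t)" using h'(1) by (rule borel_version_mult) measurable
  have "(\<lambda>t. t powr \<alpha> *\<^sub>R h' t) \<in> wLp p 0"
    using h'(2) by (auto simp: wLp_def Npow_weight)
  with b have "(\<lambda>t. t powr \<alpha> *\<^sub>R h t) \<in> Lp p" unfolding Lp_iff_borel_version by blast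
  with h'(1) show "h \<in> Lp_weighted p \<alpha>" unfolding Lp_weighted_def by (auto intro: borel_version_measurable_Rpos)
qed

text \<open>Valid at every \<open>t > 0\<close> and not just almost everywhere, since the integral
  does not see a change of \<open>h\<close> on a null set. The pointwise estimate of the derivative
  depends on this.\<close>

lemma weyl_borel_version:
  assumes h: "borel_version h h'" and \<nu>: "0 < \<nu>" and t: "0 < t"
  shows "set_integrable lebesgue {t<..} (weyl_integrand \<nu> h t) \<longleftrightarrow> wnn \<nu> (\<lambda>s. ennreal (norm (h' s))) t < top" (is ?A)
    and "weyl_integral \<nu> h t = wint \<nu> h' t" (is ?B)
proof -
  have [measurable]: "h' \<in> borel_measurable borel" using h by (auto simp: borel_version_def)
  have G: "0 < Gamma \<nu>" using \<nu> by (rule Gamma_real_pos)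
  have ae: "AE s in lborel. indicator {t<..} s *\<^sub>R weyl_integrand \<nu> h t s = Gamma \<nu> *\<^sub>R (wker \<nu> t s *\<^sub>R h' s)"
  proof -
    have "AE t in lborel. 0 < t \<longrightarrow> h t = h' t" using h by (simp add: borel_version_def)
    then show ?thesis by eventually_elim (use t G in \<open>auto simp: weyl_integrand_def wker_def indicator_def\<close>)
  qed
  have m: "(\<lambda>s. Gamma \<nu> *\<^sub>R (wker \<nu> t s *\<^sub>R h' s)) \<in> borel_measurable borel" by measurable
  have "set_integrable lebesgue {t<..} (weyl_integrand \<nu> h t) \<longleftrightarrow> integrable lborel (\<lambda>s. Gamma \<nu> *\<^sub>R (wker \<nu> t s *\<^sub>R h' s))"
    unfolding set_integrable_def by (rule lebesgue_borel_version(2)[OF m ae])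
  also have "\<dots> \<longleftrightarrow> integrable lborel (\<lambda>s. wker \<nu> t s *\<^sub>R h' s)"
    using G integrable_scaleR_right[of "1 / Gamma \<nu>" lborel "\<lambda>s. Gamma \<nu> *\<^sub>R (wker \<nu> t s *\<^sub>R h' s)"]
      integrable_scaleR_right[of "Gamma \<nu>" lborel "\<lambda>s. wker \<nu> t s *\<^sub>R h' s"]
    by auto
  finally show ?A using \<nu> by (simp add: integrable_wker_iff)
  have "set_lebesgue_integral lebesgue {t<..} (weyl_integrand \<nu> h t) = (LINT s|lborel. Gamma \<nu> *\<^sub>R (wker \<nu> t s *\<^sub>R h' s))"
    unfolding set_lebesgue_integral_def by (rule lebesgue_borel_version(3)[OF m ae])
  also have "\<dots> = Gamma \<nu> *\<^sub>R wint \<nu> h' t" unfolding wint_def by (rule integral_scaleR_right)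
  finally show ?B unfolding weyl_integral_def using G by simp
qed

section \<open>From the Cesaro operator to Weyl integrals\<close>

lemma cesaro_adj_eq_weyl_integral:
  assumes \<alpha>: "0 < \<alpha>" and s: "0 < s"
  shows "cesaro_adj \<alpha> g s = weyl_integral \<alpha> (\<lambda>u. (Gamma (\<alpha> + 1) * u powr (- \<alpha>)) *\<^sub>R g u) s"
proof -
  \<comment> \<open>The functional equation of Gamma reconciles the factor \<open>\<alpha>\<close>
    of \<open>cesaro_adj\<close> with the factor \<open>1 / Gamma \<alpha>\<close> of
    \<open>weyl_integral\<close>.\<close>
  have G: "0 < Gamma \<alpha>" "Gamma (\<alpha> + 1) = \<alpha> * Gamma \<alpha>" using \<alpha> by (auto simp: Gamma_real_pos intro!: Gamma_plus1 dest: nonpos_Ints_nonpos)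
  have "indicator {s<..} u *\<^sub>R weyl_integrand \<alpha> (\<lambda>u. (Gamma (\<alpha> + 1) * u powr (- \<alpha>)) *\<^sub>R g u) s u
    = Gamma (\<alpha> + 1) *\<^sub>R (indicator {s<..} u *\<^sub>R (((u - s) powr (\<alpha> - 1) / u powr \<alpha>) *\<^sub>R g u))" for u
    by (auto simp: weyl_integrand_def powr_minus divide_inverse)
  then show ?thesis
    unfolding cesaro_adj_def weyl_integral_def set_lebesgue_integral_def
    using G by (simp only: integral_scaleR_right) simp
qed

text \<open>
  \<open>u\<close> is a Borel representative of \<open>W\<^sup>\<alpha> f\<close>.
\<close>

definition T_rep :: "real \<Rightarrow> real \<Rightarrow> (real \<Rightarrow> complex) \<Rightarrow> (real \<Rightarrow> complex) \<Rightarrow> bool" where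
  "T_rep p \<alpha> f u \<longleftrightarrow> u \<in> wLp p \<alpha> \<and> (AE t in lborel. 0 < t \<longrightarrow> f t = (if \<alpha> = 0 then u t else wint \<alpha> u t))"

lemma T_repD:
  assumes "T_rep p \<alpha> f u"
  shows "u \<in> wLp p \<alpha>" "u \<in> borel_measurable borel" "\<And>t. t \<le> 0 \<Longrightarrow> u t = 0" "Npow p \<alpha> u < top"
  using assms by (auto simp: T_rep_def wLp_def)

lemma T_rep_0: "T_rep p 0 f u \<longleftrightarrow> borel_version f u \<and> u \<in> wLp p 0"
  by (auto simp: T_rep_def borel_version_def wLp_def)

lemma Npow_scaleR:
  assumes "0 < p" "0 \<le> c" and [measurable]: "u \<in> borel_measurable borel"
  shows "Npow p \<alpha> (\<lambda>t. c *\<^sub>R u t) = ennreal (c powr p) * Npow p \<alpha> u"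
proof -
  have "ennreal (t powr \<alpha> * norm (c *\<^sub>R u t)) = ennreal c * ennreal (t powr \<alpha> * norm (u t))" for t
    using assms by (simp add: ennreal_mult'[symmetric] mult.left_commute)
  then show ?thesis unfolding Npow_def using assms
    by (simp add: epow_mult nn_integral_cmult del: norm_scaleR)
qed

lemma Npow_cong_AE:
  assumes "AE t in lborel. u t = v t" shows "Npow p \<alpha> u = Npow p \<alpha> v"
  unfolding Npow_def by (intro nn_integral_cong_AE) (use assms in \<open>eventually_elim, simp\<close>)

text \<open>The representative satisfies \<open>t powr \<alpha> *\<^sub>R u t = Gamma (\<alpha> + 1)
  *\<^sub>R g' t\<close>, where \<open>g'\<close> is a Borel version of \<open>g\<close>; this
  matches the Gamma factor in \<open>T_norm\<close>. The last conjunct is the link to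
  \<open>W\<close>.\<close>

lemma cesaro_rep:
  assumes p: "1 \<le> p" and \<alpha>: "0 < \<alpha>" and g: "g \<in> Lp p" and fg: "AE t in Rpos. f t = cesaro_adj \<alpha> g t"
  shows "\<exists>u. T_rep p \<alpha> f u \<and> Gamma (\<alpha> + 1) * Lp_norm p g = enn2real (Npow p \<alpha> u) powr (1 / p)
     \<and> borel_version (\<lambda>t. (Gamma (\<alpha> + 1) * t powr (- \<alpha>)) *\<^sub>R g t) u"
proof -
  have G: "0 < Gamma (\<alpha> + 1)" using \<alpha> by (simp add: Gamma_real_pos)
  obtain g' where g': "borel_version g g'" "g' \<in> wLp p 0" using g unfolding Lp_iff_borel_version by blast
  have g'm [measurable]: "g' \<in> borel_measurable borel" and g'0: "\<forall>t\<le>0. g' t = 0" using g'(2) by (auto simp: wLp_def)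
  define u where "u = (\<lambda>t. (Gamma (\<alpha> + 1) * t powr (- \<alpha>)) *\<^sub>R g' t)"
  have bv: "borel_version (\<lambda>t. (Gamma (\<alpha> + 1) * t powr (- \<alpha>)) *\<^sub>R g t) u"
    unfolding u_def by (intro borel_version_mult g') measurable
  have um: "u \<in> borel_measurable borel" and u0: "\<forall>t\<le>0. u t = 0" using bv by (auto simp: borel_version_def)
  have "t powr \<alpha> *\<^sub>R u t = Gamma (\<alpha> + 1) *\<^sub>R g' t" for t
    using g'0 by (cases "0 < t") (auto simp: u_def powr_minus)
  then have N: "Npow p \<alpha> u = ennreal (Gamma (\<alpha> + 1) powr p) * Npow p 0 g'"
    using Npow_weight[OF u0, of p \<alpha>] Npow_scaleR[of p "Gamma (\<alpha> + 1)" g' 0] p G by simp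
  have "u \<in> wLp p \<alpha>" unfolding wLp_def using um u0 g'(2) by (auto simp: N wLp_def ennreal_mult_less_top)
  moreover have "AE t in lborel. 0 < t \<longrightarrow> f t = wint \<alpha> u t"
  proof -
    have "AE t in lborel. 0 < t \<longrightarrow> f t = cesaro_adj \<alpha> g t" using fg unfolding AE_Rpos_iff .
    then show ?thesis
      by eventually_elim (auto simp: cesaro_adj_eq_weyl_integral[OF \<alpha>] weyl_borel_version(2)[OF bv \<alpha>])
  qed
  ultimately have "T_rep p \<alpha> f u" using \<alpha> by (simp add: T_rep_def)
  moreover have "Gamma (\<alpha> + 1) * Lp_norm p g = enn2real (Npow p \<alpha> u) powr (1 / p)"
    unfolding Lp_norm_borel_version[OF g'(1)] N using G p by (simp add: enn2real_mult powr_mult powr_powr)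
  ultimately show ?thesis using bv by blast
qed

text \<open>For positive order, \<open>cesaro_rep\<close> turns a preimage into a representative;
  conversely \<open>(t powr \<alpha> / Gamma (\<alpha> + 1)) *\<^sub>R u t\<close> is a preimage
  under \<open>cesaro_adj\<close>.\<close>

lemma T_space_iff:
  assumes p: "1 \<le> p" and \<alpha>: "0 \<le> \<alpha>"
  shows "f \<in> T_space p \<alpha> \<longleftrightarrow> (\<exists>u. T_rep p \<alpha> f u)"
proof (cases "\<alpha> = 0")
  case True
  then show ?thesis unfolding T_space_def T_rep_0 by (simp add: Lp_iff_borel_version T_rep_0)
next
  case False
  then have \<alpha>: "0 < \<alpha>" using \<alpha> by simp
  have G: "0 < Gamma (\<alpha> + 1)" using \<alpha> by (simp add: Gamma_real_pos)
  show ?thesis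
  proof
    assume "f \<in> T_space p \<alpha>"
    then obtain g where "g \<in> Lp p" "AE t in Rpos. f t = cesaro_adj \<alpha> g t" using False by (auto simp: T_space_def)
    from cesaro_rep[OF p \<alpha> this] show "\<exists>u. T_rep p \<alpha> f u" by blast
  next
    assume "\<exists>u. T_rep p \<alpha> f u"
    then obtain u where u: "T_rep p \<alpha> f u" by blast
    note [measurable] = T_repD(2)[OF u]
    have u0: "\<forall>t\<le>0. u t = 0" using T_repD(3)[OF u] by blast
    define g where "g = (\<lambda>t. (t powr \<alpha> / Gamma (\<alpha> + 1)) *\<^sub>R u t)"
    have gm: "g \<in> borel_measurable borel" unfolding g_def by measurable
    have "Npow p 0 g = Npow p 0 (\<lambda>t. (1 / Gamma (\<alpha> + 1)) *\<^sub>R (t powr \<alpha> *\<^sub>R u t))" by (simp add: g_def)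
    also have "\<dots> = ennreal ((1 / Gamma (\<alpha> + 1)) powr p) * Npow p \<alpha> u"
      using p G u0 by (subst Npow_scaleR) (simp_all add: Npow_weight)
    finally have "Npow p 0 g < top" using T_repD(4)[OF u] by (simp add: ennreal_mult_less_top)
    then have g: "g \<in> wLp p 0" unfolding wLp_def using gm u0 by (simp add: g_def)
    then have bg: "borel_version g g" by (simp add: borel_version_def wLp_def)
    have gL: "g \<in> Lp p" unfolding Lp_iff_borel_version using g bg by blast
    have "borel_version (\<lambda>t. (Gamma (\<alpha> + 1) * t powr (- \<alpha>)) *\<^sub>R g t) u"
      unfolding borel_version_def using u0 G by (auto simp: g_def powr_minus intro!: AE_I2)
    note w = weyl_borel_version(2)[OF this \<alpha>]
    have "AE t in lborel. 0 < t \<longrightarrow> f t = wint \<alpha> u t" using u False by (simp add: T_rep_def)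
    then have "AE t in lborel. 0 < t \<longrightarrow> f t = cesaro_adj \<alpha> g t"
      by eventually_elim (auto simp: cesaro_adj_eq_weyl_integral[OF \<alpha>] w)
    with gL show "f \<in> T_space p \<alpha>" unfolding T_space_def using False by (auto simp: AE_Rpos_iff)
  qed
qed

section \<open>Linear structure and uniqueness of representatives\<close>

lemma Npow_add_le:
  assumes p: "1 \<le> p" and [measurable]: "u \<in> borel_measurable borel" "v \<in> borel_measurable borel"
  shows "Npow p \<alpha> (\<lambda>t. u t + v t) \<le> ennreal (2 powr p) * (Npow p \<alpha> u + Npow p \<alpha> v)"
proof -
  have "Npow p \<alpha> (\<lambda>t. u t + v t) \<le> (\<integral>\<^sup>+t. ennreal (2 powr p) * (epow p (ennreal (t powr \<alpha> * norm (u t))) + epow p (ennreal (t powr \<alpha> * norm (v t)))) \<partial>lborel)"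
    unfolding Npow_def
  proof (intro nn_integral_mono)
    fix t
    have "ennreal (t powr \<alpha> * norm (u t + v t)) \<le> ennreal (t powr \<alpha> * norm (u t) + t powr \<alpha> * norm (v t))"
      by (intro ennreal_leI) (metis distrib_left mult_left_mono norm_triangle_ineq powr_ge_zero)
    also have "\<dots> = ennreal (t powr \<alpha> * norm (u t)) + ennreal (t powr \<alpha> * norm (v t))" by (rule ennreal_plus) auto
    finally have "epow p (ennreal (t powr \<alpha> * norm (u t + v t))) \<le> epow p (ennreal (t powr \<alpha> * norm (u t)) + ennreal (t powr \<alpha> * norm (v t)))"
      using p by (intro epow_mono) auto
    also have "\<dots> \<le> ennreal (2 powr p) * (epow p (ennreal (t powr \<alpha> * norm (u t))) + epow p (ennreal (t powr \<alpha> * norm (v t))))"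
      using p by (intro epow_add) auto
    finally show "epow p (ennreal (t powr \<alpha> * norm (u t + v t))) \<le> ennreal (2 powr p) * (epow p (ennreal (t powr \<alpha> * norm (u t))) + epow p (ennreal (t powr \<alpha> * norm (v t))))" .
  qed
  also have "\<dots> = ennreal (2 powr p) * (Npow p \<alpha> u + Npow p \<alpha> v)"
    unfolding Npow_def by (simp add: nn_integral_cmult nn_integral_add)
  finally show ?thesis .
qed

lemma Npow_minus [simp]: "Npow p \<alpha> (\<lambda>t. - u t) = Npow p \<alpha> u"
  by (simp add: Npow_def)

lemma wLp_add: "\<lbrakk>1 \<le> p; u \<in> wLp p \<alpha>; v \<in> wLp p \<alpha>\<rbrakk> \<Longrightarrow> (\<lambda>t. u t + v t) \<in> wLp p \<alpha>"
  using Npow_add_le[of p u v \<alpha>] unfolding wLp_def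
  by (auto simp: ennreal_mult_less_top elim!: le_less_trans)

lemma wLp_diff: "\<lbrakk>1 \<le> p; u \<in> wLp p \<alpha>; v \<in> wLp p \<alpha>\<rbrakk> \<Longrightarrow> (\<lambda>t. u t - v t) \<in> wLp p \<alpha>"
  using wLp_add[of p u \<alpha> "\<lambda>t. - v t"] by (auto simp: wLp_def)

lemma wint_diff:
  assumes [measurable]: "u \<in> borel_measurable borel" "v \<in> borel_measurable borel" and a: "0 < a"
    and "wnn a (\<lambda>s. ennreal (norm (u s))) t < top" "wnn a (\<lambda>s. ennreal (norm (v s))) t < top"
  shows "wint a (\<lambda>s. u s - v s) t = wint a u t - wint a v t"
  unfolding wint_def using assms by (simp add: scaleR_diff_right integrable_wker_iff)

lemma T_rep_diff:
  assumes p: "1 \<le> p" and \<alpha>: "0 \<le> \<alpha>" and f: "T_rep p \<alpha> f u" and g: "T_rep p \<alpha> g v"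
  shows "T_rep p \<alpha> (\<lambda>t. f t - g t) (\<lambda>t. u t - v t)"
proof (cases "\<alpha> = 0")
  case True
  with f g have "AE t in lborel. 0 < t \<longrightarrow> f t = u t" "AE t in lborel. 0 < t \<longrightarrow> g t = v t" by (auto simp: T_rep_def)
  then have "AE t in lborel. 0 < t \<longrightarrow> f t - g t = u t - v t" by eventually_elim auto
  then show ?thesis using True f g p by (auto simp: T_rep_def intro: wLp_diff)
next
  case False
  then have \<alpha>: "0 < \<alpha>" using \<alpha> by simp
  note [measurable] = T_repD(2)[OF f] T_repD(2)[OF g]
  have fin: "AE t in lborel. 0 < t \<longrightarrow> wnn \<alpha> (\<lambda>s. ennreal (norm (u s))) t < top" "AE t in lborel. 0 < t \<longrightarrow> wnn \<alpha> (\<lambda>s. ennreal (norm (v s))) t < top"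
    using wnn_finite_AE[of p 0 \<alpha>] T_repD(1)[OF f] T_repD(1)[OF g] p \<alpha> by auto
  have "AE t in lborel. 0 < t \<longrightarrow> f t = wint \<alpha> u t" "AE t in lborel. 0 < t \<longrightarrow> g t = wint \<alpha> v t"
    using f g False by (auto simp: T_rep_def)
  with fin have "AE t in lborel. 0 < t \<longrightarrow> f t - g t = wint \<alpha> (\<lambda>t. u t - v t) t"
    by eventually_elim (auto simp: wint_diff \<alpha>)
  then show ?thesis using False p T_repD(1)[OF f] T_repD(1)[OF g] by (auto simp: T_rep_def intro: wLp_diff)
qed

text \<open>The difference of two representatives represents 0, and for positive order
  \<open>wint_injective\<close> finishes the argument.\<close>

lemma T_rep_unique:
  assumes p: "1 \<le> p" and \<alpha>: "0 \<le> \<alpha>" and u: "T_rep p \<alpha> f u" and v: "T_rep p \<alpha> f v"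
  shows "AE t in lborel. u t = v t"
proof -
  have d: "T_rep p \<alpha> (\<lambda>t. 0) (\<lambda>t. u t - v t)" using T_rep_diff[OF p \<alpha> u v] by simp
  have "AE t in lborel. u t - v t = 0"
  proof (cases "\<alpha> = 0")
    case True
    then have "AE t in lborel. 0 < t \<longrightarrow> 0 = u t - v t" using d by (simp add: T_rep_def)
    then show ?thesis
    proof eventually_elim
      case (elim t)
      then show ?case using T_repD(3)[OF u, of t] T_repD(3)[OF v, of t] by (cases "0 < t") auto
    qed
  next
    case False
    then have "AE t in lborel. 0 < t \<longrightarrow> wint \<alpha> (\<lambda>t. u t - v t) t = 0" using d by (auto simp: T_rep_def elim: eventually_mono)
    then show ?thesis using wint_injective[OF p _ T_repD(1)[OF d]] False \<alpha> by simp
  qed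
  then show ?thesis by simp
qed

text \<open>The choice made by \<open>SOME\<close> in \<open>cesaro_adj_inv\<close> leads to some
  representative \<open>v\<close>, and by uniqueness it agrees almost everywhere with the given
  \<open>u\<close>. Norm and derivative are thus independent of the choice.\<close>

lemma T_norm_W_rep:
  assumes p: "1 \<le> p" and \<alpha>: "0 \<le> \<alpha>" and u: "T_rep p \<alpha> f u"
  shows "T_norm p \<alpha> f = enn2real (Npow p \<alpha> u) powr (1 / p)"
    and "borel_version (W p \<alpha> f) u"
proof -
  have "T_norm p \<alpha> f = enn2real (Npow p \<alpha> u) powr (1 / p) \<and> borel_version (W p \<alpha> f) u"
  proof (cases "\<alpha> = 0")
    case True
    then have "borel_version f u" using u by (simp add: T_rep_0)
    moreover have "W p \<alpha> f = f" using True by (simp add: W_def fun_eq_iff)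
    ultimately show ?thesis using True by (simp add: T_norm_def Lp_norm_borel_version)
  next
    case False
    then have \<alpha>': "0 < \<alpha>" using \<alpha> by simp
    define g where "g = cesaro_adj_inv p \<alpha> f"
    have "f \<in> T_space p \<alpha>" using T_space_iff[OF p \<alpha>] u by blast
    then have "\<exists>g. g \<in> Lp p \<and> (AE t in Rpos. f t = cesaro_adj \<alpha> g t)" using False by (auto simp: T_space_def)
    from someI_ex[OF this] have g: "g \<in> Lp p" "AE t in Rpos. f t = cesaro_adj \<alpha> g t"
      unfolding g_def cesaro_adj_inv_def by auto
    from cesaro_rep[OF p \<alpha>' g] obtain v where v: "T_rep p \<alpha> f v"
      "Gamma (\<alpha> + 1) * Lp_norm p g = enn2real (Npow p \<alpha> v) powr (1 / p)"
      "borel_version (\<lambda>t. (Gamma (\<alpha> + 1) * t powr (- \<alpha>)) *\<^sub>R g t) v" by blast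
    have uv: "AE t in lborel. v t = u t" using T_rep_unique[OF p \<alpha> v(1) u] .
    have "T_norm p \<alpha> f = enn2real (Npow p \<alpha> u) powr (1 / p)"
      using v(2) False Npow_cong_AE[OF uv] by (simp add: T_norm_def g_def)
    moreover have "(\<lambda>t. (Gamma (\<alpha> + 1) * t powr (- \<alpha>)) *\<^sub>R g t) = W p \<alpha> f"
      using False by (simp add: W_def g_def fun_eq_iff)
    then have "borel_version (W p \<alpha> f) v" using v(3) by simp
    then have "AE t in lborel. 0 < t \<longrightarrow> W p \<alpha> f t = v t" by (simp add: borel_version_def)
    with uv have "AE t in lborel. 0 < t \<longrightarrow> W p \<alpha> f t = u t" by eventually_elim auto
    then have "borel_version (W p \<alpha> f) u" using T_repD(2,3)[OF u] by (simp add: borel_version_def)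
    ultimately show ?thesis by blast
  qed
  then show "T_norm p \<alpha> f = enn2real (Npow p \<alpha> u) powr (1 / p)" "borel_version (W p \<alpha> f) u" by auto
qed

lemma wLp_mono_wint:
  assumes p: "1 \<le> p" and \<alpha>: "0 \<le> \<alpha>" and \<beta>: "\<alpha> < \<beta>" and u: "u \<in> wLp p \<beta>"
  shows "wext (\<beta> - \<alpha>) u \<in> wLp p \<alpha>"
    "Npow p \<alpha> (wext (\<beta> - \<alpha>) u) \<le> ennreal (weyl_const p \<alpha> (\<beta> - \<alpha>) powr p) * Npow p \<beta> u"
proof -
  have a: "0 < \<alpha> + 1 / p" using p \<alpha> by (simp add: add_nonneg_pos)
  show "wext (\<beta> - \<alpha>) u \<in> wLp p \<alpha>" using wext_in_wLp[OF p a, of "\<beta> - \<alpha>" u] \<beta> u by simp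
  show "Npow p \<alpha> (wext (\<beta> - \<alpha>) u) \<le> ennreal (weyl_const p \<alpha> (\<beta> - \<alpha>) powr p) * Npow p \<beta> u"
    using Npow_wext_le[OF p a, of "\<beta> - \<alpha>" u] \<beta> u by (simp add: wLp_def)
qed

lemma wint_wext: "0 \<le> t \<Longrightarrow> wint a (wext b u) t = wint a (wint b u) t"
  unfolding wint_def[of a] by (intro Bochner_Integration.integral_cong refl) (auto simp: wker_def wext_def)

text \<open>The semigroup law splits order \<open>\<beta>\<close> into \<open>\<alpha>\<close> and
  \<open>\<beta> - \<alpha>\<close>, and the inner Weyl integral is the representative of the lower
  order.\<close>

lemma T_rep_lower:
  assumes p: "1 \<le> p" and \<alpha>: "0 \<le> \<alpha>" and \<beta>: "\<alpha> < \<beta>" and u: "T_rep p \<beta> f u"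
  shows "T_rep p \<alpha> f (wext (\<beta> - \<alpha>) u)"
proof -
  note uw = T_repD(1)[OF u] and [measurable] = T_repD(2)[OF u]
  have b: "0 < \<beta>" using \<alpha> \<beta> by simp
  have ae: "AE t in lborel. 0 < t \<longrightarrow> f t = wint \<beta> u t" using u b by (simp add: T_rep_def)
  have "AE t in lborel. 0 < t \<longrightarrow> f t = (if \<alpha> = 0 then wext (\<beta> - \<alpha>) u t else wint \<alpha> (wext (\<beta> - \<alpha>) u) t)"
  proof (cases "\<alpha> = 0")
    case True
    with ae show ?thesis by (simp add: wext_def)
  next
    case False
    then have \<alpha>: "0 < \<alpha>" using \<alpha> by simp
    have "AE t in lborel. 0 < t \<longrightarrow> wnn \<beta> (\<lambda>s. ennreal (norm (u s))) t < top"
      using wnn_finite_AE[of p 0 \<beta> u] p b uw by simp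
    with ae show ?thesis
    proof eventually_elim
      case (elim t)
      show ?case
      proof (cases "0 < t")
        case True
        have "wint \<alpha> (wint (\<beta> - \<alpha>) u) t = wint (\<alpha> + (\<beta> - \<alpha>)) u t"
          using elim True \<alpha> \<beta> by (intro wint_semigroup) auto
        then show ?thesis using elim True False by (simp add: wint_wext)
      qed simp
    qed
  qed
  then show ?thesis using wLp_mono_wint(1)[OF p \<alpha> \<beta> uw] by (simp add: T_rep_def)
qed

section \<open>Smooth functions\<close>

text \<open>\<open>n\<close> derivatives on the whole line, with no continuity asked of the last
  one. The recursive form makes closure properties provable by induction, and only the conjunction
  over all \<open>n\<close> is of interest.\<close>

primrec Ck :: "nat \<Rightarrow> (real \<Rightarrow> complex) \<Rightarrow> bool" where
  "Ck 0 f \<longleftrightarrow> True"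
| "Ck (Suc n) f \<longleftrightarrow> (\<exists>f'. (\<forall>t. (f has_vector_derivative f' t) (at t)) \<and> Ck n f')"

lemma Ck_SucD: "Ck (Suc n) f \<Longrightarrow> Ck n f"
proof (induction n arbitrary: f)
  case (Suc n)
  then obtain f' where "\<forall>t. (f has_vector_derivative f' t) (at t)" "Ck (Suc n) f'" by auto
  then show ?case using Suc.IH by auto
qed simp

lemma Ck_const: "Ck n (\<lambda>t. c)"
proof (induction n arbitrary: c)
  case (Suc n)
  then show ?case by (auto intro!: exI[of _ "\<lambda>t. 0"])
qed simp

lemma Ck_add: "Ck n f \<Longrightarrow> Ck n g \<Longrightarrow> Ck n (\<lambda>t. f t + g t)"
proof (induction n arbitrary: f g)
  case (Suc n)
  then obtain f' g' where "\<forall>t. (f has_vector_derivative f' t) (at t)" "Ck n f'"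
     "\<forall>t. (g has_vector_derivative g' t) (at t)" "Ck n g'" by auto
  then show ?case using Suc.IH by (auto intro!: exI[of _ "\<lambda>t. f' t + g' t"] has_vector_derivative_add)
qed simp

lemma Ck_mult: "Ck n f \<Longrightarrow> Ck n g \<Longrightarrow> Ck n (\<lambda>t. f t * g t)"
proof (induction n arbitrary: f g)
  case (Suc n)
  then obtain f' g' where "\<forall>t. (f has_vector_derivative f' t) (at t)" "Ck n f'"
     "\<forall>t. (g has_vector_derivative g' t) (at t)" "Ck n g'" by auto
  moreover have "Ck n f" "Ck n g" using Suc.prems by (auto intro: Ck_SucD simp del: Ck.simps)
  ultimately show ?case using Suc.IH
    by (auto intro!: exI[of _ "\<lambda>t. f t * g' t + f' t * g t"] has_vector_derivative_mult Ck_add)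
qed simp

lemma Ck_affine: "Ck n f \<Longrightarrow> Ck n (\<lambda>t. f (c * t + d))"
proof (induction n arbitrary: f)
  case (Suc n)
  then obtain f' where f': "\<forall>t. (f has_vector_derivative f' t) (at t)" "Ck n f'" by auto
  have "((\<lambda>t. f (c * t + d)) has_vector_derivative of_real c * f' (c * t + d)) (at t)" for t
  proof -
    have "((\<lambda>t. c * t + d) has_vector_derivative c) (at t)"
      by (auto intro!: derivative_eq_intros simp: has_real_derivative_iff_has_vector_derivative[symmetric])
    from vector_diff_chain_at[OF this f'(1)[rule_format]] show ?thesis
      by (simp add: o_def scaleR_conv_of_real)
  qed
  moreover have "Ck n (\<lambda>t. of_real c * f' (c * t + d))"
    using Suc.IH[OF f'(2)] by (intro Ck_mult Ck_const)
  ultimately show ?case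
    by (auto simp only: Ck.simps intro!: exI[of _ "\<lambda>t. of_real c * f' (c * t + d)"])
qed simp

definition smooth :: "(real \<Rightarrow> complex) \<Rightarrow> bool" where
  "smooth f \<longleftrightarrow> (\<forall>n. Ck n f)"

definition vd :: "(real \<Rightarrow> complex) \<Rightarrow> real \<Rightarrow> complex" where
  "vd f x = vector_derivative f (at x)"

lemma smooth_vd:
  assumes "smooth f" shows "(f has_vector_derivative vd f t) (at t)" "smooth (vd f)"
proof -
  have *: "(\<forall>t. (f has_vector_derivative vd f t) (at t)) \<and> Ck n (vd f)" for n
  proof -
    obtain f' where f': "\<forall>t. (f has_vector_derivative f' t) (at t)" "Ck n f'"
      using assms[unfolded smooth_def, rule_format, of "Suc n"] by auto
    then have "vd f = f'" by (auto simp: vd_def fun_eq_iff intro: vector_derivative_at)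
    with f' show ?thesis by simp
  qed
  then show "(f has_vector_derivative vd f t) (at t)" "smooth (vd f)" by (auto simp: smooth_def)
qed

lemma smooth_const [simp]: "smooth (\<lambda>t. c)" by (simp add: smooth_def Ck_const)
lemma smooth_add: "smooth f \<Longrightarrow> smooth g \<Longrightarrow> smooth (\<lambda>t. f t + g t)" by (simp add: smooth_def Ck_add)
lemma smooth_mult: "smooth f \<Longrightarrow> smooth g \<Longrightarrow> smooth (\<lambda>t. f t * g t)" by (simp add: smooth_def Ck_mult)
lemma smooth_minus: "smooth f \<Longrightarrow> smooth (\<lambda>t. - f t)" using smooth_mult[of "\<lambda>t. -1" f] by simp
lemma smooth_diff: "smooth f \<Longrightarrow> smooth g \<Longrightarrow> smooth (\<lambda>t. f t - g t)" using smooth_add[of f "\<lambda>t. - g t"] smooth_minus[of g] by simp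
lemma smooth_affine: "smooth f \<Longrightarrow> smooth (\<lambda>t. f (c * t + d))" by (simp add: smooth_def Ck_affine)
lemma smooth_scale: "smooth f \<Longrightarrow> smooth (\<lambda>t. f (t / c))" using smooth_affine[of f "1 / c" 0] by simp

lemma smooth_continuous: "smooth f \<Longrightarrow> continuous_on S f"
  by (meson smooth_vd(1) continuous_at_imp_continuous_on has_vector_derivative_continuous)

lemma smooth_measurable [measurable_dest]: "smooth f \<Longrightarrow> f \<in> borel_measurable borel"
  by (simp add: borel_measurable_continuous_onI smooth_continuous)

lemma smooth_vds: "smooth f \<Longrightarrow> smooth ((vd ^^ n) f)"
  by (induction n) (auto intro: smooth_vd)

lemma vd_eqI: "(\<And>t. (f has_vector_derivative f' t) (at t)) \<Longrightarrow> vd f = f'"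
  by (auto simp: vd_def fun_eq_iff intro: vector_derivative_at)

lemma vds_add: "smooth f \<Longrightarrow> smooth g \<Longrightarrow> (vd ^^ n) (\<lambda>t. f t + g t) = (\<lambda>t. (vd ^^ n) f t + (vd ^^ n) g t)"
proof (induction n)
  case (Suc n)
  then show ?case by (auto intro!: vd_eqI has_vector_derivative_add smooth_vd smooth_vds)
qed simp

lemma vds_cmult: "smooth f \<Longrightarrow> (vd ^^ n) (\<lambda>t. c * f t) = (\<lambda>t. c * (vd ^^ n) f t)"
proof (induction n)
  case (Suc n)
  then show ?case by (auto intro!: vd_eqI derivative_intros smooth_vd smooth_vds)
qed simp

lemma vd_zero_on_open:
  assumes "open S" "\<And>t. t \<in> S \<Longrightarrow> f t = 0" "t \<in> S" shows "vd f t = 0"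
proof -
  have "(f has_vector_derivative 0) (at t)"
    by (rule has_vector_derivative_transform_within_open[of "\<lambda>t. 0" _ _ S]) (use assms in auto)
  then show ?thesis by (auto simp: vd_def intro: vector_derivative_at)
qed

lemma vds_zero_on_open:
  assumes "open S" "\<And>t. t \<in> S \<Longrightarrow> f t = 0" "t \<in> S" shows "(vd ^^ n) f t = 0"
  using assms(3) by (induction n arbitrary: t) (use assms vd_zero_on_open[OF assms(1)] in auto)

text \<open>This class is stable under differentiation and under Weyl integration. Test functions on
  the half-line are not: their Weyl integrals need not vanish near 0.\<close>

definition smooth_right :: "(real \<Rightarrow> complex) \<Rightarrow> bool" where
  "smooth_right f \<longleftrightarrow> smooth f \<and> (\<exists>b. \<forall>t\<ge>b. f t = 0)"

lemma smooth_right_measurable: "smooth_right f \<Longrightarrow> f \<in> borel_measurable borel"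
  by (simp add: smooth_right_def smooth_measurable)

lemma smooth_right_vd: assumes "smooth_right f" shows "smooth_right (vd f)"
proof -
  obtain b where b: "\<forall>t\<ge>b. f t = 0" using assms by (auto simp: smooth_right_def)
  have "\<forall>t\<ge>b+1. vd f t = 0"
    using b by (auto intro!: vd_zero_on_open[of "{b<..}"])
  then show ?thesis using assms by (auto simp: smooth_right_def intro: smooth_vd)
qed

lemma smooth_right_vds: "smooth_right f \<Longrightarrow> smooth_right ((vd ^^ n) f)"
  by (induction n) (auto intro: smooth_right_vd)

lemma smooth_right_cmult: "smooth_right f \<Longrightarrow> smooth_right (\<lambda>t. c * f t)"
  by (auto simp: smooth_right_def intro: smooth_mult)

text \<open>The cut at \<open>b\<close> is itself a kernel, as \<open>wker 1 s b\<close> is the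
  indicator of \<open>s < b\<close>; the composition rule then evaluates the majorant.\<close>

lemma wnn_finite_le_const:
  assumes a: "0 < a" and C: "\<And>s. t < s \<Longrightarrow> s < b \<Longrightarrow> h s \<le> ennreal C" and b: "\<And>s. b \<le> s \<Longrightarrow> h s = 0"
  shows "wnn a h t < top"
proof -
  have "wnn a h t \<le> (\<integral>\<^sup>+s. ennreal C * (ennreal (wker a t s) * ennreal (wker 1 s b)) \<partial>lborel)"
    unfolding wnn_def
  proof (intro nn_integral_mono)
    fix s
    show "ennreal (wker a t s) * h s \<le> ennreal C * (ennreal (wker a t s) * ennreal (wker 1 s b))"
    proof (cases "t < s \<and> s < b")
      case True
      then have "ennreal (wker a t s) * h s \<le> ennreal (wker a t s) * ennreal C" by (intro mult_left_mono C) auto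
      then show ?thesis using True by (simp add: wker_def mult.commute)
    next
      case False
      then show ?thesis using b[of s] by (auto simp: wker_def)
    qed
  qed
  also have "\<dots> = ennreal C * ennreal (wker (a + 1) t b)"
    using a by (simp add: nn_integral_cmult wker_convolution)
  also have "\<dots> < top" by (simp add: ennreal_mult_less_top)
  finally show ?thesis .
qed

lemma wnn_finite_bounded:
  fixes h :: "real \<Rightarrow> complex"
  assumes h: "continuous_on UNIV h" "\<forall>t\<ge>b. h t = 0" and a: "0 < a"
  shows "wnn a (\<lambda>s. ennreal (norm (h s))) t < top"
proof -
  define B where "B = max b t + 1"
  have "bounded (h ` {t..B})"
    using h(1) by (intro compact_imp_bounded compact_continuous_image) (auto intro: continuous_on_subset)
  then obtain C where "\<forall>s\<in>{t..B}. norm (h s) \<le> C" by (auto simp: bounded_iff)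
  then have C: "norm (h s) \<le> C" if "t < s" "s < B" for s using that by auto
  show ?thesis
    by (rule wnn_finite_le_const[OF a, where C=C and b=B]) (use C h(2) in \<open>auto simp: B_def intro: ennreal_leI\<close>)
qed

lemma wnn_finite_smooth: "smooth_right h \<Longrightarrow> 0 < a \<Longrightarrow> wnn a (\<lambda>s. ennreal (norm (h s))) t < top"
  by (auto simp: smooth_right_def intro: wnn_finite_bounded smooth_continuous)

lemma wint_1_eq:
  "wint 1 h t = (LINT s:{t<..}|lborel. h s)"
  unfolding wint_def set_lebesgue_integral_def
  by (intro Bochner_Integration.integral_cong refl) (auto simp: wker_def indicator_def)

lemma wint_1_vd:
  assumes f: "smooth_right f" shows "wint 1 (\<lambda>s. - vd f s) t = f t"
proof -
  obtain b where b: "\<forall>t\<ge>b. f t = 0" using f by (auto simp: smooth_right_def)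
  have sm: "smooth f" using f by (simp add: smooth_right_def)
  define B where "B = max b t"
  have z: "vd f s = 0" if "B < s" for s
    using b that by (intro vd_zero_on_open[of "{B<..}"]) (auto simp: B_def)
  have "has_bochner_integral lborel (\<lambda>x. indicator {t..B} x *\<^sub>R - vd f x) (- f B - - f t)"
  proof (rule has_bochner_integral_FTC_Icc)
    fix x
    show "((\<lambda>x. - f x) has_vector_derivative - vd f x) (at x within {t..B})"
      by (rule has_vector_derivative_at_within[OF has_vector_derivative_minus[OF smooth_vd(1)[OF sm]]])
    show "continuous_on {t..B} (\<lambda>x. - vd f x)"
      by (rule continuous_on_minus[OF smooth_continuous[OF smooth_vd(2)[OF sm]]])
  qed (simp add: B_def)
  from has_bochner_integral_integral_eq[OF this]
  have "(LINT x|lborel. indicator {t..B} x *\<^sub>R - vd f x) = f t"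
    using b by (simp add: B_def)
  also have "(LINT x|lborel. indicator {t..B} x *\<^sub>R - vd f x) = wint 1 (\<lambda>s. - vd f s) t"
    unfolding wint_def
  proof (intro integral_cong_AE)
    have [measurable]: "vd f \<in> borel_measurable borel" using smooth_vd(2)[OF sm] by measurable
    show "(\<lambda>x. indicator {t..B} x *\<^sub>R - vd f x) \<in> borel_measurable lborel" by measurable
    show "(\<lambda>s. wker 1 t s *\<^sub>R - vd f s) \<in> borel_measurable lborel" by measurable
    show "AE x in lborel. indicator {t..B} x *\<^sub>R - vd f x = wker 1 t x *\<^sub>R - vd f x"
    proof (rule eventually_mono[OF AE_lborel_singleton[of t]])
      fix x assume "x \<noteq> t"
      then show "indicator {t..B} x *\<^sub>R - vd f x = wker 1 t x *\<^sub>R - vd f x"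
        using z[of x] by (cases "B < x") (auto simp: indicator_def wker_def)
    qed
  qed
  finally show ?thesis by simp
qed

text \<open>Weyl derivatives of integer order are ordinary derivatives up to sign. The fundamental
  theorem of calculus gives order 1, and the semigroup law adds one order at a time.\<close>

lemma wint_vds:
  assumes f: "smooth_right f" shows "wint (Suc n) (\<lambda>s. (-1) ^ Suc n * (vd ^^ Suc n) f s) t = f t"
  using f
proof (induction n arbitrary: f t)
  case 0
  then show ?case using wint_1_vd[of f t] by simp
next
  case (Suc n)
  have IH: "wint (Suc n) (\<lambda>s. (-1) ^ Suc n * (vd ^^ Suc n) (vd f) s) s = vd f s" for s
    by (rule Suc.IH[OF smooth_right_vd[OF Suc.prems]])
  let ?h = "\<lambda>s. (-1) ^ Suc n * (vd ^^ Suc n) (vd f) s"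
  have h: "smooth_right ?h"
    by (intro smooth_right_cmult smooth_right_vds smooth_right_vd Suc.prems)
  then have [measurable]: "?h \<in> borel_measurable borel" by (rule smooth_right_measurable)
  have "wint 1 (wint (Suc n) (\<lambda>s. - ?h s)) t = wint (1 + real (Suc n)) (\<lambda>s. - ?h s) t"
  proof (rule wint_semigroup)
    show "wnn (1 + real (Suc n)) (\<lambda>s. ennreal (norm (- ?h s))) t < top"
      using wnn_finite_smooth[OF h, of "1 + real (Suc n)" t] by (simp only: norm_minus_cancel)
    show "(\<lambda>s. - ?h s) \<in> borel_measurable borel" by measurable
  qed simp_all
  moreover have "wint (Suc n) (\<lambda>s. - ?h s) = (\<lambda>s. - vd f s)"
    using IH unfolding wint_def fun_eq_iff by (simp del: funpow.simps power_Suc)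
  moreover have "- ?h s = (-1) ^ Suc (Suc n) * (vd ^^ Suc (Suc n)) f s" for s
    by (simp add: funpow_swap1)
  ultimately show ?case using wint_1_vd[OF Suc.prems, of t] by simp
qed

lemma wint_smooth_zero: "\<forall>t\<ge>b. h t = 0 \<Longrightarrow> b \<le> t \<Longrightarrow> wint a h t = 0"
  unfolding wint_def by (subst integral_eq_zero_AE) (auto simp: wker_def)

text \<open>Translation to the gauge integral, for which continuity and differentiability of
  indefinite integrals can be quoted. The finiteness condition admits an unbounded
  \<open>m\<close>.\<close>

lemma wint_1_indefinite:
  fixes m :: "real \<Rightarrow> complex"
  assumes [measurable]: "m \<in> borel_measurable borel" and B: "\<forall>t\<ge>B. m t = 0"
    and fin: "wnn 1 (\<lambda>s. ennreal (norm (m s))) a < top" and t: "a \<le> t" "t \<le> B"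
  shows "m integrable_on {a..B}" "wint 1 m t = integral {t..B} m"
proof -
  have "(\<lambda>s. wker 1 a s *\<^sub>R m s) = (\<lambda>s. indicator {a<..} s *\<^sub>R m s)"
    by (auto simp: wker_def indicator_def fun_eq_iff)
  then have i: "set_integrable lborel {a<..} m"
    using fin integrable_wker_iff[of m 1 a] by (simp add: set_integrable_def)
  have i1: "set_integrable lborel {t<..B} m" if "a \<le> t" for t
    by (rule set_integrable_subset[OF i]) (use that in \<open>simp_all add: subset_eq\<close>)
  have ae: "m integrable_on {t..B} \<and> set_lebesgue_integral lborel {t<..B} m = integral {t..B} m" if "a \<le> t" "t \<le> B" for t
  proof -
    have "(m has_integral set_lebesgue_integral lborel {t<..B} m) {t<..B}"
      using set_borel_integral_eq_integral[OF i1[OF that(1)]] by (metis has_integral_integral)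
    then have "(m has_integral set_lebesgue_integral lborel {t<..B} m) {t..B}"
    proof (rule has_integral_spike_set_eq[THEN iffD1, rotated 2])
      show "negligible {x \<in> {t<..B} - {t..B}. m x \<noteq> 0}"
        by (rule negligible_subset[of "{}"]) auto
      show "negligible {x \<in> {t..B} - {t<..B}. m x \<noteq> 0}"
        by (rule negligible_subset[of "{t}"]) auto
    qed
    then show ?thesis by (auto simp: integrable_on_def integral_unique)
  qed
  show "m integrable_on {a..B}" using ae[of a] t by simp
  have "wint 1 m t = set_lebesgue_integral lborel {t<..B} m"
    unfolding wint_1_eq set_lebesgue_integral_def using B
    by (intro Bochner_Integration.integral_cong refl) (auto simp: indicator_def)
  then show "wint 1 m t = integral {t..B} m" using ae[of t] t by simp
qed

section \<open>Continuity and differentiability of Weyl integrals\<close>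

lemma wint_1_continuous:
  fixes m :: "real \<Rightarrow> complex"
  assumes m: "m \<in> borel_measurable borel" and B: "\<forall>t\<ge>B. m t = 0"
    and fin: "\<And>a. wnn 1 (\<lambda>s. ennreal (norm (m s))) a < top"
  shows "continuous_on UNIV (wint 1 m)"
proof (rule continuous_at_imp_continuous_on, rule ballI)
  fix x
  define C where "C = max B (x + 1)"
  have C: "\<forall>t\<ge>C. m t = 0" using B by (simp add: C_def)
  note w = wint_1_indefinite[OF m C fin[of "x - 1"]]
  have "continuous_on {x - 1..C} (\<lambda>t. integral {t..C} m)"
    by (rule indefinite_integral_continuous_1') (rule w(1)[of x], auto simp: C_def)
  then have "continuous_on {x - 1..C} (wint 1 m)"
    by (rule continuous_on_eq) (use w(2) in auto)
  then have "continuous_on {x - 1<..<x + 1} (wint 1 m)"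
    by (rule continuous_on_subset) (auto simp: C_def)
  then show "isCont (wint 1 m) x"
    by (rule continuous_on_interior) auto
qed

lemma wint_1_has_derivative:
  fixes m :: "real \<Rightarrow> complex"
  assumes m: "continuous_on UNIV m" and B: "\<forall>t\<ge>B. m t = 0"
  shows "(wint 1 m has_vector_derivative - m x) (at x)"
proof -
  define C where "C = max B (x + 1)"
  have C: "\<forall>t\<ge>C. m t = 0" using B by (simp add: C_def)
  note w = wint_1_indefinite[OF borel_measurable_continuous_onI[OF m] C wnn_finite_bounded[OF m C], of "x - 1"]
  have "((\<lambda>u. integral {u..C} m) has_vector_derivative - m x) (at x within {x - 1..C})"
    using m by (intro integral_has_vector_derivative') (auto simp: C_def intro: continuous_on_subset)
  then have "((\<lambda>u. integral {u..C} m) has_vector_derivative - m x) (at x)"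
    by (subst (asm) at_within_interior) (auto simp: C_def)
  then show ?thesis
    by (rule has_vector_derivative_transform_within_open[where S="{x - 1<..<x + 1}"]) (use w(2) in \<open>auto simp: C_def\<close>)
qed

text \<open>
  By this identity a Weyl integral is a primitive, which yields its continuity and differentiability
  without differentiating under the singular integral.
\<close>

lemma wint_commute_vd:
  assumes f: "smooth_right f" and a: "0 < a"
  shows "wint a f = wint 1 (\<lambda>s. - wint a (vd f) s)"
proof
  fix t
  let ?h = "\<lambda>s. - vd f s"
  have h: "smooth_right ?h" using smooth_right_cmult[OF smooth_right_vd[OF f], of "-1"] by simp
  have [measurable, simp]: "vd f \<in> borel_measurable borel" using smooth_right_vd[OF f] by (rule smooth_right_measurable)
  have "wint a f t = wint a (wint 1 ?h) t" using wint_1_vd[OF f] by (simp add: fun_eq_iff[symmetric] wint_def)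
  also have "\<dots> = wint (a + 1) ?h t"
    using a wnn_finite_smooth[OF h] by (intro wint_semigroup) simp_all
  also have "\<dots> = wint (1 + a) ?h t" by (simp add: add.commute)
  also have "\<dots> = wint 1 (wint a ?h) t"
    using a wnn_finite_smooth[OF h] by (intro wint_semigroup[symmetric]) simp_all
  also have "wint a ?h = (\<lambda>s. - wint a (vd f) s)" by (simp add: wint_def fun_eq_iff)
  finally show "wint a f t = wint 1 (\<lambda>s. - wint a (vd f) s) t" .
qed

text \<open>The function is a primitive of another Weyl integral, whose integrability follows from
  convergence at order \<open>1 + a\<close>.\<close>

lemma wint_continuous:
  assumes f: "smooth_right f" and a: "0 < a" shows "continuous_on UNIV (wint a f)"
proof -
  have f': "smooth_right (vd f)" using f by (rule smooth_right_vd)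
  then have [measurable]: "vd f \<in> borel_measurable borel" by (rule smooth_right_measurable)
  obtain b where b: "\<forall>t\<ge>b. vd f t = 0" using f' by (auto simp: smooth_right_def)
  show ?thesis
    unfolding wint_commute_vd[OF f a]
  proof (rule wint_1_continuous[of _ b])
    show "\<forall>t\<ge>b. - wint a (vd f) t = 0" using wint_smooth_zero[OF b] by simp
    fix x
    have "wnn 1 (\<lambda>s. ennreal (norm (- wint a (vd f) s))) x \<le> wnn 1 (wnn a (\<lambda>s. ennreal (norm (vd f s)))) x"
      unfolding wnn_def[of 1] using a by (intro nn_integral_mono mult_left_mono) (auto intro: norm_wint_le)
    also have "\<dots> < top" using a wnn_finite_smooth[OF f'] by (simp add: wnn_semigroup)
    finally show "wnn 1 (\<lambda>s. ennreal (norm (- wint a (vd f) s))) x < top" .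
  qed measurable
qed

lemma wint_has_derivative:
  assumes f: "smooth_right f" and a: "0 < a"
  shows "(wint a f has_vector_derivative wint a (vd f) x) (at x)"
proof -
  have f': "smooth_right (vd f)" using f by (rule smooth_right_vd)
  obtain b where b: "\<forall>t\<ge>b. vd f t = 0" using f' by (auto simp: smooth_right_def)
  have "(wint 1 (\<lambda>s. - wint a (vd f) s) has_vector_derivative - (- wint a (vd f) x)) (at x)"
    by (rule wint_1_has_derivative[of _ b]) (use wint_smooth_zero[OF b] wint_continuous[OF f' a] in \<open>auto intro!: continuous_on_minus\<close>)
  then show ?thesis using wint_commute_vd[OF f a] by simp
qed

lemma smooth_right_wint:
  assumes f: "smooth_right f" and a: "0 < a" shows "smooth_right (wint a f)"
proof -
  have "Ck n (wint a f)" for n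
    using f
  proof (induction n arbitrary: f)
    case (Suc n)
    then show ?case using wint_has_derivative[OF Suc.prems a] smooth_right_vd by auto
  qed simp
  moreover obtain b where b: "\<forall>t\<ge>b. f t = 0" using f by (auto simp: smooth_right_def)
  ultimately show ?thesis using wint_smooth_zero[OF b] unfolding smooth_right_def smooth_def by (intro conjI exI[of _ b]) auto
qed

text \<open>The powers of \<open>1 / x\<close> are those produced by differentiating
  \<open>exp (- 1 / x)\<close>; with them the family is closed under differentiation up to linear
  combinations.\<close>

definition exp_flat :: "nat \<Rightarrow> real \<Rightarrow> complex" where
  "exp_flat k x = (if 0 < x then of_real ((1 / x) ^ k * exp (- (1 / x))) else 0)"

section \<open>Test functions and their density\<close>

lemma power_div_fact_le_exp:
  assumes "0 \<le> (y::real)" shows "y ^ n / fact n \<le> exp y"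
proof -
  have "(\<Sum>i\<in>{n}. y ^ i /\<^sub>R fact i) \<le> (\<Sum>i. y ^ i /\<^sub>R fact i)"
    using assms by (intro sum_le_suminf sums_summable[OF exp_converges]) auto
  then show ?thesis using sums_unique[OF exp_converges[of y]] by (simp add: field_simps)
qed

text \<open>Keeping the term of index \<open>k + 2\<close> of the exponential series leaves a factor
  \<open>x\<^sup>2\<close>, which is enough for the derivative at 0 to exist and vanish.\<close>

lemma exp_flat_bound:
  assumes x: "0 < x" shows "norm (exp_flat k x) \<le> fact (k + 2) * x\<^sup>2"
proof -
  have "(1 / x) ^ (k + 2) / fact (k + 2) \<le> exp (1 / x)"
    using x by (intro power_div_fact_le_exp) simp
  then have "(1 / x) ^ (k + 2) \<le> fact (k + 2) * exp (1 / x)"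
    unfolding pos_divide_le_eq[OF fact_gt_zero] by (simp only: mult.commute)
  then have "(1 / x) ^ (k + 2) * exp (- (1 / x)) \<le> fact (k + 2) * exp (1 / x) * exp (- (1 / x))"
    by (rule mult_right_mono) simp
  also have "\<dots> = fact (k + 2)" by (simp add: mult.assoc exp_add[symmetric])
  finally have "(1 / x) ^ (k + 2) * exp (- (1 / x)) * x\<^sup>2 \<le> fact (k + 2) * x\<^sup>2"
    by (rule mult_right_mono) simp
  moreover have "(1 / x) ^ (k + 2) * exp (- (1 / x)) * x\<^sup>2 = (1 / x) ^ k * exp (- (1 / x))"
    using x by (simp add: power_divide power_add power2_eq_square field_simps)
  ultimately show ?thesis using x by (simp add: exp_flat_def norm_mult norm_power norm_divide)
qed

lemma exp_flat_derivative:
  "(exp_flat k has_vector_derivative - of_nat k * exp_flat (k + 1) x + exp_flat (k + 2) x) (at x)"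
proof (cases "0 < x")
  case True
  have "((\<lambda>x. (1 / x) ^ k * exp (- (1 / x))) has_real_derivative
     (- real k * ((1 / x) ^ (k + 1) * exp (- (1 / x))) + (1 / x) ^ (k + 2) * exp (- (1 / x)))) (at x)"
    using True by (auto intro!: derivative_eq_intros simp: field_simps power2_eq_square)
      (cases k; simp add: field_simps)
  then have "((\<lambda>x. of_real ((1 / x) ^ k * exp (- (1 / x)))) has_vector_derivative
     (of_real (- real k * ((1 / x) ^ (k + 1) * exp (- (1 / x))) + (1 / x) ^ (k + 2) * exp (- (1 / x))) :: complex)) (at x)"
    by (rule has_vector_derivative_of_real)
  then have "(exp_flat k has_vector_derivative of_real (- real k * ((1 / x) ^ (k + 1) * exp (- (1 / x))) + (1 / x) ^ (k + 2) * exp (- (1 / x)))) (at x)"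
    by (rule has_vector_derivative_transform_within_open[where S="{0<..}"]) (use True in \<open>auto simp: exp_flat_def\<close>)
  then show ?thesis using True by (simp add: exp_flat_def)
next
  case False
  have "(exp_flat k has_vector_derivative 0) (at x)"
  proof (cases "x = 0")
    case True
    have "((\<lambda>h. (1 / norm h) *\<^sub>R exp_flat k h) \<longlongrightarrow> 0) (at 0)"
    proof (rule Lim_null_comparison)
      show "eventually (\<lambda>h. norm ((1 / norm h) *\<^sub>R exp_flat k h) \<le> fact (k + 2) * \<bar>h\<bar>) (at 0)"
      proof (rule always_eventually, rule allI)
        fix h :: real
        show "norm ((1 / norm h) *\<^sub>R exp_flat k h) \<le> fact (k + 2) * \<bar>h\<bar>"
        proof (cases "0 < h")
          case True
          have "norm ((1 / norm h) *\<^sub>R exp_flat k h) = norm (exp_flat k h) / h" using True by simp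
          also have "\<dots> \<le> fact (k + 2) * h\<^sup>2 / h"
            by (rule divide_right_mono[OF exp_flat_bound[OF True]]) (use True in simp)
          finally show ?thesis using True by (simp add: power2_eq_square)
        next
          case False
          have "0 \<le> fact (k + 2) * \<bar>h\<bar>" by (rule mult_nonneg_nonneg) simp_all
          moreover have "exp_flat k h = 0" using False by (simp add: exp_flat_def)
          ultimately show ?thesis by (simp only: scaleR_zero_right norm_zero)
        qed
      qed
      have "((\<lambda>h::real. fact (k + 2) * \<bar>h\<bar>) \<longlongrightarrow> fact (k + 2) * \<bar>0\<bar>) (at 0)"
        by (intro tendsto_intros)
      then show "((\<lambda>h::real. fact (k + 2) * \<bar>h\<bar>) \<longlongrightarrow> 0) (at 0)"
        by (simp only: abs_zero mult_zero_right)
    qed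
    from tendsto_norm_zero[OF this] show ?thesis
      unfolding True has_vector_derivative_def has_derivative_at
      by (simp add: exp_flat_def[of k 0] bounded_linear_zero)
  next
    case F: False
    show ?thesis
      by (rule has_vector_derivative_transform_within_open[of "\<lambda>t. 0" _ _ "{..<0}"]) (use F False in \<open>auto simp: exp_flat_def\<close>)
  qed
  then show ?thesis using False by (simp add: exp_flat_def)
qed

lemma smooth_exp_flat: "smooth (exp_flat k)"
proof -
  have "Ck n (exp_flat k)" for n
  proof (induction n arbitrary: k)
    case (Suc n)
    have "Ck n (\<lambda>x. - of_nat k * exp_flat (k + 1) x + exp_flat (k + 2) x)"
      by (intro Ck_add Ck_mult Ck_const Suc)
    then show ?case using exp_flat_derivative[of k]
      by (auto simp only: Ck.simps intro!: exI[of _ "\<lambda>x. - of_nat k * exp_flat (k + 1) x + exp_flat (k + 2) x"])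
  qed simp
  then show ?thesis by (simp add: smooth_def)
qed

definition bump :: "real \<Rightarrow> real \<Rightarrow> real \<Rightarrow> complex" where
  "bump a c x = exp_flat 0 (x - a) * exp_flat 0 (c - x)"

lemma bump_eq: "bump a c x = of_real (if a < x \<and> x < c then exp (- (1 / (x - a))) * exp (- (1 / (c - x))) else 0)"
  by (simp add: bump_def exp_flat_def)

lemma smooth_bump: "smooth (bump a c)"
proof -
  have "smooth (\<lambda>x. exp_flat 0 (1 * x + (- a)) * exp_flat 0 ((-1) * x + c))"
    by (intro smooth_mult smooth_affine smooth_exp_flat)
  then show ?thesis unfolding bump_def[abs_def] by simp
qed

text \<open>Test functions extended by 0 to the whole line, so that derivatives and integrals over
  the line can be used; \<open>Cc_smooth\<close> constrains values on \<open>{0<..}\<close>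
  only.\<close>

definition Cc0 :: "(real \<Rightarrow> complex) set" where
  "Cc0 = {\<phi>. smooth \<phi> \<and> (\<exists>a>0. \<exists>b. \<forall>t. t < a \<or> b < t \<longrightarrow> \<phi> t = 0)}"

lemma Cc0_smooth_right: assumes "\<phi> \<in> Cc0" shows "smooth_right \<phi>"
proof -
  obtain b where "\<forall>t. b < t \<longrightarrow> \<phi> t = 0" using assms by (auto simp: Cc0_def)
  then have "\<forall>t\<ge>b+1. \<phi> t = 0" by auto
  then show ?thesis using assms unfolding Cc0_def smooth_right_def by blast
qed

lemma funpow_vd: "((\<lambda>f x. vector_derivative f (at x)) ^^ n) \<phi> = (vd ^^ n) \<phi>"
proof -
  have "(\<lambda>f x. vector_derivative f (at x)) = vd" by (simp add: vd_def fun_eq_iff)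
  then show ?thesis by simp
qed

lemma Cc0_subset_Cc_smooth: "Cc0 \<subseteq> Cc_smooth"
proof
  fix \<phi> assume \<phi>: "\<phi> \<in> Cc0"
  then obtain a b where ab: "0 < a" "\<forall>t. t < a \<or> b < t \<longrightarrow> \<phi> t = 0" by (auto simp: Cc0_def)
  have "(vd ^^ n) \<phi> differentiable at t" for n t
    using \<phi> by (intro differentiableI_vector[OF smooth_vd(1)[OF smooth_vds]]) (simp add: Cc0_def)
  moreover have "compact {a..b}" "{a..b} \<subseteq> {0<..}" "\<forall>t\<in>{0<..} - {a..b}. \<phi> t = 0" using ab by auto
  ultimately show "\<phi> \<in> Cc_smooth" unfolding Cc_smooth_def funpow_vd by blast
qed

text \<open>Membership in \<open>Cc_smooth\<close> says nothing about \<open>{..0}\<close>, where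
  the values are reset to 0. At points \<open>t \<le> 0\<close> all derivatives exist because the
  new function vanishes on \<open>{..<a}\<close>.\<close>

lemma Cc_smooth_restrict:
  assumes \<phi>: "\<phi> \<in> Cc_smooth" shows "(\<lambda>t. if 0 < t then \<phi> t else 0) \<in> Cc0"
proof -
  obtain K where K: "compact K" "K \<subseteq> {0<..}" "\<forall>t\<in>{0<..} - K. \<phi> t = 0"
    and d: "\<And>n t. 0 < t \<Longrightarrow> (vd ^^ n) \<phi> differentiable at t"
    using \<phi> unfolding Cc_smooth_def funpow_vd by auto
  obtain a where a: "0 < a" "\<And>x. x \<in> K \<Longrightarrow> a \<le> x"
  proof (cases "K = {}")
    case True
    then show ?thesis using that[of 1] by simp
  next
    case False
    then obtain m where m: "m \<in> K" "\<And>x. x \<in> K \<Longrightarrow> m \<le> x" using compact_attains_inf[OF K(1)] by blast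
    then show ?thesis using that[of m] K(2) by auto
  qed
  obtain b where b: "\<And>x. x \<in> K \<Longrightarrow> x \<le> b"
    using compact_imp_bounded[OF K(1)] unfolding bounded_iff by (metis abs_le_D1 real_norm_def)
  have z: "(vd ^^ n) \<phi> t = 0" if "0 < t" "t < a" for n t
  proof (rule vds_zero_on_open[of "{0<..<a}"])
    fix s assume s: "s \<in> {0<..<a}"
    then have "s \<notin> K" using a(2)[of s] by auto
    then show "\<phi> s = 0" using K(3) s by simp
  qed (use that in auto)
  define g where "g = (\<lambda>n t. if 0 < t then (vd ^^ n) \<phi> t else 0)"
  have "(g n has_vector_derivative g (Suc n) t) (at t)" for n t
  proof (cases "0 < t")
    case True
    have "((vd ^^ n) \<phi> has_vector_derivative (vd ^^ Suc n) \<phi> t) (at t)"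
      using d[OF True, of n] by (simp add: vd_def vector_derivative_works)
    then have "(g n has_vector_derivative (vd ^^ Suc n) \<phi> t) (at t)"
      by (rule has_vector_derivative_transform_within_open[where S="{0<..}"]) (use True in \<open>auto simp: g_def\<close>)
    then show ?thesis using True by (simp add: g_def)
  next
    case False
    have "(g n has_vector_derivative 0) (at t)"
      by (rule has_vector_derivative_transform_within_open[of "\<lambda>t. 0" _ _ "{..<a}"]) (use a z False in \<open>auto simp: g_def\<close>)
    then show ?thesis using False by (simp add: g_def)
  qed
  then have "Ck m (g n)" for m n
    by (induction m arbitrary: n) auto
  then have "smooth (g 0)" by (simp add: smooth_def)
  moreover have "\<forall>t. t < a \<or> b < t \<longrightarrow> g 0 t = 0"
  proof (intro allI impI)
    fix t assume t: "t < a \<or> b < t"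
    then have "t \<notin> K" using a(2)[of t] b[of t] by auto
    then show "g 0 t = 0" using K(3) by (simp add: g_def)
  qed
  moreover have "g 0 = (\<lambda>t. if 0 < t then \<phi> t else 0)" by (simp add: g_def fun_eq_iff)
  ultimately show ?thesis using a(1)
    unfolding Cc0_def by (intro CollectI conjI exI[of _ a] exI[of _ b]) simp_all
qed

lemma Npow_le_bounded_support:
  assumes p: "1 \<le> p" and B: "0 \<le> B" and c: "0 \<le> c"
    and bd: "\<And>t. 0 < t \<Longrightarrow> t \<le> B \<Longrightarrow> t powr \<alpha> * norm (v t) \<le> c"
    and z: "\<And>t. t \<le> 0 \<or> B < t \<Longrightarrow> v t = 0"
  shows "Npow p \<alpha> v \<le> ennreal (c powr p * B)"
proof -
  have "Npow p \<alpha> v \<le> (\<integral>\<^sup>+t. ennreal (c powr p) * indicator {0<..B} t \<partial>lborel)"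
    unfolding Npow_def
  proof (intro nn_integral_mono)
    fix t
    show "epow p (ennreal (t powr \<alpha> * norm (v t))) \<le> ennreal (c powr p) * indicator {0<..B} t"
    proof (cases "0 < t \<and> t \<le> B")
      case True
      then have "epow p (ennreal (t powr \<alpha> * norm (v t))) \<le> epow p (ennreal c)"
        using p bd by (intro epow_mono ennreal_leI) auto
      then show ?thesis using True c by simp
    next
      case False
      then have "v t = 0" using z[of t] by auto
      then show ?thesis by simp
    qed
  qed
  also have "\<dots> = ennreal (c powr p * B)" using B by (simp add: nn_integral_cmult ennreal_mult')
  finally show ?thesis .
qed

text \<open>At integer order the representative is an explicit derivative. It is cut to the
  half-line, which the Weyl integral at \<open>t > 0\<close> does not see, and its weighted norm is
  finite because it is bounded with bounded support.\<close>

lemma T_rep_smooth_right: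
  assumes p: "1 \<le> p" and f: "smooth_right f"
  shows "T_rep p (Suc n) f (\<lambda>t. if 0 < t then (-1) ^ Suc n * (vd ^^ Suc n) f t else 0)" (is "T_rep p _ f ?u")
proof -
  let ?h = "\<lambda>t. (-1) ^ Suc n * (vd ^^ Suc n) f t"
  have h: "smooth_right ?h" by (intro smooth_right_cmult smooth_right_vds f)
  have hm [measurable]: "?h \<in> borel_measurable borel" by (rule smooth_right_measurable[OF h])
  have um: "?u \<in> borel_measurable borel" by measurable
  obtain b where b: "\<forall>t\<ge>b. ?h t = 0" using h by (auto simp: smooth_right_def)
  define B where "B = max b 1"
  have "bounded (?h ` {0..B})"
    using h by (intro compact_imp_bounded compact_continuous_image smooth_continuous) (auto simp: smooth_right_def)
  then obtain C where "\<forall>t\<in>{0..B}. norm (?h t) \<le> C" unfolding bounded_iff by blast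
  then have C: "norm (?h t) \<le> C" if "0 < t" "t \<le> B" for t using that by (auto simp del: funpow.simps power_Suc)
  have C0: "0 \<le> C" by (rule order_trans[OF norm_ge_zero C[of 1]]) (auto simp: B_def)
  have "Npow p (Suc n) ?u \<le> ennreal ((B powr Suc n * C) powr p * B)"
  proof (rule Npow_le_bounded_support[OF p])
    fix t assume "0 < t" "t \<le> B"
    then show "t powr Suc n * norm (?u t) \<le> B powr Suc n * C"
      using C[of t] by (intro mult_mono powr_mono2) (auto simp del: funpow.simps power_Suc)
  next
    fix t assume "t \<le> 0 \<or> B < t"
    then show "?u t = 0" using b by (auto simp: B_def simp del: funpow.simps power_Suc)
  qed (use C0 in \<open>auto simp: B_def\<close>)
  also have "\<dots> < top" by simp
  finally have "?u \<in> wLp p (Suc n)" unfolding wLp_def using um by auto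
  moreover have "f t = wint (Suc n) ?u t" if "0 < t" for t
  proof -
    have "wint (Suc n) ?u t = wint (Suc n) ?h t"
      unfolding wint_def by (intro Bochner_Integration.integral_cong refl) (use that in \<open>auto simp: wker_def\<close>)
    then show ?thesis using wint_vds[OF f, of n t] by simp
  qed
  ultimately show ?thesis by (simp add: T_rep_def del: funpow.simps power_Suc)
qed

text \<open>An integer order above \<open>\<alpha>\<close> is explicit, and
  \<open>T_rep_lower\<close> descends from it.\<close>

lemma smooth_right_T_rep_ex:
  assumes p: "1 \<le> p" and f: "smooth_right f" and \<alpha>: "0 \<le> \<alpha>" shows "\<exists>u. T_rep p \<alpha> f u"
proof -
  obtain n where "\<alpha> < real (Suc n)" using reals_Archimedean2[of \<alpha>] by (metis less_SucI less_trans of_nat_less_iff lessI)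
  then show ?thesis using T_rep_lower[OF p \<alpha> _ T_rep_smooth_right[OF p f, of n]] by blast
qed

lemma wLp_mono_ennreal: "Npow p \<alpha> u \<le> c \<Longrightarrow> c < top \<Longrightarrow> u \<in> borel_measurable borel \<Longrightarrow> \<forall>t\<le>0. u t = 0 \<Longrightarrow> u \<in> wLp p \<alpha>"
  by (auto simp: wLp_def intro: le_less_trans)

section \<open>Density of test functions in the unweighted space\<close>

lemma Npow_dominated:
  assumes p: "1 \<le> p"
    and [measurable]: "\<And>n. g n \<in> borel_measurable borel" "f \<in> borel_measurable borel" "H \<in> borel_measurable borel"
    and z: "\<And>n. \<forall>t\<le>0. g n t = 0" "\<forall>t\<le>0. f t = 0"
    and bd: "\<And>n. AE t in lborel. norm (f t - g n t) \<le> H t" and H: "(\<integral>\<^sup>+t. ennreal (H t powr p) \<partial>lborel) < top"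
    and lim: "AE t in lborel. (\<lambda>n. g n t) \<longlonglongrightarrow> f t" and e: "0 < e"
  shows "\<exists>n. Npow p 0 (\<lambda>t. f t - g n t) < e"
proof -
  have "(\<lambda>n. \<integral>\<^sup>+t. ennreal (norm (f t - g n t) powr p) \<partial>lborel) \<longlonglongrightarrow> (\<integral>\<^sup>+t. (0::ennreal) \<partial>(lborel::real measure))"
  proof (rule nn_integral_dominated_convergence[where w="\<lambda>t. ennreal (H t powr p)"])
    show "AE t in lborel. ennreal (norm (f t - g n t) powr p) \<le> ennreal (H t powr p)" for n
      using bd[of n] by eventually_elim (use p in \<open>auto intro!: ennreal_leI powr_mono2\<close>)
    show "AE t in lborel. (\<lambda>n. ennreal (norm (f t - g n t) powr p)) \<longlonglongrightarrow> 0"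
      using lim
    proof eventually_elim
      case (elim t)
      have "(\<lambda>n. norm (f t - g n t)) \<longlonglongrightarrow> 0"
        using tendsto_norm[OF tendsto_diff[OF tendsto_const[of "f t"] elim]] by simp
      then have "(\<lambda>n. norm (f t - g n t) powr p) \<longlonglongrightarrow> 0 powr p"
        using p by (intro tendsto_powr') auto
      then show ?case using p tendsto_ennrealI by fastforce
    qed
  qed (use H in auto)
  then have "(\<lambda>n. Npow p 0 (\<lambda>t. f t - g n t)) \<longlonglongrightarrow> 0"
    using z by (subst Npow_0) auto
  then have "eventually (\<lambda>n. Npow p 0 (\<lambda>t. f t - g n t) < e) sequentially"
    using e by (rule order_tendstoD(2))
  then show ?thesis by (auto simp: eventually_sequentially)
qed

lemma Npow_triangle:
  assumes p: "1 \<le> p" and [measurable]: "u \<in> borel_measurable borel" "v \<in> borel_measurable borel" "w \<in> borel_measurable borel"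
  shows "Npow p \<alpha> (\<lambda>t. u t - w t) \<le> ennreal (2 powr p) * (Npow p \<alpha> (\<lambda>t. u t - v t) + Npow p \<alpha> (\<lambda>t. v t - w t))"
  using Npow_add_le[of p "\<lambda>t. u t - v t" "\<lambda>t. v t - w t" \<alpha>] p by simp

lemma ennreal_pos_real_less: "0 < (e::ennreal) \<Longrightarrow> \<exists>r>0. ennreal r < e"
  by (metis dense ennreal_cases ennreal_less_zero_iff less_top_ennreal order.strict_trans top.extremum_strict)

text \<open>Halving of a tolerance, adapted to the factor \<open>2 powr p\<close> in
  \<open>Npow_add_le\<close>.\<close>

lemma ennreal_half_split:
  assumes "0 < (e::ennreal)"
  shows "\<exists>d>0. \<forall>x y. x < d \<longrightarrow> y < d \<longrightarrow> ennreal (2 powr p) * (x + y) < e"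
proof -
  obtain r where r: "0 < r" "ennreal r < e"
    using ennreal_pos_real_less[OF assms] by blast
  define d where "d = ennreal (r / (2 * 2 powr p))"
  have "ennreal (2 powr p) * (x + y) < e" if "x < d" "y < d" for x y
  proof -
    have "x + y \<le> d + d" using that by (intro add_mono) auto
    then have "ennreal (2 powr p) * (x + y) \<le> ennreal (2 powr p) * (d + d)" by (rule mult_left_mono) simp
    also have "d + d = ennreal (r / 2 powr p)" unfolding d_def using r by (simp add: ennreal_plus[symmetric] del: ennreal_plus)
    also have "ennreal (2 powr p) * ennreal (r / 2 powr p) = ennreal r" using r by (simp add: ennreal_mult'[symmetric])
    finally show ?thesis using r by simp
  qed
  moreover have "0 < d" using r by (simp add: d_def)
  ultimately show ?thesis by blast
qed

text \<open>Measurability provides continuous functions that converge to \<open>f\<close> almost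
  everywhere but without any bound. Clipping their values at height \<open>M\<close> and multiplying
  by a fixed cut-off gives a common majorant and leaves the limit unchanged.\<close>

lemma Lp_approx_continuous:
  fixes f :: "real \<Rightarrow> complex"
  assumes p: "1 \<le> p" and fm [measurable]: "f \<in> borel_measurable borel" and M: "0 < M" "\<And>t. norm (f t) \<le> M"
    and ac: "0 < a" "a < c" and supp: "\<And>t. t < a \<or> c < t \<Longrightarrow> f t = 0" and e: "0 < e"
  shows "\<exists>g. continuous_on UNIV g \<and> (\<forall>t. t < a / 2 \<or> c + 1 < t \<longrightarrow> g t = 0) \<and> Npow p 0 (\<lambda>t. f t - g t) < e"
proof -
  have "f \<in> borel_measurable lebesgue" by (intro measurable_completion) simp
  then have "f measurable_on UNIV" by (rule lebesgue_measurable_imp_measurable_on) simp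
  then obtain N h where N: "negligible N" and h: "\<And>n. continuous_on UNIV (h n)"
    and lim: "\<And>x. x \<notin> N \<Longrightarrow> (\<lambda>n. h n x) \<longlonglongrightarrow> f x"
    unfolding measurable_on_def by auto
  \<comment> \<open>A trapezoid that is 1 on \<open>{a..c}\<close> and 0 outside
    \<open>{a / 2..c + 1}\<close>.\<close>
  define \<theta> where "\<theta> = (\<lambda>t::real. max 0 (min 1 (min (2 * t / a - 1) (c + 1 - t))))"
  have \<theta>c: "continuous_on UNIV \<theta>" unfolding \<theta>_def using ac by (intro continuous_intros) auto
  have \<theta>01: "0 \<le> \<theta> t" "\<theta> t \<le> 1" for t by (auto simp: \<theta>_def)
  have \<theta>0: "\<theta> t = 0" if "t < a / 2 \<or> c + 1 < t" for t
  proof -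
    have "min (2 * t / a - 1) (c + 1 - t) \<le> 0" using that ac by (auto simp: field_simps min_le_iff_disj)
    then show ?thesis unfolding \<theta>_def by (meson max.absorb1 min.coboundedI2)
  qed
  have \<theta>1: "\<theta> t = 1" if "a \<le> t" "t \<le> c" for t
  proof -
    have "1 \<le> 2 * t / a - 1" "1 \<le> c + 1 - t" using that ac by (auto simp: field_simps)
    then show ?thesis by (simp add: \<theta>_def)
  qed
  \<comment> \<open>The radial projection onto the disc of radius \<open>M\<close>.\<close>
  define clip where "clip = (\<lambda>z::complex. (M / max M (norm z)) *\<^sub>R z)"
  have clipc: "continuous_on UNIV clip"
    unfolding clip_def using M by (intro continuous_intros) (auto simp: max_def)
  have clipM: "norm (clip z) \<le> M" for z
    using M by (auto simp: clip_def max_def field_simps)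
  have clip_id: "clip z = z" if "norm z \<le> M" for z
    using M that by (simp add: clip_def max_def)
  define g where "g = (\<lambda>n t. \<theta> t *\<^sub>R clip (h n t))"
  have gc: "continuous_on UNIV (g n)" for n
    unfolding g_def by (intro continuous_intros \<theta>c continuous_on_compose2[OF clipc h]) auto
  have g0: "g n t = 0" if "t < a / 2 \<or> c + 1 < t" for n t using \<theta>0[OF that] by (simp add: g_def)
  have gM: "norm (g n t) \<le> M" for n t
  proof -
    have "norm (g n t) = \<theta> t * norm (clip (h n t))" using \<theta>01[of t] by (simp add: g_def)
    also have "\<dots> \<le> 1 * M" using \<theta>01 clipM by (intro mult_mono) auto
    finally show ?thesis by simp
  qed
  have f_eq: "f t = \<theta> t *\<^sub>R clip (f t)" for t
  proof (cases "t < a \<or> c < t")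
    case True
    then show ?thesis using supp[OF True] by (simp add: clip_def)
  next
    case False
    then show ?thesis using \<theta>1[of t] clip_id[OF M(2)[of t]] by simp
  qed
  have "\<exists>n. Npow p 0 (\<lambda>t. f t - g n t) < e"
  proof (rule Npow_dominated[OF p])
    show "g n \<in> borel_measurable borel" for n using gc by (rule borel_measurable_continuous_onI)
    show "\<forall>t\<le>0. g n t = 0" for n using g0 ac by auto
    show "\<forall>t\<le>0. f t = 0" using supp ac by auto
    let ?H = "\<lambda>t. indicator {a / 2..c + 1} t * (2 * M)"
    show "?H \<in> borel_measurable borel" by measurable
    have "norm (f t - g n t) \<le> ?H t" for n t
    proof (cases "t \<in> {a / 2..c + 1}")
      case True
      then show ?thesis using norm_triangle_ineq4[of "f t" "g n t"] M(2)[of t] gM[of n t] by simp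
    next
      case False
      then have "t < a / 2 \<or> c + 1 < t" by auto
      moreover from this have "t < a \<or> c < t" using ac by auto
      ultimately show ?thesis using g0 supp by auto
    qed
    then show "AE t in lborel. norm (f t - g n t) \<le> ?H t" for n by simp
    have "(\<integral>\<^sup>+t. ennreal (?H t powr p) \<partial>lborel) = (\<integral>\<^sup>+t. ennreal ((2 * M) powr p) * indicator {a / 2..c + 1} t \<partial>lborel)"
      using p by (intro nn_integral_cong) (auto simp: indicator_def)
    also have "\<dots> < top" using ac by (simp add: nn_integral_cmult ennreal_mult_less_top)
    finally show "(\<integral>\<^sup>+t. ennreal (?H t powr p) \<partial>lborel) < top" .
    have "AE t in lebesgue. t \<notin> N" using N by (intro AE_not_in) (simp add: negligible_iff_null_sets)
    then have "AE t in lborel. t \<notin> N" by (simp add: AE_completion_iff)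
    then show "AE t in lborel. (\<lambda>n. g n t) \<longlonglongrightarrow> f t"
    proof eventually_elim
      case (elim t)
      have "isCont clip (f t)" using clipc by (simp add: continuous_on_eq_continuous_at)
      then have "(\<lambda>n. clip (h n t)) \<longlonglongrightarrow> clip (f t)" using lim[OF elim] by (rule isCont_tendsto_compose)
      then have "(\<lambda>n. g n t) \<longlonglongrightarrow> \<theta> t *\<^sub>R clip (f t)" unfolding g_def by (intro tendsto_intros)
      then show ?case using f_eq[of t] by simp
    qed
  qed (use e in auto)
  then show ?thesis using gc g0 by blast
qed

lemma smooth_polynomial_function:
  fixes q :: "real \<Rightarrow> complex"
  assumes "polynomial_function q" shows "smooth q"
proof -
  have "Ck n q" for n
    using assms
  proof (induction n arbitrary: q)
    case (Suc n)
    then obtain q' where "polynomial_function q'" "\<And>x. (q has_vector_derivative q' x) (at x)"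
      using has_vector_derivative_polynomial_function by blast
    then show ?case using Suc.IH by auto
  qed simp
  then show ?thesis by (simp add: smooth_def)
qed

text \<open>
  The quotient of \<open>g\<close> by a bump function that is positive on the support of \<open>g\<close> is continuous, and the bump
  function times a polynomial approximation of the quotient is a test function.
\<close>

lemma continuous_approx_Cc0:
  assumes p: "1 \<le> p" and gc: "continuous_on UNIV g" and ac: "0 < a" "a < c"
    and supp: "\<And>t. t < a \<or> c < t \<Longrightarrow> g t = 0" and e: "0 < e"
  shows "\<exists>\<phi>\<in>Cc0. Npow p 0 (\<lambda>t. g t - \<phi> t) < e"
proof -
  obtain r where r: "0 < r" "ennreal r < e"
    using ennreal_pos_real_less[OF e] by blast
  define L where "L = c + 1"
  have L: "0 < L" using ac by (simp add: L_def)
  \<comment> \<open>Uniform accuracy \<open>\<eta>\<close> on an interval of length \<open>L\<close>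
    costs \<open>\<eta> powr p * L\<close>, which is exactly \<open>r\<close>.\<close>
  define \<eta> where "\<eta> = (r / L) powr (1 / p)"
  have \<eta>: "0 < \<eta>" using r L by (simp add: \<eta>_def)
  let ?b = "bump (a / 2) L"
  define G where "G = (\<lambda>t. if a / 2 < t \<and> t < L then g t / ?b t else 0)"
  have bpos: "?b t \<noteq> 0" if "a / 2 < t" "t < L" for t using that by (simp add: bump_eq)
  have ble: "norm (?b t) \<le> 1" for t by (auto simp: bump_eq mult_le_one)
  have "continuous_on ({a/2<..<L} \<union> ({..<a} \<union> {c<..})) G"
  proof (rule continuous_on_open_Un)
    have "continuous_on {a/2<..<L} (\<lambda>t. g t / ?b t)"
      using bpos by (intro continuous_on_divide continuous_on_subset[OF gc] smooth_continuous smooth_bump) auto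
    then show "continuous_on {a/2<..<L} G" by (rule continuous_on_eq) (auto simp: G_def)
    show "continuous_on ({..<a} \<union> {c<..}) G"
      by (rule continuous_on_eq[OF continuous_on_const[of _ 0]]) (use supp in \<open>auto simp: G_def\<close>)
  qed auto
  moreover have "{a/2<..<L} \<union> ({..<a} \<union> {c<..}) = UNIV" using ac by (auto simp: L_def)
  ultimately have Gc: "continuous_on UNIV G" by simp
  obtain q where q: "polynomial_function q" "\<And>t. t \<in> {a/2..L} \<Longrightarrow> norm (G t - q t) < \<eta>"
    using Stone_Weierstrass_polynomial_function[of "{a/2..L}" G \<eta>] \<eta> continuous_on_subset[OF Gc] by auto
  define \<phi> where "\<phi> = (\<lambda>t. ?b t * q t)"
  have "smooth \<phi>" unfolding \<phi>_def by (intro smooth_mult smooth_bump smooth_polynomial_function q)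
  moreover have "\<forall>t. t < a / 2 \<or> L < t \<longrightarrow> \<phi> t = 0" by (auto simp: \<phi>_def bump_eq)
  ultimately have \<phi>: "\<phi> \<in> Cc0" using ac unfolding Cc0_def by (intro CollectI conjI exI[of _ "a / 2"] exI[of _ L]) auto
  have bd: "norm (g t - \<phi> t) \<le> indicator {0<..L} t * \<eta>" for t
  proof (cases "a / 2 < t \<and> t < L")
    case True
    then have "g t - \<phi> t = ?b t * (G t - q t)" using bpos by (simp add: G_def \<phi>_def algebra_simps)
    then have "norm (g t - \<phi> t) = norm (?b t) * norm (G t - q t)" by (simp add: norm_mult)
    also have "\<dots> \<le> 1 * \<eta>" using ble[of t] q(2)[of t] True by (intro mult_mono) auto
    finally show ?thesis using True ac by (simp add: indicator_def)
  next
    case False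
    then have "g t = 0" "\<phi> t = 0" using supp[of t] ac by (auto simp: \<phi>_def bump_eq L_def)
    then show ?thesis using \<eta> by simp
  qed
  have "Npow p 0 (\<lambda>t. g t - \<phi> t) \<le> ennreal (\<eta> powr p * L)"
  proof (rule Npow_le_bounded_support[OF p])
    fix t assume "0 < t" "t \<le> L"
    then show "t powr 0 * norm (g t - \<phi> t) \<le> \<eta>" using bd[of t] by simp
  next
    fix t assume "t \<le> 0 \<or> L < t"
    then show "g t - \<phi> t = 0" using bd[of t] by auto
  qed (use L \<eta> in auto)
  also have "\<eta> powr p * L = r" using r L p by (simp add: \<eta>_def powr_powr)
  finally show ?thesis using \<phi> r by (auto intro: le_less_trans)
qed

text \<open>Truncation in position and height is followed by approximation with continuous functions
  and then with test functions. Three errors are combined by two uses of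
  \<open>Npow_triangle\<close>, hence the nested tolerances \<open>d\<close> and
  \<open>d'\<close>.\<close>

lemma Cc0_dense_Lp:
  assumes p: "1 \<le> p" and f: "f \<in> wLp p 0" and e: "0 < e"
  shows "\<exists>\<phi>\<in>Cc0. Npow p 0 (\<lambda>t. f t - \<phi> t) < e"
proof -
  have fm [measurable]: "f \<in> borel_measurable borel" and f0: "\<forall>t\<le>0. f t = 0" and fN: "Npow p 0 f < top" using f by (auto simp: wLp_def)
  obtain d where d: "0 < d" "\<And>x y. x < d \<Longrightarrow> y < d \<Longrightarrow> ennreal (2 powr p) * (x + y) < e"
    using ennreal_half_split[OF e] by blast
  obtain d' where d': "0 < d'" "\<And>x y. x < d' \<Longrightarrow> y < d' \<Longrightarrow> ennreal (2 powr p) * (x + y) < d"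
    using ennreal_half_split[OF d(1)] by blast
  define g where "g = (\<lambda>n t. if 1 / real (Suc n) \<le> t \<and> t \<le> real (Suc n) + 1 \<and> norm (f t) \<le> real (Suc n) then f t else 0)"
  have gm [measurable]: "g n \<in> borel_measurable borel" for n unfolding g_def by measurable
  have "\<exists>n. Npow p 0 (\<lambda>t. f t - g n t) < d"
  proof (rule Npow_dominated[OF p])
    show "\<forall>t\<le>0. g n t = 0" for n using f0 by (auto simp: g_def)
    show "AE t in lborel. norm (f t - g n t) \<le> norm (f t)" for n by (auto simp: g_def)
    show "(\<integral>\<^sup>+t. ennreal (norm (f t) powr p) \<partial>lborel) < top" using fN by (simp add: Npow_0 f0)
    show "AE t in lborel. (\<lambda>n. g n t) \<longlonglongrightarrow> f t"
    proof (intro AE_I2)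
      fix t
      show "(\<lambda>n. g n t) \<longlonglongrightarrow> f t"
      proof (cases "0 < t")
        case True
        obtain n0 where n0: "max (1 / t) (max t (norm (f t))) < real n0" using reals_Archimedean2 by blast
        have "eventually (\<lambda>n. g n t = f t) sequentially"
          using eventually_ge_at_top[of n0]
        proof eventually_elim
          case (elim n)
          then have n: "1 / t < real (Suc n)" "t < real (Suc n)" "norm (f t) < real (Suc n)" using n0 by auto
          then have "1 / real (Suc n) < t" using True by (simp add: field_simps)
          then show ?case using n by (simp add: g_def)
        qed
        then show ?thesis by (rule tendsto_eventually)
      next
        case False
        then have "g n t = f t" for n using f0 by (simp add: g_def)
        then show ?thesis by simp
      qed
    qed
  qed (use f0 d in auto)
  then obtain n where n: "Npow p 0 (\<lambda>t. f t - g n t) < d" by blast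
  let ?a = "1 / real (Suc n)" and ?c = "real (Suc n) + 1"
  have ac: "0 < ?a" "?a < ?c" by (auto simp: field_simps intro: add_pos_nonneg)
  have "\<exists>h. continuous_on UNIV h \<and> (\<forall>t. t < ?a / 2 \<or> ?c + 1 < t \<longrightarrow> h t = 0) \<and> Npow p 0 (\<lambda>t. g n t - h t) < d'"
    by (rule Lp_approx_continuous[OF p gm, where M="real (Suc n)"]) (use ac d' in \<open>auto simp: g_def\<close>)
  then obtain h where h: "continuous_on UNIV h" "\<forall>t. t < ?a / 2 \<or> ?c + 1 < t \<longrightarrow> h t = 0" "Npow p 0 (\<lambda>t. g n t - h t) < d'"
    by blast
  have hm [measurable]: "h \<in> borel_measurable borel" using h(1) by (rule borel_measurable_continuous_onI)
  have half: "x / 2 < y + 1" if "0 < x" "x < y" for x y :: real using that by linarith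
  have "\<exists>\<phi>\<in>Cc0. Npow p 0 (\<lambda>t. h t - \<phi> t) < d'"
  proof (rule continuous_approx_Cc0[OF p h(1) _ _ _ d'(1)])
    show "0 < ?a / 2" using ac by simp
    show "?a / 2 < ?c + 1" by (rule half[OF ac])
  qed (use h(2) in blast)
  then obtain \<phi> where \<phi>: "\<phi> \<in> Cc0" "Npow p 0 (\<lambda>t. h t - \<phi> t) < d'" by blast
  have [measurable]: "\<phi> \<in> borel_measurable borel" using \<phi>(1) by (auto simp: Cc0_def intro: smooth_measurable)
  have "Npow p 0 (\<lambda>t. g n t - \<phi> t) < d"
    using Npow_triangle[OF p gm hm, of \<phi> 0] d'(2)[OF h(3) \<phi>(2)] by (auto intro: le_less_trans)
  then have "Npow p 0 (\<lambda>t. f t - \<phi> t) < e"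
    using Npow_triangle[OF p fm gm[of n], of \<phi> 0] d(2)[OF n] by (auto intro: le_less_trans)
  then show ?thesis using \<phi>(1) by blast
qed

text \<open>Exponent and function vary together in the induction: the derivative is a sum of two
  products of the same form, one with exponent \<open>c - 1\<close> and one with
  \<open>vd \<psi>\<close>.\<close>

lemma Cc0_powr_mult:
  assumes "\<psi> \<in> Cc0" shows "(\<lambda>t. (t powr c) *\<^sub>R \<psi> t) \<in> Cc0"
proof -
  obtain a b where ab: "0 < a" "\<forall>t. t < a \<or> b < t \<longrightarrow> \<psi> t = 0" using assms by (auto simp: Cc0_def)
  have "Ck n (\<lambda>t. (t powr c) *\<^sub>R \<psi> t)" if "smooth \<psi>" "\<forall>t<a. \<psi> t = 0" for n c \<psi>
    using that
  proof (induction n arbitrary: c \<psi>)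
    case (Suc n)
    have z: "\<forall>t<a. vd \<psi> t = 0" using Suc.prems by (auto intro!: vd_zero_on_open[of "{..<a}"])
    let ?D = "\<lambda>t. c *\<^sub>R ((t powr (c - 1)) *\<^sub>R \<psi> t) + (t powr c) *\<^sub>R vd \<psi> t"
    have "((\<lambda>t. (t powr c) *\<^sub>R \<psi> t) has_vector_derivative ?D t) (at t)" for t
    proof (cases "0 < t")
      case True
      have "((\<lambda>t. t powr c) has_field_derivative c * t powr (c - 1)) (at t)"
        using True by (rule has_real_derivative_powr)
      from has_vector_derivative_scaleR[OF this smooth_vd(1)[OF Suc.prems(1)]]
      show ?thesis by (simp add: add.commute)
    next
      case False
      have "((\<lambda>t. (t powr c) *\<^sub>R \<psi> t) has_vector_derivative 0) (at t)"
        by (rule has_vector_derivative_transform_within_open[of "\<lambda>t. 0" _ _ "{..<a}"]) (use Suc.prems ab False in auto)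
      moreover have "\<psi> t = 0" "vd \<psi> t = 0" using False ab Suc.prems z by auto
      ultimately show ?thesis by simp
    qed
    moreover have "Ck n ?D"
    proof (rule Ck_add)
      have "Ck n (\<lambda>t. of_real c * ((t powr (c - 1)) *\<^sub>R \<psi> t))"
        by (intro Ck_mult Ck_const Suc.IH Suc.prems)
      then show "Ck n (\<lambda>t. c *\<^sub>R ((t powr (c - 1)) *\<^sub>R \<psi> t))" by (simp add: scaleR_conv_of_real)
      show "Ck n (\<lambda>t. (t powr c) *\<^sub>R vd \<psi> t)" using Suc.prems z by (intro Suc.IH smooth_vd)
    qed
    ultimately show ?case by (auto simp only: Ck.simps intro!: exI[of _ ?D])
  qed simp
  then have "smooth (\<lambda>t. (t powr c) *\<^sub>R \<psi> t)" using assms ab by (simp add: smooth_def Cc0_def)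
  then show ?thesis using ab unfolding Cc0_def by (intro CollectI conjI exI[of _ a] exI[of _ b]) auto
qed

section \<open>Cutting off near the origin\<close>

lemma bump_eq_norm: "bump a c t = of_real (norm (bump a c t))"
  by (simp add: bump_eq norm_mult)

lemma bump_integral:
  assumes ac: "a < c"
  shows "integrable lborel (\<lambda>t. norm (bump a c t))" "0 < (LINT t|lborel. norm (bump a c t))"
proof -
  have rc: "continuous_on UNIV (\<lambda>t. norm (bump a c t))" by (intro continuous_intros smooth_continuous smooth_bump)
  have "(\<lambda>t. norm (bump a c t)) = (\<lambda>t. indicator {a..c} t *\<^sub>R norm (bump a c t))" by (auto simp: fun_eq_iff indicator_def bump_eq)
  moreover have "set_integrable lborel {a..c} (\<lambda>t. norm (bump a c t))"
    unfolding set_integrable_def by (rule borel_integrable_compact) (auto intro: continuous_on_subset[OF rc])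
  ultimately show int: "integrable lborel (\<lambda>t. norm (bump a c t))" unfolding set_integrable_def by simp
  have "(LINT t|lborel. norm (bump a c t)) \<noteq> 0"
  proof
    assume "(LINT t|lborel. norm (bump a c t)) = 0"
    then have "AE t in lborel. norm (bump a c t) = 0"
      using integral_nonneg_eq_0_iff_AE[OF int] by simp
    then have "AE t in lborel. t \<notin> {a<..<c}"
      by eventually_elim (auto simp: bump_eq)
    then have "{a<..<c} \<in> null_sets lborel" by (subst AE_iff_null_sets) simp_all
    then have "emeasure lborel {a<..<c} = 0" by (rule null_setsD1)
    then show False using ac by simp
  qed
  moreover have "0 \<le> (LINT t|lborel. norm (bump a c t))" by simp
  ultimately show "0 < (LINT t|lborel. norm (bump a c t))" by linarith
qed

text \<open>The integral of a bump over \<open>{t<..}\<close>, divided by its total mass, is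
  constant to the left of the bump and 0 to its right.\<close>

lemma smooth_cutoff: "\<exists>\<kappa>. smooth \<kappa> \<and> (\<forall>t\<le>1. \<kappa> t = 1) \<and> (\<forall>t\<ge>2. \<kappa> t = 0)"
proof -
  let ?b = "bump 1 2"
  have b: "smooth_right ?b" unfolding smooth_right_def using smooth_bump by (intro conjI exI[of _ 2]) (auto simp: bump_eq)
  define I where "I = wint 1 ?b 1"
  have bz: "\<forall>t\<ge>2. ?b t = 0" by (auto simp: bump_eq)
  have "I = (LINT t|lborel. of_real (norm (?b t)))"
    unfolding I_def wint_def
    by (intro Bochner_Integration.integral_cong refl) (auto simp: wker_def bump_eq_norm[symmetric] bump_eq)
  then have I0: "I \<noteq> 0" using bump_integral(2)[of 1 2] by simp
  have "smooth (\<lambda>t. (1 / I) * wint 1 ?b t)"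
    using smooth_right_wint[OF b, of 1] by (intro smooth_mult) (auto simp: smooth_right_def)
  moreover have "(1 / I) * wint 1 ?b t = 1" if "t \<le> 1" for t
  proof -
    have "wint 1 ?b t = I" unfolding I_def wint_def
      by (intro Bochner_Integration.integral_cong refl) (use that in \<open>auto simp: wker_def bump_eq\<close>)
    then show ?thesis using I0 by simp
  qed
  moreover have "(1 / I) * wint 1 ?b t = 0" if "2 \<le> t" for t
    using wint_smooth_zero[OF bz that] by simp
  ultimately show ?thesis by (intro exI[of _ "\<lambda>t. (1 / I) * wint 1 ?b t"]) auto
qed

text \<open>
  The growth \<open>\<epsilon>\<^bsup>-n\<^esup>\<close> is compensated by the weight \<open>t\<^sup>n\<close> on \<open>{0..2 * \<epsilon>}\<close>.
\<close>

lemma vds_cutoff_bound: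
  assumes "smooth f" "smooth \<kappa>"
  shows "\<exists>C\<ge>0. \<forall>\<epsilon>. 0 < \<epsilon> \<and> \<epsilon> \<le> 1 \<longrightarrow> (\<forall>t\<in>{0..2 * \<epsilon>}. norm ((vd ^^ n) (\<lambda>t. f t * \<kappa> (t / \<epsilon>)) t) \<le> C / \<epsilon> ^ n)"
  using assms
proof (induction n arbitrary: f \<kappa>)
  case 0
  have "bounded (f ` {0..2})" "bounded (\<kappa> ` {0..2})"
    using 0 by (auto intro!: compact_imp_bounded compact_continuous_image smooth_continuous)
  then obtain A B where "\<forall>t\<in>{0..2}. norm (f t) \<le> A" "\<forall>t\<in>{0..2}. norm (\<kappa> t) \<le> B" by (auto simp: bounded_iff)
  then have AB: "norm (f t) \<le> A" "norm (\<kappa> t) \<le> B" if "0 \<le> t" "t \<le> 2" for t using that by auto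
  have A: "0 \<le> A" "0 \<le> B" using AB[of 0] norm_ge_zero order_trans by (simp, blast, simp, blast)
  show ?case
  proof (intro exI[of _ "A * B"] conjI allI impI ballI)
    fix \<epsilon> t :: real assume "0 < \<epsilon> \<and> \<epsilon> \<le> 1" "t \<in> {0..2 * \<epsilon>}"
    then have "0 \<le> t" "t \<le> 2" "0 \<le> t / \<epsilon>" "t / \<epsilon> \<le> 2" by (auto simp: field_simps)
    then have "norm (f t) * norm (\<kappa> (t / \<epsilon>)) \<le> A * B" using AB A by (intro mult_mono) auto
    then show "norm ((vd ^^ 0) (\<lambda>t. f t * \<kappa> (t / \<epsilon>)) t) \<le> A * B / \<epsilon> ^ 0" by (simp add: norm_mult)
  qed (use A in simp)
next
  case (Suc n)
  note sf = smooth_vd[OF Suc.prems(1)] and s\<kappa> = smooth_vd[OF Suc.prems(2)]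
  obtain A where A: "0 \<le> A" "\<And>\<epsilon> t. 0 < \<epsilon> \<Longrightarrow> \<epsilon> \<le> 1 \<Longrightarrow> t \<in> {0..2 * \<epsilon>} \<Longrightarrow> norm ((vd ^^ n) (\<lambda>t. vd f t * \<kappa> (t / \<epsilon>)) t) \<le> A / \<epsilon> ^ n"
    using Suc.IH[OF sf(2) Suc.prems(2)] by blast
  obtain B where B: "0 \<le> B" "\<And>\<epsilon> t. 0 < \<epsilon> \<Longrightarrow> \<epsilon> \<le> 1 \<Longrightarrow> t \<in> {0..2 * \<epsilon>} \<Longrightarrow> norm ((vd ^^ n) (\<lambda>t. f t * vd \<kappa> (t / \<epsilon>)) t) \<le> B / \<epsilon> ^ n"
    using Suc.IH[OF Suc.prems(1) s\<kappa>(2)] by blast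
  show ?case
  proof (intro exI[of _ "A + B"] conjI allI impI ballI)
    fix \<epsilon> t :: real assume "0 < \<epsilon> \<and> \<epsilon> \<le> 1" and t: "t \<in> {0..2 * \<epsilon>}"
    then have \<epsilon>: "0 < \<epsilon>" "\<epsilon> \<le> 1" by auto
    have d: "((\<lambda>t. f t * \<kappa> (t / \<epsilon>)) has_vector_derivative vd f t * \<kappa> (t / \<epsilon>) + of_real (1 / \<epsilon>) * (f t * vd \<kappa> (t / \<epsilon>))) (at t)" for t
    proof -
      have "((\<lambda>t. t / \<epsilon>) has_vector_derivative 1 / \<epsilon>) (at t)"
        using \<epsilon> by (auto intro!: derivative_eq_intros simp: has_real_derivative_iff_has_vector_derivative[symmetric])
      from vector_diff_chain_at[OF this s\<kappa>(1)]
      have "((\<lambda>t. \<kappa> (t / \<epsilon>)) has_vector_derivative of_real (1 / \<epsilon>) * vd \<kappa> (t / \<epsilon>)) (at t)"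
        by (simp add: o_def scaleR_conv_of_real)
      from has_vector_derivative_mult[OF sf(1) this] show ?thesis by (simp add: algebra_simps)
    qed
    have s1: "smooth (\<lambda>t. vd f t * \<kappa> (t / \<epsilon>))" "smooth (\<lambda>t. f t * vd \<kappa> (t / \<epsilon>))"
      using sf(2) s\<kappa>(2) Suc.prems by (auto intro: smooth_mult smooth_scale)
    have "(vd ^^ Suc n) (\<lambda>t. f t * \<kappa> (t / \<epsilon>)) = (vd ^^ n) (vd (\<lambda>t. f t * \<kappa> (t / \<epsilon>)))"
      by (simp add: funpow_swap1)
    also have "vd (\<lambda>t. f t * \<kappa> (t / \<epsilon>)) = (\<lambda>t. vd f t * \<kappa> (t / \<epsilon>) + of_real (1 / \<epsilon>) * (f t * vd \<kappa> (t / \<epsilon>)))"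
      using d by (rule vd_eqI)
    also have "(vd ^^ n) \<dots> = (\<lambda>t. (vd ^^ n) (\<lambda>t. vd f t * \<kappa> (t / \<epsilon>)) t + of_real (1 / \<epsilon>) * (vd ^^ n) (\<lambda>t. f t * vd \<kappa> (t / \<epsilon>)) t)"
      by (simp only: vds_add[OF s1(1) smooth_mult[OF smooth_const s1(2)]] vds_cmult[OF s1(2)])
    finally have "norm ((vd ^^ Suc n) (\<lambda>t. f t * \<kappa> (t / \<epsilon>)) t) \<le>
      norm ((vd ^^ n) (\<lambda>t. vd f t * \<kappa> (t / \<epsilon>)) t) + norm (of_real (1 / \<epsilon>) * (vd ^^ n) (\<lambda>t. f t * vd \<kappa> (t / \<epsilon>)) t)"
      by (simp only: norm_triangle_ineq)
    also have "norm (of_real (1 / \<epsilon>) * (vd ^^ n) (\<lambda>t. f t * vd \<kappa> (t / \<epsilon>)) t) = (1 / \<epsilon>) * norm ((vd ^^ n) (\<lambda>t. f t * vd \<kappa> (t / \<epsilon>)) t)"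
      using \<epsilon> by (simp add: norm_mult norm_divide)
    also have "norm ((vd ^^ n) (\<lambda>t. vd f t * \<kappa> (t / \<epsilon>)) t) + \<dots> \<le> A / \<epsilon> ^ n + (1 / \<epsilon>) * (B / \<epsilon> ^ n)"
      using A(2)[OF \<epsilon> t] B(2)[OF \<epsilon> t] \<epsilon> by (intro add_mono mult_left_mono) auto
    also have "\<dots> = (\<epsilon> * A + B) / \<epsilon> ^ Suc n" using \<epsilon> by (simp add: field_simps)
    also have "\<dots> \<le> (A + B) / \<epsilon> ^ Suc n"
      using \<epsilon> A(1) by (intro divide_right_mono add_mono) (auto simp: mult_left_le_one_le)
    finally show "norm ((vd ^^ Suc n) (\<lambda>t. f t * \<kappa> (t / \<epsilon>)) t) \<le> (A + B) / \<epsilon> ^ Suc n" .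
  qed (use A B in simp)
qed

lemma Npow_scale_out:
  assumes "\<forall>t\<le>0. u t = 0" "\<forall>t\<le>0. \<psi> t = 0"
  shows "Npow p \<alpha> (\<lambda>t. u t - (t powr (- \<alpha>)) *\<^sub>R \<psi> t) = Npow p 0 (\<lambda>t. (t powr \<alpha>) *\<^sub>R u t - \<psi> t)"
proof -
  have "Npow p \<alpha> (\<lambda>t. u t - (t powr (- \<alpha>)) *\<^sub>R \<psi> t) = Npow p 0 (\<lambda>t. (t powr \<alpha>) *\<^sub>R (u t - (t powr (- \<alpha>)) *\<^sub>R \<psi> t))"
    using assms by (subst Npow_weight) auto
  also have "(\<lambda>t. (t powr \<alpha>) *\<^sub>R (u t - (t powr (- \<alpha>)) *\<^sub>R \<psi> t)) = (\<lambda>t. (t powr \<alpha>) *\<^sub>R u t - \<psi> t)"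
  proof
    fix t
    show "(t powr \<alpha>) *\<^sub>R (u t - (t powr (- \<alpha>)) *\<^sub>R \<psi> t) = (t powr \<alpha>) *\<^sub>R u t - \<psi> t"
      using assms by (cases "0 < t") (auto simp: scaleR_diff_right powr_add[symmetric])
  qed
  finally show ?thesis .
qed

text \<open>Here \<open>g\<close> is the part of \<open>f\<close> near 0. The estimate takes place
  at an integer order above \<open>\<alpha>\<close>, where the product rule controls the cut-off
  function: the weighted derivative stays bounded as \<open>\<epsilon>\<close> shrinks, and the
  length of \<open>{0..2 * \<epsilon>}\<close> supplies the smallness.\<close>

lemma cutoff_small:
  assumes p: "1 \<le> p" and \<alpha>: "0 \<le> \<alpha>" and f: "smooth_right f" and d: "0 < d"
  shows "\<exists>g w. T_rep p \<alpha> g w \<and> Npow p \<alpha> w < d \<and> (\<lambda>t. f t - g t) \<in> Cc0"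
proof -
  obtain \<kappa> where \<kappa>: "smooth \<kappa>" "\<And>t. t \<le> 1 \<Longrightarrow> \<kappa> t = 1" "\<And>t. 2 \<le> t \<Longrightarrow> \<kappa> t = 0"
    using smooth_cutoff by blast
  obtain b where b: "\<forall>t\<ge>b. f t = 0" and fs: "smooth f" using f by (auto simp: smooth_right_def)
  obtain n where "\<alpha> < real n" using reals_Archimedean2 by blast
  then have n: "\<alpha> < real (Suc n)" by simp
  obtain C where C: "0 \<le> C" "\<And>\<epsilon> t. 0 < \<epsilon> \<Longrightarrow> \<epsilon> \<le> 1 \<Longrightarrow> t \<in> {0..2 * \<epsilon>} \<Longrightarrow> norm ((vd ^^ Suc n) (\<lambda>t. f t * \<kappa> (t / \<epsilon>)) t) \<le> C / \<epsilon> ^ Suc n"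
    using vds_cutoff_bound[OF fs \<kappa>(1), of "Suc n"] by blast
  \<comment> \<open>\<open>K * \<epsilon>\<close> will bound \<open>Npow\<close> at order
    \<open>\<alpha>\<close>: the constant of the descent from order \<open>Suc n\<close>, the
    \<open>p\<close>-th power of the bound for the weighted derivative, and the length
    \<open>2 * \<epsilon>\<close> of the support.\<close>
  define K where "K = weyl_const p \<alpha> (real (Suc n) - \<alpha>) powr p * ((2 ^ Suc n * C) powr p * 2)"
  have K: "0 \<le> K" by (simp add: K_def)
  obtain r where r: "0 < r" "ennreal r < d"
    using ennreal_pos_real_less[OF d] by blast
  define \<epsilon> where "\<epsilon> = min 1 (r / (K + 1))"
  have \<epsilon>: "0 < \<epsilon>" "\<epsilon> \<le> 1" using r K by (auto simp: \<epsilon>_def)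
  have "K * \<epsilon> \<le> K * (r / (K + 1))" using K by (intro mult_left_mono) (auto simp: \<epsilon>_def)
  also have "\<dots> \<le> r" using K r by (simp add: field_simps)
  finally have K\<epsilon>: "ennreal (K * \<epsilon>) < d" using r(2) ennreal_leI le_less_trans by blast
  define g where "g = (\<lambda>t. f t * \<kappa> (t / \<epsilon>))"
  have gs: "smooth g" unfolding g_def using fs \<kappa>(1) by (intro smooth_mult smooth_scale)
  have g0: "g t = 0" if "2 * \<epsilon> \<le> t" for t using \<kappa>(3)[of "t / \<epsilon>"] that \<epsilon> by (simp add: g_def field_simps)
  have gr: "smooth_right g" using gs g0 unfolding smooth_right_def by blast
  define v where "v = (\<lambda>t. if 0 < t then (-1) ^ Suc n * (vd ^^ Suc n) g t else 0)"
  have v: "T_rep p (Suc n) g v" unfolding v_def by (rule T_rep_smooth_right[OF p gr])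
  have Nv: "Npow p (Suc n) v \<le> ennreal ((2 ^ Suc n * C) powr p * (2 * \<epsilon>))"
  proof (rule Npow_le_bounded_support[OF p])
    fix t assume t: "0 < t" "t \<le> 2 * \<epsilon>"
    then have "t powr real (Suc n) \<le> (2 * \<epsilon>) ^ Suc n" using power_mono[of t "2 * \<epsilon>" "Suc n"] by (simp only: powr_realpow less_imp_le)
    moreover have "norm (v t) \<le> C / \<epsilon> ^ Suc n"
      using C(2)[OF \<epsilon>, of t] t by (simp add: v_def g_def norm_mult norm_power del: funpow.simps power_Suc)
    ultimately have "t powr real (Suc n) * norm (v t) \<le> (2 * \<epsilon>) ^ Suc n * (C / \<epsilon> ^ Suc n)"
      using \<epsilon>(1) by (intro mult_mono) auto
    also have "\<dots> = 2 ^ Suc n * C" using \<epsilon>(1) by (simp add: power_mult_distrib)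
    finally show "t powr real (Suc n) * norm (v t) \<le> 2 ^ Suc n * C" .
  next
    fix t assume t: "t \<le> 0 \<or> 2 * \<epsilon> < t"
    have "(vd ^^ Suc n) g t = 0" if "2 * \<epsilon> < t"
      by (rule vds_zero_on_open[of "{2 * \<epsilon><..}"]) (use g0 that in auto)
    with t show "v t = 0" by (auto simp: v_def simp del: funpow.simps power_Suc)
  qed (use \<epsilon>(1) C(1) in auto)
  let ?w = "wext (real (Suc n) - \<alpha>) v"
  have w: "T_rep p \<alpha> g ?w" by (rule T_rep_lower[OF p \<alpha> n v])
  have "Npow p \<alpha> ?w \<le> ennreal (weyl_const p \<alpha> (real (Suc n) - \<alpha>) powr p) * Npow p (Suc n) v"
    by (rule wLp_mono_wint(2)[OF p \<alpha> n T_repD(1)[OF v]])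
  also have "\<dots> \<le> ennreal (weyl_const p \<alpha> (real (Suc n) - \<alpha>) powr p) * ennreal ((2 ^ Suc n * C) powr p * (2 * \<epsilon>))"
    by (intro mult_left_mono Nv) simp
  also have "\<dots> = ennreal (K * \<epsilon>)" by (simp add: K_def ennreal_mult'[symmetric] mult_ac)
  finally have Nw: "Npow p \<alpha> ?w < d" using K\<epsilon> by simp
  have "f t - g t = 0" if "t < \<epsilon> \<or> b < t" for t
    using that b \<kappa>(2)[of "t / \<epsilon>"] \<epsilon> by (auto simp: g_def field_simps)
  then have "(\<lambda>t. f t - g t) \<in> Cc0"
    using smooth_diff[OF fs gs] \<epsilon>(1) unfolding Cc0_def by (intro CollectI conjI exI[of _ \<epsilon>] exI[of _ b]) auto
  with w Nw show ?thesis by (intro exI[of _ g] exI[of _ ?w] conjI)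
qed

lemma Cc0_dense_T:
  assumes p: "1 \<le> p" and \<alpha>: "0 \<le> \<alpha>" and u: "T_rep p \<alpha> f u" and e: "0 < e"
  shows "\<exists>d\<in>Cc0. \<exists>v. T_rep p \<alpha> d v \<and> Npow p \<alpha> (\<lambda>t. u t - v t) < e"
proof -
  note um [measurable] = T_repD(2)[OF u]
  have u0: "\<forall>t\<le>0. u t = 0" using T_repD(3)[OF u] by blast
  obtain d where d: "0 < d" "\<And>x y. x < d \<Longrightarrow> y < d \<Longrightarrow> ennreal (2 powr p) * (x + y) < e"
    using ennreal_half_split[OF e] by blast
  define g where "g = (\<lambda>t. (t powr \<alpha>) *\<^sub>R u t)"
  have "g \<in> wLp p 0" unfolding wLp_def g_def using u0 T_repD(4)[OF u] by (auto simp: Npow_weight)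
  \<comment> \<open>Tolerance \<open>d\<close> serves the cut-off argument, tolerance
    \<open>e\<close> the case \<open>\<alpha> = 0\<close>, where the approximant is used as it
    is.\<close>
  from Cc0_dense_Lp[OF p this, of "min d e"] d e obtain \<psi> where \<psi>: "\<psi> \<in> Cc0" "Npow p 0 (\<lambda>t. g t - \<psi> t) < d" "Npow p 0 (\<lambda>t. g t - \<psi> t) < e" by auto
  have \<psi>0: "\<forall>t\<le>0. \<psi> t = 0" using \<psi>(1) by (auto simp: Cc0_def)
  define \<phi> where "\<phi> = (\<lambda>t. (t powr (- \<alpha>)) *\<^sub>R \<psi> t)"
  have \<phi>: "\<phi> \<in> Cc0" unfolding \<phi>_def by (rule Cc0_powr_mult[OF \<psi>(1)])
  have N\<phi>: "Npow p \<alpha> (\<lambda>t. u t - \<phi> t) = Npow p 0 (\<lambda>t. g t - \<psi> t)"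
    unfolding \<phi>_def g_def by (rule Npow_scale_out[OF u0 \<psi>0])
  have \<phi>m [measurable]: "\<phi> \<in> borel_measurable borel" using \<phi> by (auto simp: Cc0_def intro: smooth_measurable)
  have \<phi>0: "\<forall>t\<le>0. \<phi> t = 0" using \<phi> by (auto simp: Cc0_def)
  have "(\<lambda>t. u t - \<phi> t) \<in> wLp p \<alpha>" unfolding wLp_def using N\<phi> \<psi>(2) u0 \<phi>0 by (auto intro: less_trans simp: less_top[symmetric] dest: less_imp_neq)
  from wLp_diff[OF p T_repD(1)[OF u] this] have \<phi>w: "\<phi> \<in> wLp p \<alpha>" by simp
  show ?thesis
  proof (cases "\<alpha> = 0")
    case True
    then have "T_rep p \<alpha> \<phi> \<phi>" using \<phi>w by (simp add: T_rep_def)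
    then show ?thesis using \<phi> N\<phi> \<psi>(3) by (intro bexI[of _ \<phi>] exI[of _ \<phi>] conjI) auto
  next
    case False
    then have \<alpha>': "0 < \<alpha>" using \<alpha> by simp
    \<comment> \<open>\<open>f0\<close> is smooth and vanishes far to the right, but in general not
      near 0; \<open>cutoff_small\<close> repairs this.\<close>
    define f0 where "f0 = wint \<alpha> \<phi>"
    have f0: "smooth_right f0" unfolding f0_def by (rule smooth_right_wint[OF Cc0_smooth_right[OF \<phi>] \<alpha>'])
    have r0: "T_rep p \<alpha> f0 \<phi>" using False \<phi>w by (simp add: T_rep_def f0_def)
    obtain h w where hw: "T_rep p \<alpha> h w" "Npow p \<alpha> w < d" "(\<lambda>t. f0 t - h t) \<in> Cc0"
      using cutoff_small[OF p \<alpha> f0 d(1)] by blast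
    have [measurable]: "w \<in> borel_measurable borel" using T_repD(2)[OF hw(1)] .
    have "T_rep p \<alpha> (\<lambda>t. f0 t - h t) (\<lambda>t. \<phi> t - w t)" by (rule T_rep_diff[OF p \<alpha> r0 hw(1)])
    moreover have "Npow p \<alpha> (\<lambda>t. u t - (\<phi> t - w t)) < e"
    proof -
      have "Npow p \<alpha> (\<lambda>t. (u t - \<phi> t) + w t) \<le> ennreal (2 powr p) * (Npow p \<alpha> (\<lambda>t. u t - \<phi> t) + Npow p \<alpha> w)"
        by (rule Npow_add_le[OF p]) measurable
      also have "\<dots> < e" using N\<phi> \<psi>(2) hw(2) by (intro d(2)) auto
      finally show ?thesis by (simp add: algebra_simps)
    qed
    ultimately show ?thesis using hw(3) by blast
  qed
qed

section \<open>The convolution kernel\<close>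

text \<open>
  Positive and negative part of the density of \<open>R\<^sub>r * R\<^sub>t\<close>, for \<open>r, t > 0\<close>.
\<close>

definition kplus :: "real \<Rightarrow> real \<Rightarrow> real \<Rightarrow> real \<Rightarrow> real" where
  "kplus \<alpha> r t s = (if max r t < s \<and> s < r + t then (r + t - s) powr (\<alpha> - 1) / Gamma \<alpha> else 0)"

definition kminus :: "real \<Rightarrow> real \<Rightarrow> real \<Rightarrow> real \<Rightarrow> real" where
  "kminus \<alpha> r t s = (if s < min r t then (r + t - s) powr (\<alpha> - 1) / Gamma \<alpha> else 0)"

lemma kplus_nonneg [simp]: "0 < \<alpha> \<Longrightarrow> 0 \<le> kplus \<alpha> r t s" by (simp add: kplus_def Gamma_real_nonneg)
lemma kminus_nonneg [simp]: "0 < \<alpha> \<Longrightarrow> 0 \<le> kminus \<alpha> r t s" by (simp add: kminus_def Gamma_real_nonneg)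

lemma measurable_kplus [measurable]:
  assumes [measurable]: "f \<in> borel_measurable M" "g \<in> borel_measurable M" "h \<in> borel_measurable M"
  shows "(\<lambda>x. kplus a (f x) (g x) (h x)) \<in> borel_measurable M"
  unfolding kplus_def by measurable

lemma measurable_kminus [measurable]:
  assumes [measurable]: "f \<in> borel_measurable M" "g \<in> borel_measurable M" "h \<in> borel_measurable M"
  shows "(\<lambda>x. kminus a (f x) (g x) (h x)) \<in> borel_measurable M"
  unfolding kminus_def by measurable

text \<open>
  After the substitution \<open>s = r + y\<close> all three integrals have the same integrand, which is symmetric under
  \<open>y \<mapsto> x - r + t - y\<close>; only the domains differ. The negative part is moved to the left so that
  the identity makes sense in \<open>[0, \<infinity>]\<close>.
\<close>

lemma wker_convolution_identity_aux:
  assumes \<alpha>: "0 < \<alpha>" and x: "0 < x" and tr: "0 < t" "t \<le> r"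
  shows "(\<integral>\<^sup>+y. ennreal (indicator {0<..<x} y * wker \<alpha> (x - y) r * wker \<alpha> y t) \<partial>lborel) + (\<integral>\<^sup>+s. ennreal (kminus \<alpha> r t s * wker \<alpha> x s) \<partial>lborel)
    = (\<integral>\<^sup>+s. ennreal (kplus \<alpha> r t s * wker \<alpha> x s) \<partial>lborel)"
proof -
  let ?P = "\<lambda>s. ennreal (kplus \<alpha> r t s * wker \<alpha> x s)" and ?M = "\<lambda>s. ennreal (kminus \<alpha> r t s * wker \<alpha> x s)"
  define \<Phi> where "\<Phi> = (\<lambda>y. ennreal ((t - y) powr (\<alpha> - 1) * (y - (x - r)) powr (\<alpha> - 1) / (Gamma \<alpha> * Gamma \<alpha>)))"
  have [measurable]: "\<Phi> \<in> borel_measurable borel" unfolding \<Phi>_def by measurable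
  define I where "I = (\<lambda>S. \<integral>\<^sup>+y. \<Phi> y * indicator S y \<partial>lborel)"
  have plus: "(\<integral>\<^sup>+s. ?P s \<partial>lborel) = I {max 0 (x - r)<..<t}"
  proof -
    have "(\<integral>\<^sup>+s. ?P s \<partial>lborel) = (\<integral>\<^sup>+y. ?P (r + 1 * y) \<partial>lborel)"
      by (subst nn_integral_real_affine[where c=1 and t=r]) auto
    also have "\<dots> = I {max 0 (x - r)<..<t}"
      unfolding I_def \<Phi>_def using tr by (intro nn_integral_cong) (auto simp: kplus_def wker_def indicator_def algebra_simps)
    finally show ?thesis .
  qed
  have minus: "(\<integral>\<^sup>+s. ?M s \<partial>lborel) = I {x - r<..<t - r}"
  proof -
    have "(\<integral>\<^sup>+s. ?M s \<partial>lborel) = (\<integral>\<^sup>+y. ?M (r + 1 * y) \<partial>lborel)"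
      by (subst nn_integral_real_affine[where c=1 and t=r]) auto
    also have "\<dots> = I {x - r<..<t - r}"
      unfolding I_def \<Phi>_def using tr by (intro nn_integral_cong) (auto simp: kminus_def wker_def indicator_def algebra_simps)
    finally show ?thesis .
  qed
  have lhs: "(\<integral>\<^sup>+y. ennreal (indicator {0<..<x} y * wker \<alpha> (x - y) r * wker \<alpha> y t) \<partial>lborel) = I {max 0 (x - r)<..<min x t}"
    unfolding I_def \<Phi>_def by (intro nn_integral_cong) (auto simp: wker_def indicator_def algebra_simps)
  \<comment> \<open>For \<open>t \<le> x\<close> the domain of the negative part is empty. For
    \<open>x < t\<close> its reflection \<open>{x<..<t}\<close> and the convolution domain
    \<open>{0<..<x}\<close> together fill \<open>{0<..<t}\<close> up to the point
    \<open>x\<close>.\<close>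
  show ?thesis
  proof (cases "t \<le> x")
    case True
    then have "I {x - r<..<t - r} = 0" by (simp add: I_def)
    then show ?thesis using True unfolding plus minus lhs by (simp add: min_def)
  next
    case False
    have refl: "I {x - r<..<t - r} = I {x<..<t}"
    proof -
      have "I {x - r<..<t - r} = (\<integral>\<^sup>+y. \<Phi> ((x - r + t) + (-1) * y) * indicator {x - r<..<t - r} ((x - r + t) + (-1) * y) \<partial>lborel)"
        unfolding I_def by (subst nn_integral_real_affine[where c="-1" and t="x - r + t"]) auto
      also have "\<dots> = I {x<..<t}"
        unfolding I_def \<Phi>_def by (intro nn_integral_cong) (auto simp: indicator_def algebra_simps)
      finally show ?thesis .
    qed
    have "I {0<..<x} + I {x<..<t} = (\<integral>\<^sup>+y. \<Phi> y * indicator {0<..<x} y + \<Phi> y * indicator {x<..<t} y \<partial>lborel)"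
      unfolding I_def by (intro nn_integral_add[symmetric]) auto
    also have "\<dots> = I {0<..<t}"
      unfolding I_def
    proof (intro nn_integral_cong_AE eventually_mono[OF AE_lborel_singleton[of x]])
      fix y assume "y \<noteq> x"
      then show "\<Phi> y * indicator {0<..<x} y + \<Phi> y * indicator {x<..<t} y = \<Phi> y * indicator {0<..<t} y"
        using False x by (auto simp: indicator_def)
    qed
    finally show ?thesis using False tr x unfolding plus minus lhs refl by (simp add: min_def max_def)
  qed
qed

text \<open>The case \<open>r < t\<close> follows by the reflection that exchanges the factors of
  the convolution, since \<open>kplus\<close> and \<open>kminus\<close> are symmetric in
  \<open>r\<close> and \<open>t\<close>.\<close>

lemma wker_convolution_identity:
  assumes \<alpha>: "0 < \<alpha>" and x: "0 < x" and tr: "0 < t" "0 < r"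
  shows "(\<integral>\<^sup>+y. ennreal (indicator {0<..<x} y * wker \<alpha> (x - y) r * wker \<alpha> y t) \<partial>lborel) + (\<integral>\<^sup>+s. ennreal (kminus \<alpha> r t s * wker \<alpha> x s) \<partial>lborel)
    = (\<integral>\<^sup>+s. ennreal (kplus \<alpha> r t s * wker \<alpha> x s) \<partial>lborel)"
proof (cases "t \<le> r")
  case True
  then show ?thesis using wker_convolution_identity_aux[OF \<alpha> x tr(1)] by simp
next
  case False
  have "(\<integral>\<^sup>+y. ennreal (indicator {0<..<x} y * wker \<alpha> (x - y) r * wker \<alpha> y t) \<partial>lborel)
    = (\<integral>\<^sup>+y. ennreal (indicator {0<..<x} (x + (-1) * y) * wker \<alpha> (x - (x + (-1) * y)) r * wker \<alpha> (x + (-1) * y) t) \<partial>lborel)"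
    by (subst nn_integral_real_affine[where c="-1" and t=x]) auto
  also have "\<dots> = (\<integral>\<^sup>+y. ennreal (indicator {0<..<x} y * wker \<alpha> (x - y) t * wker \<alpha> y r) \<partial>lborel)"
    by (intro nn_integral_cong) (auto simp: indicator_def mult_ac)
  finally have 1: "(\<integral>\<^sup>+y. ennreal (indicator {0<..<x} y * wker \<alpha> (x - y) r * wker \<alpha> y t) \<partial>lborel) = \<dots>" .
  have 2: "kplus \<alpha> r t = kplus \<alpha> t r" "kminus \<alpha> r t = kminus \<alpha> t r"
    by (auto simp: kplus_def kminus_def fun_eq_iff max.commute min.commute add.commute)
  show ?thesis unfolding 1 2 using wker_convolution_identity_aux[OF \<alpha> x tr(2), of t] False by simp
qed

text \<open>
  The kernel that maps \<open>t\<^sup>\<alpha> W\<^sup>\<alpha> f(t)\<close> and \<open>r\<^sup>\<alpha> W\<^sup>\<alpha> g(r)\<close> to a majorant of \<open>s\<^sup>\<alpha> W\<^sup>\<alpha>(g * f)(s)\<close>.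
\<close>

definition mpos :: "real \<Rightarrow> real \<Rightarrow> real \<Rightarrow> real \<Rightarrow> real" where
  "mpos \<alpha> r t s = indicator {0<..} s * indicator {0<..} r * indicator {0<..} t * (s powr \<alpha> * r powr (- \<alpha>) * t powr (- \<alpha>) * (kplus \<alpha> r t s + kminus \<alpha> r t s))"

lemma measurable_mpos [measurable]:
  assumes [measurable]: "f \<in> borel_measurable M" "g \<in> borel_measurable M" "h \<in> borel_measurable M"
  shows "(\<lambda>x. mpos a (f x) (g x) (h x)) \<in> borel_measurable M"
  unfolding mpos_def by measurable

text \<open>The power is increasing or decreasing according to the sign of
  \<open>\<alpha> - 1\<close>, and the factor \<open>2 powr \<alpha>\<close> covers both
  cases.\<close>

lemma powr_shift_bound:
  fixes \<alpha> M z :: real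
  assumes "0 < M" "M \<le> z" "z \<le> 2 * M" "0 < \<alpha>"
  shows "z powr (\<alpha> - 1) \<le> 2 powr \<alpha> * M powr (\<alpha> - 1)"
proof (cases "1 \<le> \<alpha>")
  case True
  then have "z powr (\<alpha> - 1) \<le> (2 * M) powr (\<alpha> - 1)" using assms by (intro powr_mono2) auto
  also have "\<dots> = 2 powr (\<alpha> - 1) * M powr (\<alpha> - 1)" using assms by (simp add: powr_mult)
  also have "\<dots> \<le> 2 powr \<alpha> * M powr (\<alpha> - 1)" by (intro mult_right_mono powr_mono) auto
  finally show ?thesis .
next
  case False
  then have "z powr (\<alpha> - 1) \<le> M powr (\<alpha> - 1)" using assms by (intro powr_mono2') auto
  also have "\<dots> \<le> 2 powr \<alpha> * M powr (\<alpha> - 1)"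
    using ge_one_powr_ge_zero[of 2 \<alpha>] assms by (simp add: mult_le_cancel_right1)
  finally show ?thesis .
qed

text \<open>
  The three terms cover \<open>r \<le> t < s\<close>, \<open>t < r < s\<close> and \<open>s < min r t\<close>. As functions of \<open>s\<close> and \<open>t\<close> they are a
  convolution kernel, a translated adjoint Cesaro kernel of order \<open>\<alpha>\<close>, and one of order \<open>1\<close>.
\<close>

lemma mpos_bound:
  assumes \<alpha>: "0 < \<alpha>" and r: "0 < r"
  shows "mpos \<alpha> r t s \<le> 2 powr \<alpha> * (r powr (- \<alpha>) * (indicator {0<..} (s - t) * wker \<alpha> (s - t) r))
     + (2 powr \<alpha> * (indicator {0<..} (s - r) * (s - r) powr 0 * wker \<alpha> (s - r) t * t powr (- \<alpha>))
     + 2 powr \<alpha> / Gamma \<alpha> * (indicator {0<..} s * s powr 0 * wker 1 s t * t powr (- 1)))"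
    (is "_ \<le> ?A1 + (?A2 + ?B)")
proof -
  have G: "0 < Gamma \<alpha>" using \<alpha> by (rule Gamma_real_pos)
  have nn: "0 \<le> ?A1" "0 \<le> ?A2" "0 \<le> ?B" using \<alpha> G by auto
  show ?thesis
  proof (cases "0 < s \<and> 0 < t")
    case False
    then have "mpos \<alpha> r t s = 0" by (auto simp: mpos_def)
    then show ?thesis using nn by linarith
  next
    case True
    then have s: "0 < s" and t: "0 < t" by auto
    have eq: "mpos \<alpha> r t s = s powr \<alpha> * r powr (- \<alpha>) * t powr (- \<alpha>) * (kplus \<alpha> r t s + kminus \<alpha> r t s)"
      using s t r by (simp add: mpos_def)
    have "(max r t < s \<and> s < r + t \<and> r \<le> t) \<or> (max r t < s \<and> s < r + t \<and> t < r) \<or> s < min r t \<or> (kplus \<alpha> r t s = 0 \<and> kminus \<alpha> r t s = 0)"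
      by (simp only: kplus_def kminus_def if_False if_True) (meson not_le)
    then consider "max r t < s" "s < r + t" "r \<le> t" | "max r t < s" "s < r + t" "t < r" | "s < min r t" | "kplus \<alpha> r t s = 0 \<and> kminus \<alpha> r t s = 0"
      by blast
    then show ?thesis
    proof cases
      case 1
      have "s powr \<alpha> \<le> (2 * t) powr \<alpha>" using 1 s \<alpha> by (intro powr_mono2) auto
      then have "s powr \<alpha> * t powr (- \<alpha>) \<le> (2 * t) powr \<alpha> * t powr (- \<alpha>)" by (rule mult_right_mono) simp
      also have "\<dots> = 2 powr \<alpha>" using t by (simp add: powr_mult powr_minus)
      finally have le: "s powr \<alpha> * t powr (- \<alpha>) \<le> 2 powr \<alpha>" .
      have "mpos \<alpha> r t s = (s powr \<alpha> * t powr (- \<alpha>)) * (r powr (- \<alpha>) * wker \<alpha> (s - t) r)"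
        using 1 unfolding eq by (simp add: kplus_def kminus_def wker_def algebra_simps)
      also have "\<dots> \<le> 2 powr \<alpha> * (r powr (- \<alpha>) * wker \<alpha> (s - t) r)"
        using le \<alpha> by (intro mult_right_mono) auto
      also have "\<dots> = ?A1" using 1 by simp
      finally show ?thesis using nn by linarith
    next
      case 2
      have "s powr \<alpha> \<le> (2 * r) powr \<alpha>" using 2 s \<alpha> by (intro powr_mono2) auto
      then have "s powr \<alpha> * r powr (- \<alpha>) \<le> (2 * r) powr \<alpha> * r powr (- \<alpha>)" by (rule mult_right_mono) simp
      also have "\<dots> = 2 powr \<alpha>" using r by (simp add: powr_mult powr_minus)
      finally have le: "s powr \<alpha> * r powr (- \<alpha>) \<le> 2 powr \<alpha>" .
      have "mpos \<alpha> r t s = (s powr \<alpha> * r powr (- \<alpha>)) * (t powr (- \<alpha>) * wker \<alpha> (s - r) t)"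
        using 2 unfolding eq by (simp add: kplus_def kminus_def wker_def algebra_simps)
      also have "\<dots> \<le> 2 powr \<alpha> * (t powr (- \<alpha>) * wker \<alpha> (s - r) t)"
        using le \<alpha> by (intro mult_right_mono) auto
      also have "\<dots> = ?A2" using 2 by simp
      finally show ?thesis using nn by linarith
    next
      case 3
      \<comment> \<open>As \<open>s < m\<close>, the base \<open>m + M - s\<close> lies between
        \<open>M\<close> and \<open>2 * M\<close>, so its power is comparable to that of
        \<open>M\<close>.\<close>
      define m M where "m = min r t" and "M = max r t"
      have mM: "0 < m" "m \<le> M" "r + t = m + M" "s < m" "t \<le> M" using 3 r t by (auto simp: m_def M_def)
      have "r powr (- \<alpha>) * t powr (- \<alpha>) = m powr (- \<alpha>) * M powr (- \<alpha>)"
        by (auto simp: m_def M_def min_def max_def)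
      then have "mpos \<alpha> r t s = (s powr \<alpha> * m powr (- \<alpha>)) * (M powr (- \<alpha>) * (m + M - s) powr (\<alpha> - 1)) / Gamma \<alpha>"
        using 3 mM(3) unfolding eq by (simp add: kplus_def kminus_def mult.assoc)
      also have "\<dots> \<le> 1 * (M powr (- \<alpha>) * (2 powr \<alpha> * M powr (\<alpha> - 1))) / Gamma \<alpha>"
      proof (intro divide_right_mono mult_mono mult_left_mono powr_shift_bound)
        have "s powr \<alpha> * m powr (- \<alpha>) \<le> m powr \<alpha> * m powr (- \<alpha>)"
          using s mM \<alpha> by (intro mult_right_mono powr_mono2) auto
        also have "\<dots> = 1" using mM by (simp add: powr_minus)
        finally show "s powr \<alpha> * m powr (- \<alpha>) \<le> 1" .
      qed (use mM s \<alpha> G in auto)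
      also have "M powr (- \<alpha>) * (2 powr \<alpha> * M powr (\<alpha> - 1)) = 2 powr \<alpha> * (M powr (- \<alpha>) * M powr (\<alpha> - 1))" by simp
      also have "M powr (- \<alpha>) * M powr (\<alpha> - 1) = M powr (- 1)" by (simp add: powr_add[symmetric])
      also have "1 * (2 powr \<alpha> * M powr (- 1)) / Gamma \<alpha> \<le> 1 * (2 powr \<alpha> * t powr (- 1)) / Gamma \<alpha>"
        using mM t G by (intro divide_right_mono mult_left_mono powr_mono2') auto
      also have "\<dots> = ?B" using 3 s by (simp add: wker_def)
      finally show ?thesis using nn by linarith
    next
      case 4
      then have "mpos \<alpha> r t s = 0" by (simp add: mpos_def)
      then show ?thesis using nn by linarith
    qed
  qed
qed

lemma weyl_const_nonneg: "0 < \<alpha> + 1 / p \<Longrightarrow> 0 < \<mu> \<Longrightarrow> 0 \<le> weyl_const p \<alpha> \<mu>"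
  by (simp add: weyl_const_def Gamma_real_nonneg)

text \<open>One summand for each term of \<open>mpos_bound\<close>, and a factor
  \<open>2 powr p\<close> for each of the two uses of \<open>epow_add\<close>.\<close>

definition mconst :: "real \<Rightarrow> real \<Rightarrow> real" where
  "mconst p \<alpha> = 2 powr p * ((2 powr \<alpha> / Gamma (\<alpha> + 1)) powr p
     + 2 powr p * ((2 powr \<alpha> * weyl_const p 0 \<alpha>) powr p + (2 powr \<alpha> / Gamma \<alpha> * weyl_const p 0 1) powr p))"

text \<open>The point is uniformity in \<open>r\<close>: the first term of \<open>mpos_bound\<close>
  has integrals in \<open>s\<close> and in \<open>t\<close> that do not depend on \<open>r\<close>,
  the second is a kernel of \<open>weyl_schur\<close> translated by \<open>r\<close>, and the third
  does not contain \<open>r\<close>.\<close>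

lemma mpos_schur:
  assumes p: "1 \<le> p" and \<alpha>: "0 < \<alpha>" and r: "0 < r" and [measurable]: "F \<in> borel_measurable borel"
  shows "(\<integral>\<^sup>+s. epow p (\<integral>\<^sup>+t. ennreal (mpos \<alpha> r t s) * F t \<partial>lborel) \<partial>lborel) \<le> ennreal (mconst p \<alpha>) * (\<integral>\<^sup>+t. epow p (F t) \<partial>lborel)"
proof -
  let ?N = "\<integral>\<^sup>+t. epow p (F t) \<partial>lborel"
  have G: "0 < Gamma \<alpha>" "0 < Gamma (\<alpha> + 1)" using \<alpha> by (auto intro: Gamma_real_pos)
  define A where "A = (\<lambda>s t. 2 powr \<alpha> * (r powr (- \<alpha>) * (indicator {0<..} (s - t) * wker \<alpha> (s - t) r)))"
  define K2 where "K2 = (\<lambda>s t. indicator {0<..} s * s powr 0 * wker \<alpha> s t * t powr (- \<alpha>))"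
  define K3 where "K3 = (\<lambda>s t. indicator {0<..} s * s powr 0 * wker 1 s t * t powr (- 1))"
  have nn: "0 \<le> A s t" "0 \<le> K2 s t" "0 \<le> K3 s t" for s t using \<alpha> by (auto simp: A_def K2_def K3_def)
  have Am [measurable]: "(\<lambda>(s, t). ennreal (A s t)) \<in> borel_measurable (lborel \<Otimes>\<^sub>M lborel)" unfolding A_def by measurable
  have Am' [measurable]: "(\<lambda>t. A s t) \<in> borel_measurable borel" for s unfolding A_def by measurable
  have K2m [measurable]: "(\<lambda>t. K2 s t) \<in> borel_measurable borel" "(\<lambda>(s, t). K2 s t) \<in> borel_measurable (lborel \<Otimes>\<^sub>M lborel)" for s unfolding K2_def by measurable
  have K3m [measurable]: "(\<lambda>t. K3 s t) \<in> borel_measurable borel" "(\<lambda>(s, t). K3 s t) \<in> borel_measurable (lborel \<Otimes>\<^sub>M lborel)" for s unfolding K3_def by measurable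
  define a where "a = 2 powr \<alpha> / Gamma (\<alpha> + 1)"
  let ?X1 = "\<lambda>s. \<integral>\<^sup>+t. ennreal (A s t) * F t \<partial>lborel"
  let ?Y2 = "\<lambda>s. \<integral>\<^sup>+t. ennreal (K2 s t) * F t \<partial>lborel" and ?Y3 = "\<lambda>s. \<integral>\<^sup>+t. ennreal (K3 s t) * F t \<partial>lborel"
  let ?X2 = "\<lambda>s. ennreal (2 powr \<alpha>) * ?Y2 (s - r)" and ?X3 = "\<lambda>s. ennreal (2 powr \<alpha> / Gamma \<alpha>) * ?Y3 s"
  let ?S = "\<lambda>s t. ennreal (A s t) + (ennreal (2 powr \<alpha>) * ennreal (K2 (s - r) t) + ennreal (2 powr \<alpha> / Gamma \<alpha>) * ennreal (K3 s t))"
  let ?T = "\<lambda>s t. ennreal (A s t) * F t + (ennreal (2 powr \<alpha>) * (ennreal (K2 (s - r) t) * F t) + ennreal (2 powr \<alpha> / Gamma \<alpha>) * (ennreal (K3 s t) * F t))"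
  let ?k = "\<lambda>y. ennreal (2 powr \<alpha> * (r powr (- \<alpha>) * (indicator {0<..} y * wker \<alpha> y r)))"
  have a: "0 < a" using G by (simp add: a_def)
  have w0: "(\<integral>\<^sup>+y. ennreal (indicator {0<..} y * wker \<alpha> y r) \<partial>lborel) = ennreal (r powr \<alpha> / Gamma (\<alpha> + 1))"
  proof -
    have "(\<integral>\<^sup>+y. ennreal (indicator {0<..} y * wker \<alpha> y r) \<partial>lborel) = (\<integral>\<^sup>+x. ennreal (indicator {0<..} x * x powr (1 - 1)) * ennreal (wker \<alpha> x r) \<partial>lborel)"
      by (intro nn_integral_cong) (auto simp: indicator_def)
    also have "\<dots> = ennreal (Gamma 1 / Gamma (1 + \<alpha>) * r powr (1 + \<alpha> - 1))"
      using \<alpha> r by (intro wker_power_from_0) auto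
    finally show ?thesis by (simp add: add.commute)
  qed
  have ka: "(\<integral>\<^sup>+y. ?k y \<partial>lborel) = ennreal a"
  proof -
    have "(\<integral>\<^sup>+y. ?k y \<partial>lborel) =
       (\<integral>\<^sup>+y. ennreal (2 powr \<alpha> * r powr (- \<alpha>)) * ennreal (indicator {0<..} y * wker \<alpha> y r) \<partial>lborel)"
      using \<alpha> by (intro nn_integral_cong) (simp add: ennreal_mult'[symmetric] mult.assoc)
    also have "\<dots> = ennreal (2 powr \<alpha> * r powr (- \<alpha>)) * ennreal (r powr \<alpha> / Gamma (\<alpha> + 1))"
      by (subst nn_integral_cmult, measurable, subst w0) simp
    also have "\<dots> = ennreal a" using r G by (simp add: ennreal_mult'[symmetric] a_def powr_minus)
    finally show ?thesis .
  qed
  have S1: "(\<integral>\<^sup>+s. epow p (?X1 s) \<partial>lborel) \<le> ennreal (a powr p) * ?N"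
  proof -
    have "(\<integral>\<^sup>+s. epow p (?X1 s) \<partial>lborel) \<le> ennreal (a powr (p - 1) * a) * ?N"
    proof (rule schur_test[where v="\<lambda>_. 1" and w="\<lambda>_. 1", OF p a])
      fix s
      have "(\<integral>\<^sup>+t. ennreal (A s t) \<partial>lborel) = (\<integral>\<^sup>+y. ennreal (A s (s + (-1) * y)) \<partial>lborel)"
        by (subst nn_integral_real_affine[where c="-1" and t=s]) auto
      then show "(\<integral>\<^sup>+t. ennreal (A s t) * ennreal 1 \<partial>lborel) \<le> ennreal (a * 1)"
        using ka by (simp add: A_def)
    next
      fix t
      have [measurable]: "(\<lambda>s. A s t) \<in> borel_measurable borel" unfolding A_def by measurable
      have "(\<integral>\<^sup>+s. ennreal (A s t) \<partial>lborel) = (\<integral>\<^sup>+y. ennreal (A (t + 1 * y) t) \<partial>lborel)"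
        by (subst nn_integral_real_affine[where c=1 and t=t]) auto
      then show "(\<integral>\<^sup>+s. ennreal (A s t) * ennreal (1 powr (p - 1)) \<partial>lborel) \<le> ennreal (a * 1 powr (p - 1))"
        using ka by (simp add: A_def)
    qed (use a in auto)
    also have "a powr (p - 1) * a = a powr p" using a by (metis diff_add_cancel powr_add powr_one less_eq_real_def)
    finally show ?thesis .
  qed
  have S2: "(\<integral>\<^sup>+s. epow p (?X2 s) \<partial>lborel) \<le> ennreal ((2 powr \<alpha> * weyl_const p 0 \<alpha>) powr p) * ?N"
  proof -
    have "(\<integral>\<^sup>+s. epow p (?X2 s) \<partial>lborel)
      = ennreal ((2 powr \<alpha>) powr p) * (\<integral>\<^sup>+s. epow p (?Y2 (s - r)) \<partial>lborel)"
      using p by (simp add: epow_mult nn_integral_cmult)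
    also have "(\<integral>\<^sup>+s. epow p (?Y2 (s - r)) \<partial>lborel) = (\<integral>\<^sup>+s. epow p (?Y2 s) \<partial>lborel)"
      by (subst nn_integral_real_affine[where c=1 and t=r]) auto
    also have "\<dots> \<le> ennreal (weyl_const p 0 \<alpha> powr p) * ?N"
      using weyl_schur[OF p, of 0 \<alpha> F] p \<alpha> by (simp add: K2_def)
    finally show ?thesis
      using p \<alpha> weyl_const_nonneg[of 0 p \<alpha>] by (simp add: powr_mult ennreal_mult' mult.assoc mult_left_mono)
  qed
  have S3: "(\<integral>\<^sup>+s. epow p (?X3 s) \<partial>lborel) \<le> ennreal ((2 powr \<alpha> / Gamma \<alpha> * weyl_const p 0 1) powr p) * ?N"
  proof -
    have "(\<integral>\<^sup>+s. epow p (?X3 s) \<partial>lborel)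
      = ennreal ((2 powr \<alpha> / Gamma \<alpha>) powr p) * (\<integral>\<^sup>+s. epow p (?Y3 s) \<partial>lborel)"
      using p G by (simp add: epow_mult nn_integral_cmult)
    also have "(\<integral>\<^sup>+s. epow p (?Y3 s) \<partial>lborel) \<le> ennreal (weyl_const p 0 1 powr p) * ?N"
      using weyl_schur[OF p, of 0 1 F] p by (simp add: K3_def)
    finally have le: "(\<integral>\<^sup>+s. epow p (?X3 s) \<partial>lborel)
      \<le> ennreal ((2 powr \<alpha> / Gamma \<alpha>) powr p) * (ennreal (weyl_const p 0 1 powr p) * ?N)" by (simp add: mult_left_mono)
    have "(2 powr \<alpha> / Gamma \<alpha> * weyl_const p 0 1) powr p = (2 powr \<alpha> / Gamma \<alpha>) powr p * weyl_const p 0 1 powr p"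
      by (rule powr_mult)
    with le show ?thesis by (simp only: ennreal_mult' powr_ge_zero mult.assoc)
  qed
  have "(\<integral>\<^sup>+t. ennreal (mpos \<alpha> r t s) * F t \<partial>lborel) \<le> ?X1 s + (?X2 s + ?X3 s)" for s
  proof -
    have "(\<integral>\<^sup>+t. ennreal (mpos \<alpha> r t s) * F t \<partial>lborel) \<le>
      (\<integral>\<^sup>+t. ?T s t \<partial>lborel)"
    proof (intro nn_integral_mono)
      fix t
      have "ennreal (mpos \<alpha> r t s) \<le> ennreal (A s t + (2 powr \<alpha> * K2 (s - r) t + 2 powr \<alpha> / Gamma \<alpha> * K3 s t))"
        unfolding A_def K2_def K3_def by (intro ennreal_leI mpos_bound \<alpha> r)
      also have "\<dots> = ?S s t"
      proof -
        have "ennreal (a + (b * c + d * e)) = ennreal a + (ennreal b * ennreal c + ennreal d * ennreal e)"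
          if "0 \<le> a" "0 \<le> b" "0 \<le> c" "0 \<le> d" "0 \<le> e" for a b c d e
          using that by (simp add: ennreal_mult')
        then show ?thesis using nn G by (metis divide_nonneg_pos powr_ge_zero)
      qed
      finally have "ennreal (mpos \<alpha> r t s) * F t \<le> ?S s t * F t"
        by (rule mult_right_mono) simp
      then show "ennreal (mpos \<alpha> r t s) * F t \<le> ?T s t"
        by (simp add: distrib_right mult.assoc)
    qed
    also have "\<dots> = ?X1 s + (?X2 s + ?X3 s)"
      by (simp add: nn_integral_add nn_integral_cmult)
    finally show ?thesis .
  qed
  then have "(\<integral>\<^sup>+s. epow p (\<integral>\<^sup>+t. ennreal (mpos \<alpha> r t s) * F t \<partial>lborel) \<partial>lborel) \<le> (\<integral>\<^sup>+s. epow p (?X1 s + (?X2 s + ?X3 s)) \<partial>lborel)"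
    using p by (intro nn_integral_mono epow_mono) auto
  also have "\<dots> \<le> (\<integral>\<^sup>+s. ennreal (2 powr p) * (epow p (?X1 s) + ennreal (2 powr p) * (epow p (?X2 s) + epow p (?X3 s))) \<partial>lborel)"
  proof (intro nn_integral_mono)
    fix s
    have "epow p (?X1 s + (?X2 s + ?X3 s)) \<le> ennreal (2 powr p) * (epow p (?X1 s) + epow p (?X2 s + ?X3 s))"
      using p by (intro epow_add) auto
    also have "\<dots> \<le> ennreal (2 powr p) * (epow p (?X1 s) + ennreal (2 powr p) * (epow p (?X2 s) + epow p (?X3 s)))"
      using p by (intro mult_left_mono add_left_mono epow_add) auto
    finally show "epow p (?X1 s + (?X2 s + ?X3 s)) \<le> \<dots>" .
  qed
  also have "\<dots> = ennreal (2 powr p) * ((\<integral>\<^sup>+s. epow p (?X1 s) \<partial>lborel) + ennreal (2 powr p) * ((\<integral>\<^sup>+s. epow p (?X2 s) \<partial>lborel) + (\<integral>\<^sup>+s. epow p (?X3 s) \<partial>lborel)))"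
    by (simp add: nn_integral_add nn_integral_cmult)
  also have "\<dots> \<le> ennreal (2 powr p) * (ennreal (a powr p) * ?N + ennreal (2 powr p) * (ennreal ((2 powr \<alpha> * weyl_const p 0 \<alpha>) powr p) * ?N + ennreal ((2 powr \<alpha> / Gamma \<alpha> * weyl_const p 0 1) powr p) * ?N))"
    by (intro mult_left_mono add_mono S1 S2 S3) auto
  also have "\<dots> = ennreal (mconst p \<alpha>) * ?N"
    by (simp add: mconst_def a_def ennreal_mult' distrib_left distrib_right mult.assoc)
  finally show ?thesis .
qed

section \<open>Convolution\<close>

lemma nn_integral_jensen_nonneg:
  assumes p: "1 \<le> p" and A: "0 \<le> A" "(\<integral>\<^sup>+x. m x \<partial>M) \<le> ennreal A"
    and [measurable]: "m \<in> borel_measurable M" "F \<in> borel_measurable M"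
  shows "epow p (\<integral>\<^sup>+x. m x * F x \<partial>M) \<le> ennreal (A powr (p - 1)) * (\<integral>\<^sup>+x. m x * epow p (F x) \<partial>M)"
proof (cases "A = 0")
  case True
  then have "(\<integral>\<^sup>+x. m x \<partial>M) = 0" using A by simp
  then have "AE x in M. m x = 0" by (simp add: nn_integral_0_iff_AE)
  then have "(\<integral>\<^sup>+x. m x * F x \<partial>M) = (\<integral>\<^sup>+x. 0 \<partial>M)" by (intro nn_integral_cong_AE) (auto elim: eventually_mono)
  then show ?thesis by simp
next
  case False
  then show ?thesis using nn_integral_jensen[OF p _ A(2)] A by simp
qed

lemma AE_lborel_affine:
  assumes "AE x in lborel. P (x::real)" and c: "c \<noteq> 0" shows "AE x in lborel. P (t + c * x)"
proof -
  obtain N where N: "{x. \<not> P x} \<subseteq> N" "N \<in> null_sets lborel"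
    using assms(1) by (auto elim!: AE_E simp: null_sets_def)
  have [measurable]: "N \<in> sets borel" using N by auto
  have "0 = (\<integral>\<^sup>+x. indicator N x \<partial>lborel)" using null_setsD1[OF N(2)] by simp
  also have "\<dots> = ennreal \<bar>c\<bar> * (\<integral>\<^sup>+x. indicator N (t + c * x) \<partial>lborel)"
    using c by (intro nn_integral_real_affine) auto
  finally have "(\<integral>\<^sup>+x. indicator N (t + c * x) \<partial>lborel) = (0::ennreal)" using c by simp
  then have "AE x in lborel. indicator N (t + c * x) = (0::ennreal)"
    by (subst (asm) nn_integral_0_iff_AE) auto
  then show ?thesis by eventually_elim (use N in \<open>auto simp: indicator_def split: if_splits\<close>)
qed

section \<open>Integrals over the plane\<close>

lemma norm_integral_le_nn: "ennreal (norm (integral\<^sup>L M f)) \<le> (\<integral>\<^sup>+x. ennreal (norm (f x :: complex)) \<partial>M)"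
  by (cases "integrable M f") (auto intro: integral_norm_bound_ennreal simp: not_integrable_integral_eq)

lemma integral_scaleR_const: "(LINT x|M. f x *\<^sub>R (c :: complex)) = (LINT x|M. f x) *\<^sub>R c"
  by (simp add: scaleR_conv_of_real)

lemma Fubini_plane:
  fixes F :: "real \<Rightarrow> real \<times> real \<Rightarrow> complex"
  assumes m: "(\<lambda>(y, q). F y q) \<in> borel_measurable (lborel \<Otimes>\<^sub>M (lborel \<Otimes>\<^sub>M lborel))"
    and fin: "(\<integral>\<^sup>+y. (\<integral>\<^sup>+q. ennreal (norm (F y q)) \<partial>(lborel \<Otimes>\<^sub>M lborel)) \<partial>lborel) < top"
  shows "(LINT y|lborel. (LINT q|(lborel \<Otimes>\<^sub>M lborel). F y q)) = (LINT q|(lborel \<Otimes>\<^sub>M lborel). (LINT y|lborel. F y q))"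
  using lborel_Fubini[of F] m fin by (simp add: lborel_prod)

lemma nn_integral_plane_swap:
  fixes F :: "real \<Rightarrow> real \<times> real \<Rightarrow> ennreal"
  assumes m: "(\<lambda>(y, q). F y q) \<in> borel_measurable (lborel \<Otimes>\<^sub>M (lborel \<Otimes>\<^sub>M lborel))"
  shows "(\<integral>\<^sup>+y. (\<integral>\<^sup>+q. F y q \<partial>(lborel \<Otimes>\<^sub>M lborel)) \<partial>lborel) = (\<integral>\<^sup>+q. (\<integral>\<^sup>+y. F y q \<partial>lborel) \<partial>(lborel \<Otimes>\<^sub>M lborel))"
  using lborel_pair.Fubini'[of F] m by (simp add: lborel_prod)

lemma nn_integral_plane:
  assumes "(\<lambda>q. F (fst q) (snd q)) \<in> borel_measurable (lborel \<Otimes>\<^sub>M lborel)"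
  shows "(\<integral>\<^sup>+q. F (fst q) (snd q) \<partial>(lborel \<Otimes>\<^sub>M lborel)) = (\<integral>\<^sup>+r. (\<integral>\<^sup>+t. F r t \<partial>lborel) \<partial>(lborel::real measure))"
  using lborel.nn_integral_fst[OF assms] by simp

lemma integral_plane_product:
  fixes a b :: "real \<Rightarrow> complex"
  assumes a: "integrable lborel a" and b: "integrable lborel b"
  shows "(LINT q|(lborel \<Otimes>\<^sub>M lborel). a (fst q) * b (snd q)) = (LINT r|lborel. a r) * (LINT t|lborel. b t)"
proof -
  have [measurable]: "a \<in> borel_measurable borel" "b \<in> borel_measurable borel" using a b by auto
  have "(\<integral>\<^sup>+q. ennreal (norm (a (fst q) * b (snd q))) \<partial>(lborel \<Otimes>\<^sub>M lborel)) = (\<integral>\<^sup>+r. \<integral>\<^sup>+t. ennreal (norm (a r)) * ennreal (norm (b t)) \<partial>lborel \<partial>lborel)"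
    by (subst nn_integral_plane[where F="\<lambda>r t. ennreal (norm (a r * b t))"]) (auto simp: norm_mult ennreal_mult')
  also have "\<dots> = (\<integral>\<^sup>+r. ennreal (norm (a r)) \<partial>lborel) * (\<integral>\<^sup>+t. ennreal (norm (b t)) \<partial>lborel)"
    by (simp add: nn_integral_cmult nn_integral_multc)
  also have "\<dots> < top" using a b by (simp add: integrable_iff_bounded ennreal_mult_less_top)
  finally have "integrable (lborel \<Otimes>\<^sub>M lborel) (\<lambda>q. a (fst q) * b (snd q))"
    unfolding integrable_iff_bounded by simp
  from lborel_pair.integral_fst'[OF this] show ?thesis by simp
qed

lemma kplus_le_wker: "0 < \<alpha> \<Longrightarrow> 0 < r \<Longrightarrow> 0 < t \<Longrightarrow> kplus \<alpha> r t s \<le> wker \<alpha> s (r + t)"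
  by (auto simp: kplus_def wker_def Gamma_real_nonneg)

lemma kminus_le_wker: "0 < \<alpha> \<Longrightarrow> 0 < r \<Longrightarrow> 0 < t \<Longrightarrow> kminus \<alpha> r t s \<le> wker \<alpha> s (r + t)"
  by (auto simp: kminus_def wker_def Gamma_real_nonneg)

text \<open>Subtraction requires finite integrals: both parts of the density are dominated by
  \<open>wker \<alpha> s (r + t)\<close>, whose integral against \<open>wker \<alpha> x s\<close> is
  given by \<open>wker_convolution\<close>.\<close>

lemma wker_convolution_identity_integral:
  assumes \<alpha>: "0 < \<alpha>" and x: "0 < x" and tr: "0 < t" "0 < r"
  shows "(LINT y|lborel. indicator {0<..<x} y * wker \<alpha> (x - y) r * wker \<alpha> y t)
    = (LINT s|lborel. wker \<alpha> x s * (kplus \<alpha> r t s - kminus \<alpha> r t s))"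
proof -
  have fin: "(\<integral>\<^sup>+s. ennreal (k s * wker \<alpha> x s) \<partial>lborel) < top"
    if "\<And>s. 0 \<le> k s" "\<And>s. k s \<le> wker \<alpha> s (r + t)" for k :: "real \<Rightarrow> real"
  proof -
    have "(\<integral>\<^sup>+s. ennreal (k s * wker \<alpha> x s) \<partial>lborel) \<le> (\<integral>\<^sup>+s. ennreal (wker \<alpha> x s) * ennreal (wker \<alpha> s (r + t)) \<partial>lborel)"
    proof (intro nn_integral_mono)
      fix s
      have "k s * wker \<alpha> x s \<le> wker \<alpha> x s * wker \<alpha> s (r + t)"
        using that \<alpha> by (subst mult.commute) (intro mult_left_mono, auto)
      then show "ennreal (k s * wker \<alpha> x s) \<le> ennreal (wker \<alpha> x s) * ennreal (wker \<alpha> s (r + t))"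
        using \<alpha> by (simp add: ennreal_mult'[symmetric] ennreal_leI)
    qed
    then show ?thesis using \<alpha> by (simp add: wker_convolution le_less_trans)
  qed
  let ?p = "\<lambda>s. kplus \<alpha> r t s * wker \<alpha> x s" and ?m = "\<lambda>s. kminus \<alpha> r t s * wker \<alpha> x s"
  let ?l = "\<lambda>y. indicator {0<..<x} y * wker \<alpha> (x - y) r * wker \<alpha> y t"
  have fp: "(\<integral>\<^sup>+s. ennreal (?p s) \<partial>lborel) < top" and fm: "(\<integral>\<^sup>+s. ennreal (?m s) \<partial>lborel) < top"
    using fin[of "kplus \<alpha> r t"] fin[of "kminus \<alpha> r t"] kplus_le_wker[OF \<alpha> tr(2,1)] kminus_le_wker[OF \<alpha> tr(2,1)] \<alpha> by auto
  note id = wker_convolution_identity[OF \<alpha> x tr]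
  have fl: "(\<integral>\<^sup>+y. ennreal (?l y) \<partial>lborel) < top"
    using fp unfolding id[symmetric] by simp
  have ip: "integrable lborel ?p" and im: "integrable lborel ?m"
    unfolding integrable_iff_bounded using fp fm \<alpha> by auto
  have e: "(LINT s|lborel. ?p s) = enn2real (\<integral>\<^sup>+s. ennreal (?p s) \<partial>lborel)" "(LINT s|lborel. ?m s) = enn2real (\<integral>\<^sup>+s. ennreal (?m s) \<partial>lborel)"
    "(LINT y|lborel. ?l y) = enn2real (\<integral>\<^sup>+y. ennreal (?l y) \<partial>lborel)"
    using \<alpha> by (auto intro!: integral_eq_nn_integral)
  have "(LINT y|lborel. ?l y) + (LINT s|lborel. ?m s) = (LINT s|lborel. ?p s)"
    unfolding e id[symmetric] using fl fm by (simp add: enn2real_plus)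
  also have "(LINT s|lborel. wker \<alpha> x s * (kplus \<alpha> r t s - kminus \<alpha> r t s)) = (LINT s|lborel. ?p s - ?m s)"
    by (intro Bochner_Integration.integral_cong refl) (simp add: algebra_simps)
  then have "(LINT s|lborel. ?p s) - (LINT s|lborel. ?m s) = (LINT s|lborel. wker \<alpha> x s * (kplus \<alpha> r t s - kminus \<alpha> r t s))"
    using ip im by simp
  ultimately show ?thesis by linarith
qed

context
  fixes p \<alpha> :: real and v u :: "real \<Rightarrow> complex"
  assumes p: "1 \<le> p" and \<alpha>: "0 < \<alpha>" and v: "v \<in> wLp 1 \<alpha>" and u: "u \<in> wLp p \<alpha>"
begin

text \<open>The absolute values are moved inside the formula for the derivative of the convolution.
  Finiteness of the Weyl integral of this majorant justifies every exchange of integrals in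
  \<open>conv_wint_eq\<close>.\<close>

definition conv_major :: "real \<Rightarrow> ennreal" where
  "conv_major s = (\<integral>\<^sup>+r. \<integral>\<^sup>+t. ennreal (norm (v r)) * ennreal (norm (u t)) * ennreal (kplus \<alpha> r t s + kminus \<alpha> r t s) \<partial>lborel \<partial>lborel)"

text \<open>
  The formula for \<open>W\<^sup>\<alpha>(g * f)\<close>, where \<open>v = W\<^sup>\<alpha> g\<close> and \<open>u = W\<^sup>\<alpha> f\<close>.
\<close>

definition conv_deriv :: "real \<Rightarrow> complex" where
  "conv_deriv s = (if 0 < s then LINT q|(lborel \<Otimes>\<^sub>M lborel). (kplus \<alpha> (fst q) (snd q) s - kminus \<alpha> (fst q) (snd q) s) *\<^sub>R (v (fst q) * u (snd q)) else 0)"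

lemma v_measurable [measurable]: "v \<in> borel_measurable borel" and u_measurable [measurable]: "u \<in> borel_measurable borel"
  using u v by (auto simp: wLp_def)

lemma v_eq_0: "t \<le> 0 \<Longrightarrow> v t = 0" and u_eq_0: "t \<le> 0 \<Longrightarrow> u t = 0"
  using u v by (auto simp: wLp_def)

lemma measurable_conv_major [measurable]: "conv_major \<in> borel_measurable borel"
  unfolding conv_major_def[abs_def] by measurable

lemma measurable_conv_deriv [measurable]: "conv_deriv \<in> borel_measurable borel"
  unfolding conv_deriv_def[abs_def] by measurable

text \<open>Jensen's inequality is applied in \<open>r\<close> with density
  \<open>r powr \<alpha> * norm (v r)\<close>, whose mass is \<open>Npow 1 \<alpha> v\<close>. After
  an exchange of integrals, \<open>mpos_schur\<close> applies for each fixed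
  \<open>r\<close>.\<close>

lemma conv_major_bound:
  "(\<integral>\<^sup>+s. epow p (ennreal (indicator {0<..} s * s powr \<alpha>) * conv_major s) \<partial>lborel)
    \<le> ennreal (enn2real (Npow 1 \<alpha> v) powr p * mconst p \<alpha>) * Npow p \<alpha> u"
proof -
  let ?w = "\<lambda>s. indicator {0<..} s * s powr \<alpha> :: real" and ?k = "\<lambda>r t s. kplus \<alpha> r t s + kminus \<alpha> r t s"
  define G where "G = (\<lambda>r. ennreal (r powr \<alpha> * norm (v r)))"
  define F where "F = (\<lambda>t. ennreal (t powr \<alpha> * norm (u t)))"
  have [measurable]: "G \<in> borel_measurable borel" "F \<in> borel_measurable borel" unfolding G_def F_def by measurable
  let ?X = "\<lambda>r s. \<integral>\<^sup>+t. ennreal (mpos \<alpha> r t s) * F t \<partial>lborel"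
  define n where "n = enn2real (Npow 1 \<alpha> v)"
  have G: "(\<integral>\<^sup>+r. G r \<partial>lborel) = ennreal n"
  proof -
    have "(\<integral>\<^sup>+r. G r \<partial>lborel) = Npow 1 \<alpha> v" unfolding Npow_def G_def by (intro nn_integral_cong) simp
    then show ?thesis using v by (simp add: n_def wLp_def)
  qed
  have n: "0 \<le> n" by (simp add: n_def)
  have eq: "ennreal (?w s) * conv_major s = (\<integral>\<^sup>+r. G r * (?X r s) \<partial>lborel)" for s
  proof -
    have "ennreal (?w s) * conv_major s =
      (\<integral>\<^sup>+r. \<integral>\<^sup>+t. ennreal (?w s) * (ennreal (norm (v r)) * ennreal (norm (u t)) * ennreal (?k r t s)) \<partial>lborel \<partial>lborel)"
      unfolding conv_major_def by (simp add: nn_integral_cmult)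
    also have "\<dots> = (\<integral>\<^sup>+r. \<integral>\<^sup>+t. G r * (ennreal (mpos \<alpha> r t s) * F t) \<partial>lborel \<partial>lborel)"
    proof (intro nn_integral_cong)
      fix r t
      show "ennreal (?w s) * (ennreal (norm (v r)) * ennreal (norm (u t)) * ennreal (?k r t s)) = G r * (ennreal (mpos \<alpha> r t s) * F t)"
      proof (cases "0 < r \<and> 0 < t")
        case True
        then have "r powr \<alpha> * r powr (- \<alpha>) = 1" "t powr \<alpha> * t powr (- \<alpha>) = 1" by (auto simp: powr_add[symmetric])
        moreover have "z * (V * U * k) = (ra * V) * ((z * ra' * ta' * k) * (ta * U))" if "ra * ra' = 1" "ta * ta' = 1" for z V U k ra ra' ta ta' :: real
        proof -
          have "(ra * V) * ((z * ra' * ta' * k) * (ta * U)) = (ra * ra') * (ta * ta') * (z * (V * U * k))" by (simp only: mult_ac)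
          also have "\<dots> = z * (V * U * k)" unfolding that by simp
          finally show ?thesis by (rule sym)
        qed
        ultimately have "?w s * (norm (v r) * norm (u t) * (?k r t s)) =
          (r powr \<alpha> * norm (v r)) * ((indicator {0<..} s * s powr \<alpha> * r powr (- \<alpha>) * t powr (- \<alpha>) * (?k r t s)) * (t powr \<alpha> * norm (u t)))"
          by blast
        also have "indicator {0<..} s * s powr \<alpha> * r powr (- \<alpha>) * t powr (- \<alpha>) * (?k r t s) = mpos \<alpha> r t s"
          using True by (simp add: mpos_def)
        finally have r: "?w s * (norm (v r) * norm (u t) * (?k r t s)) =
          (r powr \<alpha> * norm (v r)) * (mpos \<alpha> r t s * (t powr \<alpha> * norm (u t)))" .
        have "0 \<le> mpos \<alpha> r t s" "0 \<le> ?k r t s" using \<alpha> by (auto simp: mpos_def)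
        then show ?thesis unfolding G_def F_def using r by (simp only: ennreal_mult'[symmetric] mult_nonneg_nonneg norm_ge_zero powr_ge_zero indicator_pos_le)
      next
        case False
        then have "norm (v r) = 0 \<or> norm (u t) = 0" using v_eq_0 u_eq_0 by auto
        then show ?thesis by (auto simp: G_def F_def)
      qed
    qed
    finally show ?thesis by (simp add: nn_integral_cmult)
  qed
  have "(\<integral>\<^sup>+s. epow p (ennreal (?w s) * conv_major s) \<partial>lborel) \<le>
    (\<integral>\<^sup>+s. ennreal (n powr (p - 1)) * (\<integral>\<^sup>+r. G r * epow p (?X r s) \<partial>lborel) \<partial>lborel)"
    unfolding eq using G n by (intro nn_integral_mono nn_integral_jensen_nonneg p) auto
  also have "\<dots> = ennreal (n powr (p - 1)) * (\<integral>\<^sup>+s. (\<integral>\<^sup>+r. G r * epow p (?X r s) \<partial>lborel) \<partial>lborel)"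
    by (intro nn_integral_cmult) measurable
  also have "(\<integral>\<^sup>+s. (\<integral>\<^sup>+r. G r * epow p (?X r s) \<partial>lborel) \<partial>lborel)
    = (\<integral>\<^sup>+r. (\<integral>\<^sup>+s. G r * epow p (?X r s) \<partial>lborel) \<partial>lborel)"
    by (rule lborel_pair.Fubini') measurable
  also have "\<dots> = (\<integral>\<^sup>+r. G r * (\<integral>\<^sup>+s. epow p (?X r s) \<partial>lborel) \<partial>lborel)"
    by (intro nn_integral_cong nn_integral_cmult) measurable
  also have "\<dots> \<le> (\<integral>\<^sup>+r. G r * (ennreal (mconst p \<alpha>) * Npow p \<alpha> u) \<partial>lborel)"
  proof (intro nn_integral_mono)
    fix r
    show "G r * (\<integral>\<^sup>+s. epow p (?X r s) \<partial>lborel) \<le> G r * (ennreal (mconst p \<alpha>) * Npow p \<alpha> u)"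
    proof (cases "0 < r")
      case True
      then show ?thesis using mpos_schur[OF p \<alpha> True, of F] by (intro mult_left_mono) (auto simp: Npow_def F_def)
    qed (simp add: G_def v_eq_0)
  qed
  also have "\<dots> = ennreal n * (ennreal (mconst p \<alpha>) * Npow p \<alpha> u)"
    using G by (subst nn_integral_multc) simp_all
  also have "ennreal (n powr (p - 1)) * \<dots> = ennreal ((n powr (p - 1) * n) * mconst p \<alpha>) * Npow p \<alpha> u"
    using n by (simp add: ennreal_mult' mult.assoc)
  also have "n powr (p - 1) * n = n powr p"
    using n by (cases "n = 0") (auto simp: powr_diff)
  finally show ?thesis by (simp add: n_def mult_left_mono)
qed

lemma conv_deriv_le_major: "0 < s \<Longrightarrow> ennreal (norm (conv_deriv s)) \<le> conv_major s"
proof -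
  assume s: "0 < s"
  let ?f = "\<lambda>r t. (kplus \<alpha> r t s - kminus \<alpha> r t s) *\<^sub>R (v r * u t)"
  have "ennreal (norm (conv_deriv s)) \<le> (\<integral>\<^sup>+q. ennreal (norm (?f (fst q) (snd q))) \<partial>(lborel \<Otimes>\<^sub>M lborel))"
    unfolding conv_deriv_def using s by (simp only: if_True norm_integral_le_nn)
  also have "\<dots> = (\<integral>\<^sup>+r. \<integral>\<^sup>+t. ennreal (norm (?f r t)) \<partial>lborel \<partial>lborel)"
    by (rule nn_integral_plane) measurable
  also have "\<dots> \<le> conv_major s"
    unfolding conv_major_def
  proof (intro nn_integral_mono)
    fix r t
    have "\<bar>kplus \<alpha> r t s - kminus \<alpha> r t s\<bar> \<le> kplus \<alpha> r t s + kminus \<alpha> r t s"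
      using kplus_nonneg[OF \<alpha>, of r t s] kminus_nonneg[OF \<alpha>, of r t s] by linarith
    then have "norm (?f r t) \<le> norm (v r) * norm (u t) * (kplus \<alpha> r t s + kminus \<alpha> r t s)"
      by (simp add: norm_mult mult.commute mult_left_mono)
    then have "ennreal (norm (?f r t)) \<le> ennreal (norm (v r) * norm (u t) * (kplus \<alpha> r t s + kminus \<alpha> r t s))" by (rule ennreal_leI)
    then show "ennreal (norm (?f r t)) \<le> ennreal (norm (v r)) * ennreal (norm (u t)) * ennreal (kplus \<alpha> r t s + kminus \<alpha> r t s)"
      by (simp add: ennreal_mult')
  qed
  finally show ?thesis .
qed

lemma Npow_conv_deriv:
  "Npow p \<alpha> conv_deriv \<le> ennreal (enn2real (Npow 1 \<alpha> v) powr p * mconst p \<alpha>) * Npow p \<alpha> u"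
proof -
  have "Npow p \<alpha> conv_deriv \<le> (\<integral>\<^sup>+s. epow p (ennreal (indicator {0<..} s * s powr \<alpha>) * conv_major s) \<partial>lborel)"
    unfolding Npow_def
  proof (intro nn_integral_mono epow_mono)
    fix s
    show "ennreal (s powr \<alpha> * norm (conv_deriv s)) \<le> ennreal (indicator {0<..} s * s powr \<alpha>) * conv_major s"
    proof (cases "0 < s")
      case True
      then show ?thesis using conv_deriv_le_major[OF True] by (simp add: ennreal_mult' mult_left_mono)
    qed (simp add: conv_deriv_def)
  qed (use p in simp)
  also note conv_major_bound
  finally show ?thesis .
qed

lemma conv_deriv_wLp: "conv_deriv \<in> wLp p \<alpha>"
  using Npow_conv_deriv u unfolding wLp_def
  by (auto simp: ennreal_mult_less_top conv_deriv_def intro: le_less_trans)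

lemma conv_major_finite: "AE x in lborel. 0 < x \<longrightarrow> wnn \<alpha> conv_major x < top"
proof -
  \<comment> \<open>A finite complex version of the majorant, to which \<open>wnn_finite_AE\<close>
    can be applied; it differs from \<open>conv_major\<close> on the half-line only in a null
    set.\<close>
  define h where "h = (\<lambda>s. complex_of_real (if 0 < s then enn2real (conv_major s) else 0))"
  have [measurable]: "h \<in> borel_measurable borel" unfolding h_def by measurable
  have "(\<integral>\<^sup>+s. epow p (ennreal (indicator {0<..} s * s powr \<alpha>) * conv_major s) \<partial>lborel) < top"
    using conv_major_bound u by (auto simp: wLp_def ennreal_mult_less_top intro: le_less_trans)
  moreover have "Npow p \<alpha> h \<le> (\<integral>\<^sup>+s. epow p (ennreal (indicator {0<..} s * s powr \<alpha>) * conv_major s) \<partial>lborel)"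
    unfolding Npow_def
  proof (intro nn_integral_mono epow_mono)
    fix s
    show "ennreal (s powr \<alpha> * norm (h s)) \<le> ennreal (indicator {0<..} s * s powr \<alpha>) * conv_major s"
      by (auto simp: h_def ennreal_mult' ennreal_enn2real_if intro: mult_left_mono)
  qed (use p in simp)
  ultimately have fin: "(\<integral>\<^sup>+s. epow p (ennreal (indicator {0<..} s * s powr \<alpha>) * conv_major s) \<partial>lborel) \<noteq> \<infinity>" and hw: "h \<in> wLp p \<alpha>"
    by (auto simp: wLp_def h_def intro: le_less_trans)
  from nn_integral_PInf_AE[OF _ fin]
  have "AE s in lborel. epow p (ennreal (indicator {0<..} s * s powr \<alpha>) * conv_major s) \<noteq> \<infinity>" by simp
  then have ae: "AE s in lborel. 0 < s \<longrightarrow> conv_major s = ennreal (norm (h s))"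
    by eventually_elim (auto simp: ennreal_mult_eq_top_iff h_def less_top)
  have "AE x in lborel. 0 < x \<longrightarrow> wnn \<alpha> (\<lambda>s. ennreal (norm (h s))) x < top"
    using wnn_finite_AE[OF p, of 0 \<alpha> h] p \<alpha> hw by simp
  then show ?thesis
  proof eventually_elim
    case (elim x)
    have "wnn \<alpha> conv_major x = wnn \<alpha> (\<lambda>s. ennreal (norm (h s))) x" if "0 < x"
      unfolding wnn_def by (rule nn_integral_cong_AE[OF eventually_mono[OF ae]]) (use that in \<open>auto simp: wker_def\<close>)
    then show ?case using elim by auto
  qed
qed

text \<open>Both factors are written as Weyl integrals over \<open>r\<close> and \<open>t\<close>.
  The integral in \<open>y\<close> is moved inside, evaluated by the kernel identity as an integral
  in \<open>s\<close>, and the latter is moved outside again. What then stands inside is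
  \<open>conv_deriv s\<close>.\<close>

lemma conv_wint_eq:
  assumes x: "0 < x" and fin: "wnn \<alpha> conv_major x < top"
    and gf: "AE y in lborel. 0 < y \<longrightarrow> y < x \<longrightarrow> g (x - y) = wint \<alpha> v (x - y) \<and> f y = wint \<alpha> u y
       \<and> wnn \<alpha> (\<lambda>s. ennreal (norm (v s))) (x - y) < top \<and> wnn \<alpha> (\<lambda>s. ennreal (norm (u s))) y < top"
  shows "set_integrable lebesgue {0<..<x} (\<lambda>s. g (x - s) * f s) \<and> conv g f x = wint \<alpha> conv_deriv x"
proof -
  let ?P = "lborel \<Otimes>\<^sub>M lborel :: (real \<times> real) measure"
  let ?vu = "\<lambda>q. ennreal (norm (v (fst q)) * norm (u (snd q)))" and ?p = "\<lambda>s q. ennreal (kplus \<alpha> (fst q) (snd q) s * wker \<alpha> x s)"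
  let ?l = "\<lambda>y q. indicator {0<..<x} y * wker \<alpha> (x - y) (fst q) * wker \<alpha> y (snd q)"
  let ?M = "\<lambda>r t s. ennreal (norm (v r)) * ennreal (norm (u t)) * ennreal (kplus \<alpha> r t s + kminus \<alpha> r t s)"
  let ?H = "\<lambda>s q. (wker \<alpha> x s * (kplus \<alpha> (fst q) (snd q) s - kminus \<alpha> (fst q) (snd q) s)) *\<^sub>R (v (fst q) * u (snd q))"
  let ?h = "\<lambda>r t s. (wker \<alpha> x s * (kplus \<alpha> r t s - kminus \<alpha> r t s)) *\<^sub>R (v r * u t)"
  let ?n = "\<lambda>r t. norm (v r) * norm (u t)" and ?a = "\<lambda>r t s. \<bar>kplus \<alpha> r t s - kminus \<alpha> r t s\<bar>" and ?s = "\<lambda>r t s. kplus \<alpha> r t s + kminus \<alpha> r t s"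
  let ?K = "\<lambda>y q. ?l y q *\<^sub>R (v (fst q) * u (snd q))"
  have Kn: "ennreal (norm (?K y q)) = ?vu q * ennreal (?l y q)" for y q
    using \<alpha> by (simp add: ennreal_mult'[symmetric] norm_mult abs_mult mult_ac)
  have main_fin: "(\<integral>\<^sup>+y. (\<integral>\<^sup>+q. ennreal (norm (?K y q)) \<partial>?P) \<partial>lborel) < top"
  proof -
    have "(\<integral>\<^sup>+y. (\<integral>\<^sup>+q. ennreal (norm (?K y q)) \<partial>?P) \<partial>lborel) = (\<integral>\<^sup>+q. (\<integral>\<^sup>+y. ennreal (norm (?K y q)) \<partial>lborel) \<partial>?P)"
      by (rule nn_integral_plane_swap) measurable
    also have "\<dots> \<le> (\<integral>\<^sup>+q. (\<integral>\<^sup>+s. ?vu q * ?p s q \<partial>lborel) \<partial>?P)"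
    proof (rule nn_integral_mono)
      fix q :: "real \<times> real"
      have "(\<integral>\<^sup>+y. ennreal (norm (?K y q)) \<partial>lborel) = ?vu q * (\<integral>\<^sup>+y. ennreal (?l y q) \<partial>lborel)"
        unfolding Kn by (rule nn_integral_cmult) measurable
      also have "\<dots> \<le> ?vu q * (\<integral>\<^sup>+s. ?p s q \<partial>lborel)"
      \<comment> \<open>For positive \<open>r\<close> and \<open>t\<close> the kernel identity, with
        its nonnegative \<open>kminus\<close> term dropped, bounds the integral in \<open>y\<close>;
        otherwise the product of \<open>v\<close> and \<open>u\<close> is 0.\<close>
      proof (cases "0 < fst q \<and> 0 < snd q")
        case True
        then have "(\<integral>\<^sup>+y. ennreal (?l y q) \<partial>lborel) \<le> (\<integral>\<^sup>+s. ?p s q \<partial>lborel)"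
          unfolding le_iff_add by (intro exI) (rule wker_convolution_identity[OF \<alpha> x, symmetric], simp_all)
        then show ?thesis by (rule mult_left_mono) simp
      next
        case False
        then have "norm (v (fst q)) * norm (u (snd q)) = 0" using v_eq_0 u_eq_0 by auto
        then show ?thesis by (simp only: ennreal_0 mult_zero_left order_refl)
      qed
      also have "\<dots> = (\<integral>\<^sup>+s. ?vu q * ?p s q \<partial>lborel)"
        by (rule nn_integral_cmult[symmetric]) measurable
      finally show "(\<integral>\<^sup>+y. ennreal (norm (?K y q)) \<partial>lborel) \<le> \<dots>" .
    qed
    also have "\<dots> = (\<integral>\<^sup>+s. (\<integral>\<^sup>+q. ?vu q * ?p s q \<partial>?P) \<partial>lborel)"
      by (rule nn_integral_plane_swap[symmetric]) measurable
    also have "\<dots> \<le> (\<integral>\<^sup>+s. ennreal (wker \<alpha> x s) * conv_major s \<partial>lborel)"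
    proof (intro nn_integral_mono)
      fix s
      have "(\<integral>\<^sup>+q. ?vu q * ?p s q \<partial>?P)
        = (\<integral>\<^sup>+r. \<integral>\<^sup>+t. ennreal (?n r t) * ennreal (kplus \<alpha> r t s * wker \<alpha> x s) \<partial>lborel \<partial>lborel)"
        by (rule nn_integral_plane) measurable
      also have "\<dots> \<le> (\<integral>\<^sup>+r. \<integral>\<^sup>+t. ennreal (wker \<alpha> x s) * (?M r t s) \<partial>lborel \<partial>lborel)"
      proof (intro nn_integral_mono)
        fix r t
        have "?n r t * (kplus \<alpha> r t s * wker \<alpha> x s) \<le> wker \<alpha> x s * (?n r t * ?s r t s)"
          using \<alpha> by (simp add: algebra_simps)
        then have "ennreal (?n r t * (kplus \<alpha> r t s * wker \<alpha> x s)) \<le> ennreal (wker \<alpha> x s * (?n r t * ?s r t s))" by (rule ennreal_leI)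
        then show "ennreal (?n r t) * ennreal (kplus \<alpha> r t s * wker \<alpha> x s) \<le> ennreal (wker \<alpha> x s) * (?M r t s)"
          using \<alpha> by (simp only: ennreal_mult'[symmetric] mult_nonneg_nonneg norm_ge_zero wker_nonneg)
      qed
      also have "\<dots> = ennreal (wker \<alpha> x s) * conv_major s"
        unfolding conv_major_def by (simp add: nn_integral_cmult)
      finally show "(\<integral>\<^sup>+q. ?vu q * ?p s q \<partial>?P) \<le> \<dots>" .
    qed
    also have "\<dots> < top" using fin by (simp add: wnn_def)
    finally show ?thesis .
  qed
  let ?k = "\<lambda>y. (LINT q|?P. ?K y q)"
  have km: "?k \<in> borel_measurable borel" by measurable
  have prod: "AE y in lborel. indicator {0<..<x} y *\<^sub>R (g (x - y) * f y) = ?k y"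
    using gf
  proof eventually_elim
    case (elim y)
    show ?case
    proof (cases "0 < y \<and> y < x")
      case True
      have "?k y = (LINT q|?P. (wker \<alpha> (x - y) (fst q) *\<^sub>R v (fst q)) * (wker \<alpha> y (snd q) *\<^sub>R u (snd q)))"
        using True by (intro Bochner_Integration.integral_cong refl) (simp add: mult.assoc)
      also have "\<dots> = wint \<alpha> v (x - y) * wint \<alpha> u y"
        unfolding wint_def using elim True \<alpha> by (intro integral_plane_product) (auto simp: integrable_wker_iff)
      finally show ?thesis using elim True by simp
    qed auto
  qed
  have kint: "integrable lborel ?k"
    unfolding integrable_iff_bounded
  proof (intro conjI)
    have "(\<integral>\<^sup>+y. ennreal (norm (?k y)) \<partial>lborel) \<le> (\<integral>\<^sup>+y. (\<integral>\<^sup>+q. ennreal (norm (?K y q)) \<partial>?P) \<partial>lborel)"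
      by (intro nn_integral_mono norm_integral_le_nn)
    with main_fin show "(\<integral>\<^sup>+y. ennreal (norm (?k y)) \<partial>lborel) < \<infinity>" by simp
  qed (use km in simp)
  have si: "set_integrable lebesgue {0<..<x} (\<lambda>s. g (x - s) * f s)"
    unfolding set_integrable_def using lebesgue_borel_version(2)[OF km prod] kint by simp
  have "conv g f x = (LINT y|lborel. ?k y)"
    unfolding conv_def set_lebesgue_integral_def by (rule lebesgue_borel_version(3)[OF km prod])
  also have "\<dots> = (LINT q|?P. (LINT y|lborel. ?K y q))"
    by (rule Fubini_plane[OF _ main_fin]) measurable
  also have "\<dots> = (LINT q|?P. (LINT s|lborel. ?H s q))"
  proof (rule Bochner_Integration.integral_cong[OF refl])
    fix q :: "real \<times> real"
    show "(LINT y|lborel. ?K y q) = (LINT s|lborel. ?H s q)"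
    proof (cases "v (fst q) * u (snd q) = 0")
      case False
      then have "0 < fst q" "0 < snd q" using v_eq_0[of "fst q"] u_eq_0[of "snd q"] by (auto simp: not_le[symmetric])
      then show ?thesis using False wker_convolution_identity_integral[OF \<alpha> x, of "snd q" "fst q"]
        by (simp only: integral_scaleR_const)
    next
      case True
      show ?thesis unfolding True by simp
    qed
  qed
  also have "\<dots> = (LINT s|lborel. (LINT q|?P. ?H s q))"
  proof (rule Fubini_plane[symmetric])
    have "(\<integral>\<^sup>+s. (\<integral>\<^sup>+q. ennreal (norm (?H s q)) \<partial>?P) \<partial>lborel)
      \<le> (\<integral>\<^sup>+s. ennreal (wker \<alpha> x s) * conv_major s \<partial>lborel)"
    proof (intro nn_integral_mono)
      fix s
      have "(\<integral>\<^sup>+q. ennreal (norm (?H s q)) \<partial>?P)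
        = (\<integral>\<^sup>+r. \<integral>\<^sup>+t. ennreal (norm (?h r t s)) \<partial>lborel \<partial>lborel)"
        by (rule nn_integral_plane[where F="\<lambda>r t. ennreal (norm (?h r t s))"]) measurable
      also have "\<dots> \<le> (\<integral>\<^sup>+r. \<integral>\<^sup>+t. ennreal (wker \<alpha> x s) * (?M r t s) \<partial>lborel \<partial>lborel)"
      proof (intro nn_integral_mono)
        fix r t
        have "?a r t s \<le> kplus \<alpha> r t s + kminus \<alpha> r t s"
          using kplus_nonneg[OF \<alpha>, of r t s] kminus_nonneg[OF \<alpha>, of r t s] by linarith
        then have "wker \<alpha> x s * (?n r t * ?a r t s) \<le> wker \<alpha> x s * (?n r t * ?s r t s)"
          using \<alpha> by (intro mult_left_mono) auto
        moreover have "norm (?h r t s) = wker \<alpha> x s * (?n r t * ?a r t s)"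
          using \<alpha> by (simp add: norm_mult abs_mult mult_ac)
        ultimately have "ennreal (norm (?h r t s)) \<le> ennreal (wker \<alpha> x s * (?n r t * ?s r t s))"
          by (intro ennreal_leI) simp
        then show "ennreal (norm (?h r t s)) \<le> ennreal (wker \<alpha> x s) * (?M r t s)"
          using \<alpha> by (simp only: ennreal_mult'[symmetric] mult_nonneg_nonneg norm_ge_zero wker_nonneg)
      qed
      also have "\<dots> = ennreal (wker \<alpha> x s) * conv_major s"
        unfolding conv_major_def by (simp add: nn_integral_cmult)
      finally show "(\<integral>\<^sup>+q. ennreal (norm (?H s q)) \<partial>?P) \<le> \<dots>" .
    qed
    also have "\<dots> < top" using fin by (simp add: wnn_def)
    finally show "(\<integral>\<^sup>+s. (\<integral>\<^sup>+q. ennreal (norm (?H s q)) \<partial>?P) \<partial>lborel) < top" .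
  qed measurable
  also have "\<dots> = wint \<alpha> conv_deriv x"
    unfolding wint_def
  proof (intro Bochner_Integration.integral_cong refl)
    fix s
    show "(LINT q|?P. ?H s q) = wker \<alpha> x s *\<^sub>R conv_deriv s"
    proof (cases "x < s")
      case True
      then have s: "0 < s" using x by simp
      show ?thesis unfolding conv_deriv_def using s
        by (simp only: if_True integral_scaleR_right[symmetric] scaleR_scaleR)
    qed (simp add: wker_def)
  qed
  finally show ?thesis using si by blast
qed

end

lemma T_rep_conv:
  assumes p: "1 \<le> p" and \<alpha>: "0 < \<alpha>" and g: "T_rep 1 \<alpha> g v" and f: "T_rep p \<alpha> f u"
  shows "AE t in lborel. 0 < t \<longrightarrow> set_integrable lebesgue {0<..<t} (\<lambda>s. g (t - s) * f s)"
    and "\<exists>h. T_rep p \<alpha> (conv g f) h \<and> Npow p \<alpha> h \<le> ennreal (enn2real (Npow 1 \<alpha> v) powr p * mconst p \<alpha>) * Npow p \<alpha> u"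
proof -
  note v = T_repD(1)[OF g] and u = T_repD(1)[OF f]
  have gv: "AE y in lborel. 0 < y \<longrightarrow> g y = wint \<alpha> v y \<and> wnn \<alpha> (\<lambda>s. ennreal (norm (v s))) y < top"
  proof -
    have "AE y in lborel. 0 < y \<longrightarrow> g y = wint \<alpha> v y" using g \<alpha> by (simp add: T_rep_def)
    moreover have "AE y in lborel. 0 < y \<longrightarrow> wnn \<alpha> (\<lambda>s. ennreal (norm (v s))) y < top"
      using wnn_finite_AE[of 1 0 \<alpha> v] \<alpha> v by simp
    ultimately show ?thesis by eventually_elim auto
  qed
  have fu: "AE y in lborel. 0 < y \<longrightarrow> f y = wint \<alpha> u y \<and> wnn \<alpha> (\<lambda>s. ennreal (norm (u s))) y < top"
  proof -
    have "AE y in lborel. 0 < y \<longrightarrow> f y = wint \<alpha> u y" using f \<alpha> by (simp add: T_rep_def)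
    moreover have "AE y in lborel. 0 < y \<longrightarrow> wnn \<alpha> (\<lambda>s. ennreal (norm (u s))) y < top"
      using wnn_finite_AE[of p 0 \<alpha> u] p \<alpha> u by simp
    ultimately show ?thesis by eventually_elim auto
  qed
  have both: "AE x in lborel. 0 < x \<longrightarrow> set_integrable lebesgue {0<..<x} (\<lambda>s. g (x - s) * f s) \<and> conv g f x = wint \<alpha> (conv_deriv \<alpha> v u) x"
    using conv_major_finite[OF p \<alpha> v u]
  proof eventually_elim
    case (elim x)
    \<comment> \<open>\<open>g\<close> enters at \<open>x - y\<close>, so its exceptional null set
      has to be reflected.\<close>
    have "AE y in lborel. 0 < x + (-1) * y \<longrightarrow> g (x + (-1) * y) = wint \<alpha> v (x + (-1) * y) \<and> wnn \<alpha> (\<lambda>s. ennreal (norm (v s))) (x + (-1) * y) < top"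
      by (rule AE_lborel_affine[OF gv]) simp
    with fu have ae: "AE y in lborel. 0 < y \<longrightarrow> y < x \<longrightarrow> g (x - y) = wint \<alpha> v (x - y) \<and> f y = wint \<alpha> u y
       \<and> wnn \<alpha> (\<lambda>s. ennreal (norm (v s))) (x - y) < top \<and> wnn \<alpha> (\<lambda>s. ennreal (norm (u s))) y < top"
      by eventually_elim auto
    show ?case
      using conv_wint_eq[OF p \<alpha> v u _ _ ae] elim by blast
  qed
  then show "AE t in lborel. 0 < t \<longrightarrow> set_integrable lebesgue {0<..<t} (\<lambda>s. g (t - s) * f s)"
    by eventually_elim auto
  have "AE x in lborel. 0 < x \<longrightarrow> conv g f x = wint \<alpha> (conv_deriv \<alpha> v u) x"
    using both by eventually_elim auto
  then have "T_rep p \<alpha> (conv g f) (conv_deriv \<alpha> v u)"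
    using conv_deriv_wLp[OF p \<alpha> v u] \<alpha> by (simp add: T_rep_def)
  then show "\<exists>h. T_rep p \<alpha> (conv g f) h \<and> Npow p \<alpha> h \<le> ennreal (enn2real (Npow 1 \<alpha> v) powr p * mconst p \<alpha>) * Npow p \<alpha> u"
    using Npow_conv_deriv[OF p \<alpha> v u] by blast
qed

section \<open>Approximate identities\<close>

lemma mollifier_ex:
  assumes e: "0 < \<epsilon>"
  shows "\<exists>\<rho>::real \<Rightarrow> real. (\<forall>t. 0 \<le> \<rho> t) \<and> (\<forall>t. t \<le> 0 \<or> \<epsilon> < t \<longrightarrow> \<rho> t = 0) \<and> integrable lborel \<rho>
    \<and> (LINT t|lborel. \<rho> t) = 1 \<and> (\<lambda>t. complex_of_real (\<rho> t)) \<in> Cc0"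
proof -
  let ?b = "bump (\<epsilon> / 2) \<epsilon>"
  define J where "J = (LINT t|lborel. norm (?b t))"
  have i: "integrable lborel (\<lambda>t. norm (?b t))" and J: "0 < J"
    unfolding J_def using bump_integral[of "\<epsilon> / 2" \<epsilon>] e by auto
  define \<rho> where "\<rho> = (\<lambda>t. norm (?b t) / J)"
  have "(\<lambda>t. complex_of_real (\<rho> t)) = (\<lambda>t. of_real (1 / J) * ?b t)"
    unfolding \<rho>_def fun_eq_iff using bump_eq_norm[of "\<epsilon> / 2" \<epsilon>] by (auto simp: field_simps)
  moreover have "smooth (\<lambda>t. of_real (1 / J) * ?b t)" by (intro smooth_mult smooth_const smooth_bump)
  ultimately have "smooth (\<lambda>t. complex_of_real (\<rho> t))" by simp
  moreover have z: "\<rho> t = 0" if "t < \<epsilon> / 2 \<or> \<epsilon> < t" for t using that by (auto simp: \<rho>_def bump_eq)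
  ultimately have "(\<lambda>t. complex_of_real (\<rho> t)) \<in> Cc0"
    unfolding Cc0_def using e by (intro CollectI conjI exI[of _ "\<epsilon> / 2"] exI[of _ \<epsilon>]) auto
  moreover have "integrable lborel \<rho>" "(LINT t|lborel. \<rho> t) = 1"
    using i J by (auto simp: \<rho>_def J_def[symmetric])
  moreover have "\<forall>t. 0 \<le> \<rho> t" using J by (simp add: \<rho>_def)
  moreover have "\<forall>t. t \<le> 0 \<or> \<epsilon> < t \<longrightarrow> \<rho> t = 0" using z e by auto
  ultimately show ?thesis by blast
qed

text \<open>Convolution over the whole line. It agrees with \<open>conv\<close> for functions that
  vanish on \<open>{..0}\<close>, and being a superposition of translates it commutes with Weyl
  integration.\<close>

definition moll :: "(real \<Rightarrow> real) \<Rightarrow> (real \<Rightarrow> complex) \<Rightarrow> real \<Rightarrow> complex" where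
  "moll \<rho> \<phi> x = (LINT r|lborel. \<rho> r *\<^sub>R \<phi> (x - r))"

lemma measurable_moll [measurable]:
  assumes [measurable]: "\<rho> \<in> borel_measurable borel" "\<phi> \<in> borel_measurable borel"
  shows "moll \<rho> \<phi> \<in> borel_measurable borel"
  unfolding moll_def[abs_def] by measurable

lemma conv_eq_moll:
  assumes [measurable]: "\<rho> \<in> borel_measurable borel" "\<phi> \<in> borel_measurable borel"
    and "\<And>t. t \<le> 0 \<Longrightarrow> \<rho> t = 0" "\<And>t. t \<le> 0 \<Longrightarrow> \<phi> t = 0"
  shows "conv (\<lambda>t. complex_of_real (\<rho> t)) \<phi> x = moll \<rho> \<phi> x"
proof -
  have "conv (\<lambda>t. complex_of_real (\<rho> t)) \<phi> x = (LINT s|lborel. \<rho> (x - s) *\<^sub>R \<phi> s)"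
    unfolding conv_def set_lebesgue_integral_def
  proof (rule lebesgue_borel_version(3))
    show "AE s in lborel. indicator {0<..<x} s *\<^sub>R (complex_of_real (\<rho> (x - s)) * \<phi> s) = \<rho> (x - s) *\<^sub>R \<phi> s"
    proof (intro AE_I2)
      fix s
      show "indicator {0<..<x} s *\<^sub>R (complex_of_real (\<rho> (x - s)) * \<phi> s) = \<rho> (x - s) *\<^sub>R \<phi> s"
        using assms(3)[of "x - s"] assms(4)[of s]
        by (cases "0 < s \<and> s < x") (auto simp: scaleR_conv_of_real not_less)
    qed
  qed measurable
  also have "\<dots> = (LINT r|lborel. \<rho> (x - (x + (-1) * r)) *\<^sub>R \<phi> (x + (-1) * r))"
    by (subst lborel_integral_real_affine[where c="-1" and t=x]) auto
  finally show ?thesis by (simp add: moll_def)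
qed

lemma wint_translate: "wint a h (x - r) = (LINT s|lborel. wker a x s *\<^sub>R h (s - r))"
proof -
  have "wint a h (x - r) = (LINT s|lborel. wker a (x - r) (-r + 1 * s) *\<^sub>R h (-r + 1 * s))"
    unfolding wint_def by (subst lborel_integral_real_affine[where c=1 and t="-r"]) auto
  also have "\<dots> = (LINT s|lborel. wker a x s *\<^sub>R h (s - r))"
    by (intro Bochner_Integration.integral_cong refl) (auto simp: wker_def)
  finally show ?thesis .
qed

text \<open>Weyl integration commutes with translations, so the claim is an exchange of integrals.
  Absolute convergence comes from the bound for \<open>w\<close> and from the vanishing of
  \<open>\<rho>\<close> and \<open>w\<close> far to the right.\<close>

lemma wint_moll:
  assumes a: "0 < a" and \<rho>: "integrable lborel \<rho>" "\<And>t. 0 \<le> \<rho> t" "\<And>t. t \<le> 0 \<or> \<epsilon> < t \<Longrightarrow> \<rho> t = 0"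
    and w [measurable]: "w \<in> borel_measurable borel" and C: "\<And>t. norm (w t) \<le> C" and b: "\<And>t. b < t \<Longrightarrow> w t = 0"
  shows "wint a (moll \<rho> w) x = moll \<rho> (wint a w) x"
proof -
  have [measurable]: "\<rho> \<in> borel_measurable borel" using \<rho>(1) by auto
  have "wint a (moll \<rho> w) x = (LINT s|lborel. LINT r|lborel. (wker a x s * \<rho> r) *\<^sub>R w (s - r))"
    unfolding wint_def moll_def by (simp flip: integral_scaleR_right scaleR_scaleR)
  also have "\<dots> = (LINT r|lborel. LINT s|lborel. (wker a x s * \<rho> r) *\<^sub>R w (s - r))"
  proof (rule lborel_Fubini)
    let ?h = "\<lambda>s. \<integral>\<^sup>+r. ennreal (\<rho> r) * ennreal (norm (w (s - r))) \<partial>lborel"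
    have "(\<integral>\<^sup>+s. \<integral>\<^sup>+r. ennreal (norm ((wker a x s * \<rho> r) *\<^sub>R w (s - r))) \<partial>lborel \<partial>lborel) = wnn a ?h x"
      unfolding wnn_def using a \<rho>(2) by (simp add: nn_integral_cmult[symmetric] abs_mult ennreal_mult' mult.assoc)
    also have "\<dots> < top"
    proof (rule wnn_finite_le_const[OF a])
      fix s
      have "?h s \<le> (\<integral>\<^sup>+r. ennreal (\<rho> r) * ennreal C \<partial>lborel)"
        by (intro nn_integral_mono mult_left_mono ennreal_leI C) auto
      also have "\<dots> = ennreal ((LINT r|lborel. \<rho> r) * C)"
        using \<rho> by (simp add: nn_integral_multc nn_integral_eq_integral ennreal_mult')
      finally show "?h s \<le> ennreal ((LINT r|lborel. \<rho> r) * C)" .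
    next
      fix s assume s: "b + \<epsilon> + 1 \<le> s"
      have z: "ennreal (\<rho> r) * ennreal (norm (w (s - r))) = 0" for r
        using \<rho>(3)[of r] b[of "s - r"] s by (cases "\<epsilon> < r") auto
      show "?h s = 0" unfolding z by simp
    qed
    finally show "(\<integral>\<^sup>+s. \<integral>\<^sup>+r. ennreal (norm ((wker a x s * \<rho> r) *\<^sub>R w (s - r))) \<partial>lborel \<partial>lborel) < top" .
  qed measurable
  also have "\<dots> = (LINT r|lborel. \<rho> r *\<^sub>R (LINT s|lborel. wker a x s *\<^sub>R w (s - r)))"
    by (simp flip: integral_scaleR_right add: mult.commute)
  also have "\<dots> = moll \<rho> (wint a w) x"
    unfolding moll_def wint_translate ..
  finally show ?thesis .
qed

lemma moll_close:
  assumes \<rho>: "integrable lborel \<rho>" "\<And>t. 0 \<le> \<rho> t" "\<And>t. t \<le> 0 \<or> \<epsilon> < t \<Longrightarrow> \<rho> t = 0" "(LINT t|lborel. \<rho> t) = 1"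
    and w [measurable]: "w \<in> borel_measurable borel" and C: "\<And>t. norm (w t) \<le> C"
    and \<eta>: "\<And>r. 0 < r \<Longrightarrow> r \<le> \<epsilon> \<Longrightarrow> norm (w (x - r) - w x) \<le> \<eta>"
  shows "norm (moll \<rho> w x - w x) \<le> \<eta>"
proof -
  have [measurable]: "\<rho> \<in> borel_measurable borel" using \<rho>(1) by auto
  have i: "integrable lborel (\<lambda>r. \<rho> r *\<^sub>R w (x - r))"
  proof (rule Bochner_Integration.integrable_bound)
    show "integrable lborel (\<lambda>r. \<rho> r * C)" using \<rho>(1) by simp
    show "AE r in lborel. norm (\<rho> r *\<^sub>R w (x - r)) \<le> norm (\<rho> r * C)"
      using \<rho>(2) C order_trans[OF norm_ge_zero C] by (intro AE_I2) (simp add: abs_mult mult_left_mono)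
  qed measurable
  have i2: "integrable lborel (\<lambda>r. \<rho> r *\<^sub>R w x)" using \<rho>(1) by simp
  have "w x = (LINT r|lborel. \<rho> r *\<^sub>R w x)" by (simp add: integral_scaleR_const \<rho>(4))
  then have "moll \<rho> w x - w x = (LINT r|lborel. \<rho> r *\<^sub>R w (x - r)) - (LINT r|lborel. \<rho> r *\<^sub>R w x)" by (simp add: moll_def)
  also have "\<dots> = (LINT r|lborel. \<rho> r *\<^sub>R (w (x - r) - w x))"
    using i i2 by (simp add: scaleR_diff_right)
  also have "norm \<dots> \<le> (LINT r|lborel. norm (\<rho> r *\<^sub>R (w (x - r) - w x)))" by (rule integral_norm_bound)
  also have "\<dots> \<le> (LINT r|lborel. \<rho> r * \<eta>)"
  proof (rule integral_mono)
    show "integrable lborel (\<lambda>r. norm (\<rho> r *\<^sub>R (w (x - r) - w x)))"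
      using i i2 by (intro integrable_norm) (simp add: scaleR_diff_right)
    show "norm (\<rho> r *\<^sub>R (w (x - r) - w x)) \<le> \<rho> r * \<eta>" for r
      using \<rho>(2)[of r] \<rho>(3)[of r] \<eta>[of r] by (cases "0 < r \<and> r \<le> \<epsilon>") (auto intro: mult_left_mono)
  qed (use \<rho>(1) in simp)
  finally show ?thesis using \<rho>(4) by simp
qed

text \<open>At an integer order above \<open>\<alpha>\<close> the representative of the error is
  \<open>moll \<rho> w - w\<close>. It is uniformly small by uniform continuity of \<open>w\<close>
  and lives on a bounded interval, and the smallness is carried down to order
  \<open>\<alpha>\<close>.\<close>

lemma conv_approx_Cc0:
  assumes p: "1 \<le> p" and \<alpha>: "0 < \<alpha>" and f: "f \<in> Cc0" and d: "0 < d"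
  shows "\<exists>g\<in>Cc0. \<exists>z. T_rep p \<alpha> (\<lambda>t. conv g f t - f t) z \<and> Npow p \<alpha> z < d"
proof -
  obtain a b0 where ab0: "0 < a" "\<forall>t. t < a \<or> b0 < t \<longrightarrow> f t = 0" using f by (auto simp: Cc0_def)
  define b where "b = max b0 1"
  have fz: "f t = 0" if "t < a \<or> b < t" for t using ab0 that by (auto simp: b_def)
  have b: "1 \<le> b" by (simp add: b_def)
  have fs: "smooth f" using f by (simp add: Cc0_def)
  have fr: "smooth_right f" by (rule Cc0_smooth_right[OF f])
  obtain n where "\<alpha> < real n" using reals_Archimedean2 by blast
  then have n: "\<alpha> < real (Suc n)" by simp
  define w where "w = (\<lambda>t. (-1) ^ Suc n * (vd ^^ Suc n) f t)"
  have ws: "smooth w" unfolding w_def by (intro smooth_mult smooth_const smooth_vds fs)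
  have wm [measurable]: "w \<in> borel_measurable borel" by (rule smooth_measurable[OF ws])
  have wz: "w t = 0" if "t < a \<or> b < t" for t
  proof -
    have "(vd ^^ Suc n) f t = 0" using that
      by (intro vds_zero_on_open[of "{..<a} \<union> {b<..}"]) (use fz in auto)
    then show ?thesis unfolding w_def by (simp only: mult_zero_right)
  qed
  have wT: "T_rep p (Suc n) f w"
  proof -
    have "(\<lambda>t. if 0 < t then (-1) ^ Suc n * (vd ^^ Suc n) f t else 0) = w"
      using wz ab0(1) unfolding w_def fun_eq_iff by (metis not_less order_le_less_trans)
    then show ?thesis using T_rep_smooth_right[OF p fr, of n] by simp
  qed
  have f_w: "wint (Suc n) w = f" using wint_vds[OF fr, of n] by (simp add: w_def fun_eq_iff del: funpow.simps power_Suc)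
  have cw: "continuous_on S w" for S by (rule smooth_continuous[OF ws])
  obtain C where "\<forall>t\<in>{a..b}. norm (w t) \<le> C"
    using compact_imp_bounded[OF compact_continuous_image[OF cw compact_Icc[of a b]]] by (auto simp: bounded_iff)
  then have C': "norm (w t) \<le> max C 0" for t using wz[of t] by (cases "t < a \<or> b < t") (auto simp: le_max_iff_disj)
  \<comment> \<open>\<open>K * \<eta> powr p\<close> will bound the error at order
    \<open>\<alpha>\<close>: the constant of the descent, the largest weight on the support, and the
    length \<open>b + 1\<close> of the support.\<close>
  define K where "K = weyl_const p \<alpha> (real (Suc n) - \<alpha>) powr p * (((b + 1) powr real (Suc n)) powr p * (b + 1))"
  have K: "0 \<le> K" using b by (simp add: K_def)
  obtain r0 where r0: "0 < r0" "ennreal r0 < d"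
    using ennreal_pos_real_less[OF d] by blast
  define \<eta> where "\<eta> = (r0 / (K + 1)) powr (1 / p)"
  have \<eta>: "0 < \<eta>" using r0 K by (simp add: \<eta>_def)
  \<comment> \<open>The interval extends below 0 because \<open>w\<close> is evaluated at
    \<open>t - r\<close> with \<open>0 < t\<close> and
    \<open>r \<le> \<epsilon> \<le> 1\<close>.\<close>
  have "uniformly_continuous_on {-1..b+1} w" by (intro compact_uniformly_continuous cw) simp
  then obtain \<delta> where \<delta>: "0 < \<delta>" "\<And>x y. x \<in> {-1..b+1} \<Longrightarrow> y \<in> {-1..b+1} \<Longrightarrow> dist y x < \<delta> \<Longrightarrow> dist (w y) (w x) < \<eta>"
    unfolding uniformly_continuous_on_def using \<eta> by blast
  define \<epsilon> where "\<epsilon> = min 1 (\<delta> / 2)"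
  have \<epsilon>: "0 < \<epsilon>" "\<epsilon> \<le> 1" "\<epsilon> < \<delta>" using \<delta>(1) by (auto simp: \<epsilon>_def)
  obtain \<rho> where \<rho>: "\<And>t. 0 \<le> \<rho> t" "\<And>t. t \<le> 0 \<or> \<epsilon> < t \<Longrightarrow> \<rho> t = 0" "integrable lborel \<rho>" "(LINT t|lborel. \<rho> t) = 1" "(\<lambda>t. complex_of_real (\<rho> t)) \<in> Cc0"
    using mollifier_ex[OF \<epsilon>(1)] by blast
  have [measurable]: "\<rho> \<in> borel_measurable borel" using \<rho>(3) by auto
  define D where "D = (\<lambda>t. moll \<rho> w t - w t)"
  have Dm: "D \<in> borel_measurable borel" unfolding D_def by measurable
  have Dz: "D t = 0" if "t \<le> 0 \<or> b + 1 < t" for t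
  proof -
    have z: "\<rho> r *\<^sub>R w (t - r) = 0" for r
      using that \<rho>(2)[of r] wz[of "t - r"] ab0(1) \<epsilon> by (cases "0 < r \<and> r \<le> \<epsilon>") auto
    have "moll \<rho> w t = 0" unfolding moll_def z by simp
    then show ?thesis using wz[of t] that ab0(1) by (auto simp: D_def)
  qed
  have D\<eta>: "norm (D t) \<le> \<eta>" if t: "0 < t" "t \<le> b + 1" for t
    unfolding D_def
  proof (rule moll_close[OF \<rho>(3,1,2,4) wm C'])
    fix r assume "0 < r" "r \<le> \<epsilon>"
    then have "dist (w (t - r)) (w t) < \<eta>" using t \<epsilon> by (intro \<delta>(2)) (auto simp: dist_real_def)
    then show "norm (w (t - r) - w t) \<le> \<eta>" by (simp add: dist_norm)
  qed
  have ND: "Npow p (Suc n) D \<le> ennreal (((b + 1) powr real (Suc n) * \<eta>) powr p * (b + 1))"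
  proof (rule Npow_le_bounded_support[OF p])
    fix t assume "0 < t" "t \<le> b + 1"
    then show "t powr real (Suc n) * norm (D t) \<le> (b + 1) powr real (Suc n) * \<eta>"
      using D\<eta> by (intro mult_mono powr_mono2) auto
  qed (use Dz b \<eta> in auto)
  have Dw: "D \<in> wLp p (Suc n)"
    by (rule wLp_mono_ennreal[OF ND]) (use Dm Dz in auto)
  have cf: "conv (\<lambda>t. complex_of_real (\<rho> t)) f t = wint (Suc n) (moll \<rho> w) t" for t
  proof -
    have "conv (\<lambda>t. complex_of_real (\<rho> t)) f t = moll \<rho> f t"
      by (rule conv_eq_moll) (use \<rho>(2) fz ab0(1) smooth_measurable[OF fs] in auto)
    also have "\<dots> = wint (Suc n) (moll \<rho> w) t"
      unfolding f_w[symmetric]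
      by (rule wint_moll[symmetric, OF _ \<rho>(3,1) _ wm C', where \<epsilon>=\<epsilon> and b=b]) (use \<rho>(2) wz in auto)
    finally show ?thesis .
  qed
  have "(\<lambda>t. D t + w t) \<in> wLp p (Suc n)" by (rule wLp_add[OF p Dw T_repD(1)[OF wT]])
  then have mw: "moll \<rho> w \<in> wLp p (Suc n)" by (simp add: D_def)
  then have "T_rep p (Suc n) (conv (\<lambda>t. complex_of_real (\<rho> t)) f) (moll \<rho> w)"
    using cf by (simp add: T_rep_def)
  from T_rep_diff[OF p _ this wT] have DT: "T_rep p (Suc n) (\<lambda>t. conv (\<lambda>t. complex_of_real (\<rho> t)) f t - f t) D"
    by (simp add: D_def)
  let ?z = "wext (real (Suc n) - \<alpha>) D"
  have "T_rep p \<alpha> (\<lambda>t. conv (\<lambda>t. complex_of_real (\<rho> t)) f t - f t) ?z"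
    using T_rep_lower[OF p less_imp_le[OF \<alpha>] n DT] .
  moreover have "Npow p \<alpha> ?z < d"
  proof -
    have "Npow p \<alpha> ?z \<le> ennreal (weyl_const p \<alpha> (real (Suc n) - \<alpha>) powr p) * Npow p (Suc n) D"
      by (rule wLp_mono_wint(2)[OF p less_imp_le[OF \<alpha>] n Dw])
    also have "\<dots> \<le> ennreal (weyl_const p \<alpha> (real (Suc n) - \<alpha>) powr p) * ennreal (((b + 1) powr real (Suc n) * \<eta>) powr p * (b + 1))"
      by (intro mult_left_mono ND) simp
    also have "\<dots> = ennreal (K * \<eta> powr p)"
      using \<eta> b by (simp add: K_def ennreal_mult'[symmetric] powr_mult mult_ac del: of_nat_Suc)
    also have "K * \<eta> powr p \<le> r0"
      using r0 K p by (simp add: \<eta>_def powr_powr field_simps)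
    finally show ?thesis using r0(2) by (simp add: le_less_trans ennreal_leI)
  qed
  ultimately show ?thesis using \<rho>(5) by blast
qed

section \<open>The spaces and their norms\<close>

lemma T_norm_less:
  assumes p: "1 \<le> p" and \<alpha>: "0 \<le> \<alpha>" and u: "T_rep p \<alpha> f u" and e: "0 < e" "Npow p \<alpha> u < ennreal (e powr p)"
  shows "T_norm p \<alpha> f < e"
proof -
  have "enn2real (Npow p \<alpha> u) < e powr p"
    using e(2) T_repD(4)[OF u] by (metis enn2real_ennreal enn2real_less_iff ennreal_enn2real ennreal_less_iff enn2real_nonneg)
  then have "enn2real (Npow p \<alpha> u) powr (1 / p) < (e powr p) powr (1 / p)"
    using p by (intro powr_less_mono2) auto
  also have "(e powr p) powr (1 / p) = e" using p e by (simp add: powr_powr)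
  finally show ?thesis using T_norm_W_rep(1)[OF p \<alpha> u] by simp
qed

lemma T_norm_le_of_Npow_le:
  assumes p: "1 \<le> p" and u: "T_rep p \<alpha> f u" "0 \<le> \<alpha>" and v: "T_rep p \<beta> g v" "0 \<le> \<beta>"
    and c: "0 \<le> c" and le: "Npow p \<alpha> u \<le> ennreal (c powr p) * Npow p \<beta> v"
  shows "T_norm p \<alpha> f \<le> c * T_norm p \<beta> g"
proof -
  have "enn2real (Npow p \<alpha> u) \<le> enn2real (ennreal (c powr p) * Npow p \<beta> v)"
    using le T_repD(4)[OF v(1)] by (intro enn2real_mono) (auto simp: ennreal_mult_less_top)
  also have "\<dots> = c powr p * enn2real (Npow p \<beta> v)" by (simp add: enn2real_mult)
  finally have "enn2real (Npow p \<alpha> u) powr (1 / p) \<le> (c powr p * enn2real (Npow p \<beta> v)) powr (1 / p)"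
    using p by (intro powr_mono2) auto
  also have "\<dots> = c * enn2real (Npow p \<beta> v) powr (1 / p)"
    using c p by (simp add: powr_mult powr_powr)
  finally show ?thesis using T_norm_W_rep(1)[OF p u(2,1)] T_norm_W_rep(1)[OF p v(2,1)] by simp
qed

lemma Cc_smooth_T_rep:
  assumes p: "1 \<le> p" and \<alpha>: "0 \<le> \<alpha>" and \<phi>: "\<phi> \<in> Cc_smooth"
  shows "\<exists>u. T_rep p \<alpha> \<phi> u"
proof -
  let ?\<phi> = "\<lambda>t. if 0 < t then \<phi> t else 0"
  obtain u where "T_rep p \<alpha> ?\<phi> u"
    using smooth_right_T_rep_ex[OF p Cc0_smooth_right[OF Cc_smooth_restrict[OF \<phi>]] \<alpha>] by blast
  then have "T_rep p \<alpha> \<phi> u" unfolding T_rep_def by (auto elim: eventually_mono)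
  then show ?thesis by blast
qed

lemma T_dense_Cc_smooth:
  assumes p: "1 \<le> p" and \<alpha>: "0 \<le> \<alpha>" shows "T_dense p \<alpha> Cc_smooth"
  unfolding T_dense_def
proof (intro conjI ballI allI impI)
  show "Cc_smooth \<subseteq> T_space p \<alpha>"
    using Cc_smooth_T_rep[OF p \<alpha>] T_space_iff[OF p \<alpha>] by blast
  fix f \<epsilon> assume "f \<in> T_space p \<alpha>" and \<epsilon>: "0 < (\<epsilon>::real)"
  then obtain u where u: "T_rep p \<alpha> f u" using T_space_iff[OF p \<alpha>] by blast
  have "0 < ennreal (\<epsilon> powr p)" using \<epsilon> by simp
  from Cc0_dense_T[OF p \<alpha> u this] obtain d v where d: "d \<in> Cc0" "T_rep p \<alpha> d v" "Npow p \<alpha> (\<lambda>t. u t - v t) < ennreal (\<epsilon> powr p)" by blast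
  have "T_norm p \<alpha> (\<lambda>t. f t - d t) < \<epsilon>"
    by (rule T_norm_less[OF p \<alpha> T_rep_diff[OF p \<alpha> u d(2)] \<epsilon> d(3)])
  then show "\<exists>d\<in>Cc_smooth. T_norm p \<alpha> (\<lambda>t. f t - d t) < \<epsilon>" using d(1) Cc0_subset_Cc_smooth by blast
qed

lemma T_module:
  assumes p: "1 \<le> p" and \<alpha>: "0 < \<alpha>" and g: "g \<in> T_space 1 \<alpha>" and f: "f \<in> T_space p \<alpha>"
  shows "AE t in Rpos. set_integrable lebesgue {0<..<t} (\<lambda>s. g (t - s) * f s)"
    "conv g f \<in> T_space p \<alpha>"
    "T_norm p \<alpha> (conv g f) \<le> mconst p \<alpha> powr (1 / p) * T_norm 1 \<alpha> g * T_norm p \<alpha> f"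
proof -
  note \<alpha>0 = less_imp_le[OF \<alpha>]
  obtain v where v: "T_rep 1 \<alpha> g v" using g T_space_iff[OF _ \<alpha>0] by auto
  obtain u where u: "T_rep p \<alpha> f u" using f T_space_iff[OF p \<alpha>0] by auto
  show "AE t in Rpos. set_integrable lebesgue {0<..<t} (\<lambda>s. g (t - s) * f s)"
    unfolding AE_Rpos_iff by (rule T_rep_conv(1)[OF p \<alpha> v u])
  obtain h where h: "T_rep p \<alpha> (conv g f) h" "Npow p \<alpha> h \<le> ennreal (enn2real (Npow 1 \<alpha> v) powr p * mconst p \<alpha>) * Npow p \<alpha> u"
    using T_rep_conv(2)[OF p \<alpha> v u] by blast
  show "conv g f \<in> T_space p \<alpha>" using h(1) T_space_iff[OF p \<alpha>0] by blast
  have m: "0 \<le> mconst p \<alpha>" by (simp add: mconst_def)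
  have "(mconst p \<alpha> powr (1 / p) * enn2real (Npow 1 \<alpha> v)) powr p = enn2real (Npow 1 \<alpha> v) powr p * mconst p \<alpha>"
    using p m by (simp add: powr_mult powr_powr)
  with h(2) have "Npow p \<alpha> h \<le> ennreal ((mconst p \<alpha> powr (1 / p) * enn2real (Npow 1 \<alpha> v)) powr p) * Npow p \<alpha> u" by simp
  from T_norm_le_of_Npow_le[OF p h(1) \<alpha>0 u \<alpha>0 _ this]
  show "T_norm p \<alpha> (conv g f) \<le> mconst p \<alpha> powr (1 / p) * T_norm 1 \<alpha> g * T_norm p \<alpha> f"
    using T_norm_W_rep(1)[OF _ \<alpha>0 v] by simp
qed

text \<open>Convolutions of two test functions already suffice: \<open>d\<close> approximates
  \<open>f\<close>, and \<open>conv g d\<close> with a mollifier \<open>g\<close> approximates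
  \<open>d\<close>.\<close>

lemma T_dense_conv:
  assumes p: "1 \<le> p" and \<alpha>: "0 < \<alpha>"
  shows "T_dense p \<alpha> {conv g f | g f. g \<in> T_space 1 \<alpha> \<and> f \<in> T_space p \<alpha>}"
  unfolding T_dense_def
proof (intro conjI ballI allI impI)
  note \<alpha>0 = less_imp_le[OF \<alpha>]
  show "{conv g f | g f. g \<in> T_space 1 \<alpha> \<and> f \<in> T_space p \<alpha>} \<subseteq> T_space p \<alpha>"
    using T_module(2)[OF p \<alpha>] by blast
  fix f \<epsilon> assume "f \<in> T_space p \<alpha>" and \<epsilon>: "0 < (\<epsilon>::real)"
  then obtain u where u: "T_rep p \<alpha> f u" using T_space_iff[OF p \<alpha>0] by blast
  have "0 < ennreal (\<epsilon> powr p)" using \<epsilon> by simp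
  from ennreal_half_split[OF this] obtain \<delta> where \<delta>: "0 < \<delta>" "\<And>x y. x < \<delta> \<Longrightarrow> y < \<delta> \<Longrightarrow> ennreal (2 powr p) * (x + y) < ennreal (\<epsilon> powr p)" by blast
  obtain d v where d: "d \<in> Cc0" "T_rep p \<alpha> d v" "Npow p \<alpha> (\<lambda>t. u t - v t) < \<delta>"
    using Cc0_dense_T[OF p \<alpha>0 u \<delta>(1)] by blast
  obtain g z where g: "g \<in> Cc0" "T_rep p \<alpha> (\<lambda>t. conv g d t - d t) z" "Npow p \<alpha> z < \<delta>"
    using conv_approx_Cc0[OF p \<alpha> d(1) \<delta>(1)] by blast
  note [measurable] = T_repD(2)[OF u] T_repD(2)[OF d(2)] T_repD(2)[OF g(2)]
  have r: "T_rep p \<alpha> (\<lambda>t. f t - conv g d t) (\<lambda>t. (u t - v t) - z t)"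
    using T_rep_diff[OF p \<alpha>0 T_rep_diff[OF p \<alpha>0 u d(2)] g(2)] by simp
  have "Npow p \<alpha> (\<lambda>t. (u t - v t) - z t) \<le> ennreal (2 powr p) * (Npow p \<alpha> (\<lambda>t. u t - v t) + Npow p \<alpha> z)"
    using Npow_add_le[OF p, of "\<lambda>t. u t - v t" "\<lambda>t. - z t" \<alpha>] by simp
  also have "\<dots> < ennreal (\<epsilon> powr p)" by (rule \<delta>(2)[OF d(3) g(3)])
  finally have "T_norm p \<alpha> (\<lambda>t. f t - conv g d t) < \<epsilon>" by (rule T_norm_less[OF p \<alpha>0 r \<epsilon>])
  moreover have "g \<in> T_space 1 \<alpha>"
    using Cc_smooth_T_rep[OF _ \<alpha>0, of 1 g] g(1) Cc0_subset_Cc_smooth T_space_iff[OF _ \<alpha>0, of 1 g] by auto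
  moreover have "d \<in> T_space p \<alpha>" using d(2) T_space_iff[OF p \<alpha>0] by blast
  ultimately show "\<exists>d\<in>{conv g f | g f. g \<in> T_space 1 \<alpha> \<and> f \<in> T_space p \<alpha>}. T_norm p \<alpha> (\<lambda>t. f t - d t) < \<epsilon>"
    by blast
qed

section \<open>Inclusions and derivatives of lower order\<close>

lemma T_inclusion_bound:
  assumes p: "1 \<le> p" and \<alpha>: "0 \<le> \<alpha>" and \<beta>: "\<alpha> < \<beta>" and f: "f \<in> T_space p \<beta>"
  shows "f \<in> T_space p \<alpha>" "T_norm p \<alpha> f \<le> weyl_const p \<alpha> (\<beta> - \<alpha>) * T_norm p \<beta> f"
proof -
  have b: "0 \<le> \<beta>" using \<alpha> \<beta> by simp
  obtain u where u: "T_rep p \<beta> f u" using f T_space_iff[OF p b] by blast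
  have l: "T_rep p \<alpha> f (wext (\<beta> - \<alpha>) u)" by (rule T_rep_lower[OF p \<alpha> \<beta> u])
  then show "f \<in> T_space p \<alpha>" using T_space_iff[OF p \<alpha>] by blast
  have "0 < \<alpha> + 1 / p" using p \<alpha> by (simp add: add_nonneg_pos)
  then have "0 \<le> weyl_const p \<alpha> (\<beta> - \<alpha>)" using \<beta> by (intro weyl_const_nonneg) auto
  then show "T_norm p \<alpha> f \<le> weyl_const p \<alpha> (\<beta> - \<alpha>) * T_norm p \<beta> f"
    using wLp_mono_wint(2)[OF p \<alpha> \<beta> T_repD(1)[OF u]] by (intro T_norm_le_of_Npow_le[OF p l \<alpha> u b])
qed

lemma T_norm_nonneg:
  assumes p: "1 \<le> p" and \<alpha>: "0 \<le> \<alpha>" and f: "f \<in> T_space p \<alpha>" shows "0 \<le> T_norm p \<alpha> f"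
proof -
  obtain u where u: "T_rep p \<alpha> f u" using f T_space_iff[OF p \<alpha>] by blast
  show ?thesis using T_norm_W_rep(1)[OF p \<alpha> u] by simp
qed

lemma T_continuous_inclusion:
  assumes p: "1 \<le> p" and \<alpha>: "0 \<le> \<alpha>" and \<beta>: "\<alpha> < \<beta>"
  shows "continuous_inclusion (T_space p \<beta>) (T_norm p \<beta>) (T_space p \<alpha>) (T_norm p \<alpha>)"
  unfolding continuous_inclusion_def using T_inclusion_bound[OF p \<alpha> \<beta>] by blast

lemma T_continuous_inclusion_Lp:
  assumes p: "1 \<le> p" and \<alpha>: "0 \<le> \<alpha>"
  shows "continuous_inclusion (T_space p \<alpha>) (T_norm p \<alpha>) (Lp p) (Lp_norm p)"
proof (cases "\<alpha> = 0")
  case True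
  then show ?thesis unfolding continuous_inclusion_def by (auto simp: T_space_def T_norm_def intro: exI[of _ 1])
next
  case False
  then have "continuous_inclusion (T_space p \<alpha>) (T_norm p \<alpha>) (T_space p 0) (T_norm p 0)"
    using \<alpha> by (intro T_continuous_inclusion[OF p]) auto
  then show ?thesis by (simp add: continuous_inclusion_def T_space_def T_norm_def)
qed

text \<open>By \<open>T_rep_lower\<close> the derivative of lower order is the Weyl integral of the
  Borel representative \<open>u\<close>, and by \<open>weyl_borel_version\<close> \<open>u\<close>
  may be exchanged for \<open>W p \<beta> f\<close> under the integral.\<close>

lemma W_eq_weyl_integral:
  assumes p: "1 \<le> p" and \<alpha>: "0 \<le> \<alpha>" and \<beta>: "\<alpha> < \<beta>" and f: "f \<in> T_space p \<beta>"
  shows "AE t in Rpos. set_integrable lebesgue {t<..} (weyl_integrand (\<beta> - \<alpha>) (W p \<beta> f) t) \<and>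
           W p \<alpha> f t = weyl_integral (\<beta> - \<alpha>) (W p \<beta> f) t"
proof -
  have b: "0 \<le> \<beta>" and ba: "0 < \<beta> - \<alpha>" using \<alpha> \<beta> by auto
  obtain u where u: "T_rep p \<beta> f u" using f T_space_iff[OF p b] by blast
  note l = T_rep_lower[OF p \<alpha> \<beta> u]
  note Wb = T_norm_W_rep(2)[OF p b u]
  have "AE t in lborel. 0 < t \<longrightarrow> W p \<alpha> f t = wext (\<beta> - \<alpha>) u t"
    using T_norm_W_rep(2)[OF p \<alpha> l] by (simp add: borel_version_def)
  moreover have "AE t in lborel. 0 < t \<longrightarrow> wnn (\<beta> - \<alpha>) (\<lambda>s. ennreal (norm (u s))) t < top"
    using wnn_finite_AE[of p \<alpha> "\<beta> - \<alpha>" u] p \<alpha> \<beta> T_repD(1)[OF u] by (simp add: add_nonneg_pos)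
  ultimately have "AE t in lborel. 0 < t \<longrightarrow> set_integrable lebesgue {t<..} (weyl_integrand (\<beta> - \<alpha>) (W p \<beta> f) t) \<and>
           W p \<alpha> f t = weyl_integral (\<beta> - \<alpha>) (W p \<beta> f) t"
  proof eventually_elim
    case (elim t)
    then show ?case by (auto simp: weyl_borel_version[OF Wb ba] wext_def)
  qed
  then show ?thesis unfolding AE_Rpos_iff .
qed

text \<open>
  Jensen's inequality for the measure \<open>(s - t)\<^bsup>a-1\<^esup> s\<^bsup>-b\<^esup> ds\<close> on \<open>{t<..}\<close>, with \<open>a = \<gamma> - 1/p\<close> and
  \<open>b = a + 1/p\<close>, takes the place of Hoelder's inequality; \<open>a > 0\<close> is where \<open>\<gamma> > 1/p\<close> is used.
\<close>

lemma wnn_pointwise_bound: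
  assumes p: "1 \<le> p" and \<alpha>: "0 \<le> \<alpha>" and \<gamma>: "1 / p < \<gamma>"
  shows "\<exists>C>0. \<forall>u t. u \<in> wLp p (\<alpha> + \<gamma>) \<longrightarrow> 0 < t \<longrightarrow>
    epow p (wnn \<gamma> (\<lambda>s. ennreal (norm (u s))) t) \<le> ennreal (C * t powr (- (\<alpha> * p + 1))) * Npow p (\<alpha> + \<gamma>) u"
proof -
  let ?e = "- (\<alpha> * p + 1) + (1 - 1 / p)" and ?N = "\<lambda>u s. s powr (\<alpha> + \<gamma>) * norm (u s :: complex)"
  define a where "a = \<gamma> - 1 / p"
  have a: "0 < a" using \<gamma> by (simp add: a_def)
  have g0: "0 < \<gamma>" using \<gamma> p by (meson less_trans zero_less_divide_1_iff less_le_trans zero_less_one)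
  define b where "b = a + 1 / p"
  have ab: "a < b" using p by (simp add: b_def)
  define A where "A = Gamma (b - a) / Gamma b"
  have A: "0 < A" using a ab by (simp add: A_def Gamma_real_pos)
  define B where "B = Gamma a / Gamma \<gamma>"
  let ?B = "B powr p / Gamma a"
  have B: "0 < B" using a g0 by (simp add: B_def Gamma_real_pos)
  have main: "epow p (wnn \<gamma> (\<lambda>s. ennreal (norm (u s))) t) \<le> ennreal (A powr (p - 1) * (?B) * t powr (- (\<alpha> * p + 1))) * Npow p (\<alpha> + \<gamma>) u"
    if u: "u \<in> wLp p (\<alpha> + \<gamma>)" and t: "0 < t" for u t
  proof -
    have [measurable]: "u \<in> borel_measurable borel" using u by (simp add: wLp_def)
    \<comment> \<open>The integrand is split into a density \<open>m\<close>, whose total mass is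
      known from \<open>wker_power_to_infinity\<close>, and the remaining factor \<open>k\<close>;
      the constant \<open>B\<close> corrects \<open>Gamma a\<close> to
      \<open>Gamma \<gamma>\<close>.\<close>
    define m where "m = (\<lambda>s. ennreal (wker a t s * s powr (- b)))"
    define k where "k = (\<lambda>s. B * ((s - t) powr (\<gamma> - a)) * s powr b * norm (u s))"
    have k0: "0 \<le> k s" for s using B by (simp add: k_def)
    have [measurable]: "m \<in> borel_measurable lborel" "(\<lambda>s. ennreal (k s)) \<in> borel_measurable lborel" unfolding m_def k_def by measurable
    have "wnn \<gamma> (\<lambda>s. ennreal (norm (u s))) t = (\<integral>\<^sup>+s. m s * ennreal (k s) \<partial>lborel)"
      unfolding wnn_def
    proof (intro nn_integral_cong)
      fix s
      show "ennreal (wker \<gamma> t s) * ennreal (norm (u s)) = m s * ennreal (k s)"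
      proof (cases "t < s")
        case True
        have e1: "(s - t) powr (a - 1) * (s - t) powr (\<gamma> - a) = (s - t) powr (\<gamma> - 1)" by (simp add: powr_add[symmetric])
        have e2: "s powr (- b) * s powr b = 1" using True t by (simp add: powr_add[symmetric])
        have "(wker a t s * s powr (- b)) * k s = ((s - t) powr (a - 1) * (s - t) powr (\<gamma> - a)) * (s powr (- b) * s powr b) * norm (u s) / Gamma \<gamma>"
          using True a by (simp add: wker_def k_def B_def Gamma_real_pos less_imp_neq[symmetric])
        also have "\<dots> = wker \<gamma> t s * norm (u s)" unfolding e1 e2 using True by (simp add: wker_def)
        finally show ?thesis using a g0 k0[of s] unfolding m_def by (simp add: ennreal_mult'[symmetric])
      qed (simp add: wker_def m_def)
    qed
    also have "epow p \<dots> \<le> ennreal ((A * t powr (a - b)) powr (p - 1)) * (\<integral>\<^sup>+s. m s * epow p (ennreal (k s)) \<partial>lborel)"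
    proof (rule nn_integral_jensen[OF p])
      show "0 < A * t powr (a - b)" using A t by simp
      have "(\<integral>\<^sup>+s. m s \<partial>lborel) = (\<integral>\<^sup>+s. ennreal (wker a t s) * ennreal (s powr (- b)) \<partial>lborel)"
        unfolding m_def using a by (simp add: ennreal_mult')
      also have "\<dots> = ennreal (A * t powr (a - b))"
        unfolding A_def by (rule wker_power_to_infinity[OF a ab t])
      finally show "(\<integral>\<^sup>+s. m s \<partial>lborel) \<le> ennreal (A * t powr (a - b))" by simp
    qed auto
    also have "(\<integral>\<^sup>+s. m s * epow p (ennreal (k s)) \<partial>lborel) \<le> (\<integral>\<^sup>+s. ennreal (?B * t powr (?e)) * epow p (ennreal (?N u s)) \<partial>lborel)"
    proof (intro nn_integral_mono)
      fix s
      show "m s * epow p (ennreal (k s)) \<le> ennreal (?B * t powr (?e)) * epow p (ennreal (?N u s))"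
      proof (cases "t < s")
        case True
        then have s: "0 < s" using t by simp
        have ga: "\<gamma> - a = 1 / p" by (simp add: a_def)
        have kp: "k s powr p = B powr p * (s - t) * s powr (b * p) * norm (u s) powr p"
          using B True p s unfolding k_def ga by (simp add: powr_mult powr_powr)
        have "wker a t s * s powr (- b) * k s powr p = (?B) * ((s - t) powr (a - 1) * (s - t)) * (s powr (- b) * s powr (b * p)) * norm (u s) powr p"
          using True unfolding kp by (simp add: wker_def)
        also have "(s - t) powr (a - 1) * (s - t) = (s - t) powr a" using True by (simp add: powr_diff)
        also have "s powr (- b) * s powr (b * p) = s powr (b * p - b)" by (simp add: powr_add[symmetric])
        also have "(?B) * (s - t) powr a * s powr (b * p - b) * norm (u s) powr p
          \<le> (?B) * s powr a * s powr (b * p - b) * norm (u s) powr p"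
          using True t a by (intro mult_right_mono mult_left_mono powr_mono2) (auto simp: Gamma_real_nonneg)
        also have "\<dots> = (?B) * (s powr (?e) * s powr ((\<alpha> + \<gamma>) * p)) * norm (u s) powr p"
        proof -
          have "s powr a * s powr (b * p - b) = s powr (?e) * s powr ((\<alpha> + \<gamma>) * p)"
            using p by (simp add: powr_add[symmetric] b_def a_def algebra_simps)
          then show ?thesis by (simp add: mult.assoc)
        qed
        also have "\<dots> \<le> (?B) * (t powr (?e) * s powr ((\<alpha> + \<gamma>) * p)) * norm (u s) powr p"
        proof -
          \<comment> \<open>The exponent \<open>?e\<close> equals
            \<open>- \<alpha> * p - 1 / p\<close> and is not positive, so on \<open>t < s\<close>
            the leftover power of \<open>s\<close> is at most that of \<open>t\<close>.\<close>
          have "0 \<le> \<alpha> * p" "0 \<le> 1 / p" using p \<alpha> by auto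
          then have "?e \<le> 0" by linarith
          then have "s powr (?e) \<le> t powr (?e)"
            using True t by (intro powr_mono2') auto
          then show ?thesis using a by (intro mult_right_mono mult_left_mono) (auto simp: Gamma_real_nonneg)
        qed
        also have "\<dots> = (?B * t powr (?e)) * (?N u s) powr p"
          by (simp add: powr_mult powr_powr)
        finally have "ennreal (wker a t s * s powr (- b) * k s powr p) \<le> ennreal ((?B * t powr (?e)) * (?N u s) powr p)"
          by (rule ennreal_leI)
        moreover have "m s * epow p (ennreal (k s)) = ennreal (wker a t s * s powr (- b) * k s powr p)"
          unfolding m_def using k0[of s] a by (simp add: ennreal_mult')
        moreover have "ennreal ((?B * t powr (?e)) * (?N u s) powr p)
          = ennreal (?B * t powr (?e)) * epow p (ennreal (?N u s))"
        proof -
          have "0 \<le> ?B * t powr (?e)" using a by (simp add: Gamma_real_nonneg)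
          moreover have "epow p (ennreal (?N u s)) = ennreal ((?N u s) powr p)" by simp
          ultimately show ?thesis by (simp only: ennreal_mult')
        qed
        ultimately show ?thesis by simp
      qed (simp add: m_def wker_def)
    qed
    also have "\<dots> = ennreal (?B * t powr (?e)) * Npow p (\<alpha> + \<gamma>) u"
      unfolding Npow_def by (intro nn_integral_cmult) measurable
    finally have "epow p (wnn \<gamma> (\<lambda>s. ennreal (norm (u s))) t) \<le> ennreal ((A * t powr (a - b)) powr (p - 1)) * (ennreal (?B * t powr (?e)) * Npow p (\<alpha> + \<gamma>) u)"
      by (simp add: mult_left_mono)
    also have "\<dots> = ennreal ((A * t powr (a - b)) powr (p - 1) * (?B * t powr (?e))) * Npow p (\<alpha> + \<gamma>) u"
      by (subst ennreal_mult') (auto simp: mult.assoc)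
    also have "(A * t powr (a - b)) powr (p - 1) * (?B * t powr (?e)) = A powr (p - 1) * (?B) * (t powr ((a - b) * (p - 1)) * t powr (?e))"
      by (simp add: powr_mult powr_powr)
    also have "t powr ((a - b) * (p - 1)) * t powr (?e) = t powr (- (\<alpha> * p + 1))"
    proof -
      have "(a - b) * (p - 1) = 1 / p - 1" using p by (simp add: b_def field_simps)
      then have "(a - b) * (p - 1) + (?e) = - (\<alpha> * p + 1)" by linarith
      then show ?thesis unfolding powr_add[symmetric] by (rule arg_cong)
    qed
    finally show ?thesis .
  qed
  moreover have "0 < A powr (p - 1) * (?B)" using A B a by (simp add: Gamma_real_pos)
  ultimately show ?thesis by blast
qed

lemma W_pointwise_bound:
  assumes p: "1 \<le> p" and \<alpha>: "0 \<le> \<alpha>" and \<beta>: "\<alpha> + 1 / p < \<beta>"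
  shows "\<exists>C>0. \<forall>f\<in>T_space p \<beta>. \<forall>t>0.
              set_integrable lebesgue {t<..} (weyl_integrand (\<beta> - \<alpha>) (W p \<beta> f) t) \<and>
              norm (weyl_integral (\<beta> - \<alpha>) (W p \<beta> f) t) \<le> C * t powr (- (\<alpha> + 1 / p)) * T_norm p \<beta> f"
proof -
  have p0: "0 < 1 / p" using p by simp
  have \<gamma>: "1 / p < \<beta> - \<alpha>" and ba: "0 < \<beta> - \<alpha>" and b: "0 \<le> \<beta>" using \<beta> p0 \<alpha> by linarith+
  obtain C where C: "0 < C" "\<And>u t. u \<in> wLp p \<beta> \<Longrightarrow> 0 < t \<Longrightarrow>
    epow p (wnn (\<beta> - \<alpha>) (\<lambda>s. ennreal (norm (u s))) t) \<le> ennreal (C * t powr (- (\<alpha> * p + 1))) * Npow p \<beta> u"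
    using wnn_pointwise_bound[OF p \<alpha> \<gamma>] by auto
  have "set_integrable lebesgue {t<..} (weyl_integrand (\<beta> - \<alpha>) (W p \<beta> f) t) \<and>
      norm (weyl_integral (\<beta> - \<alpha>) (W p \<beta> f) t) \<le> C powr (1 / p) * t powr (- (\<alpha> + 1 / p)) * T_norm p \<beta> f"
    if f: "f \<in> T_space p \<beta>" and t: "0 < t" for f t
  proof -
    obtain u where u: "T_rep p \<beta> f u" using f T_space_iff[OF p b] by blast
    note Wb = T_norm_W_rep(2)[OF p b u] and uw = T_repD(1)[OF u] and N = T_repD(4)[OF u]
    define n where "n = enn2real (Npow p \<beta> u)"
    have n: "Npow p \<beta> u = ennreal n" "0 \<le> n" using N by (auto simp: n_def)
    have bd: "epow p (wnn (\<beta> - \<alpha>) (\<lambda>s. ennreal (norm (u s))) t) \<le> ennreal (C * t powr (- (\<alpha> * p + 1)) * n)"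
      using C(2)[OF uw t] C(1) by (simp add: n ennreal_mult')
    then have "epow p (wnn (\<beta> - \<alpha>) (\<lambda>s. ennreal (norm (u s))) t) < top" by (rule le_less_trans) simp
    then have fin: "wnn (\<beta> - \<alpha>) (\<lambda>s. ennreal (norm (u s))) t < top"
      using epow_eq_top_iff less_top by blast
    let ?y = "norm (wint (\<beta> - \<alpha>) u t)"
    have "epow p (ennreal ?y) \<le> epow p (wnn (\<beta> - \<alpha>) (\<lambda>s. ennreal (norm (u s))) t)"
      using p ba T_repD(2)[OF u] by (intro epow_mono norm_wint_le) auto
    with bd have "ennreal (?y powr p) \<le> ennreal (C * t powr (- (\<alpha> * p + 1)) * n)" by simp
    then have "?y powr p \<le> C * t powr (- (\<alpha> * p + 1)) * n" using C(1) n(2) by (subst (asm) ennreal_le_iff) auto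
    then have "(?y powr p) powr (1 / p) \<le> (C * t powr (- (\<alpha> * p + 1)) * n) powr (1 / p)"
      using p by (intro powr_mono2) auto
    moreover have "(?y powr p) powr (1 / p) = ?y" using p by (simp add: powr_powr)
    moreover have "(C * t powr (- (\<alpha> * p + 1)) * n) powr (1 / p) = C powr (1 / p) * t powr (- (\<alpha> * p + 1) * (1 / p)) * n powr (1 / p)"
      by (simp only: powr_mult powr_powr)
    moreover have "- (\<alpha> * p + 1) * (1 / p) = - (\<alpha> + 1 / p)" using p by (simp add: field_simps)
    ultimately have "?y \<le> C powr (1 / p) * t powr (- (\<alpha> + 1 / p)) * n powr (1 / p)" by simp
    then show ?thesis using fin weyl_borel_version[OF Wb ba t] T_norm_W_rep(1)[OF p b u] by (simp add: n_def)
  qed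
  moreover have "0 < C powr (1 / p)" using C(1) by simp
  ultimately show ?thesis by blast
qed

section \<open>Characterisation of the spaces and equivalence of norms\<close>

lemma has_W_in_Lp_iff:
  assumes \<nu>: "0 \<le> \<nu>" shows "has_W_in_Lp p \<nu> f \<longleftrightarrow> (\<exists>u. T_rep p \<nu> f u)"
proof
  assume "has_W_in_Lp p \<nu> f"
  then obtain h where h: "h \<in> Lp_weighted p \<nu>" "AE t in Rpos. f t = (if \<nu> = 0 then h t else weyl_integral \<nu> h t)"
    unfolding has_W_in_Lp_def by blast
  obtain h' where h': "borel_version h h'" "h' \<in> wLp p \<nu>" using h(1) unfolding Lp_weighted_iff_borel_version by blast
  have "AE t in lborel. 0 < t \<longrightarrow> f t = (if \<nu> = 0 then h t else weyl_integral \<nu> h t)" using h(2) unfolding AE_Rpos_iff .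
  moreover have "AE t in lborel. 0 < t \<longrightarrow> h t = h' t" using h'(1) by (simp add: borel_version_def)
  ultimately have "AE t in lborel. 0 < t \<longrightarrow> f t = (if \<nu> = 0 then h' t else wint \<nu> h' t)"
  proof eventually_elim
    case (elim t)
    then show ?case using weyl_borel_version(2)[OF h'(1), of \<nu> t] \<nu> by auto
  qed
  then show "\<exists>u. T_rep p \<nu> f u" using h'(2) unfolding T_rep_def by blast
next
  assume "\<exists>u. T_rep p \<nu> f u"
  then obtain u where u: "T_rep p \<nu> f u" by blast
  have bv: "borel_version u u" using T_repD(2,3)[OF u] by (simp add: borel_version_def)
  have "AE t in lborel. 0 < t \<longrightarrow> f t = (if \<nu> = 0 then u t else wint \<nu> u t)" using u by (simp add: T_rep_def)
  then have "AE t in Rpos. f t = (if \<nu> = 0 then u t else weyl_integral \<nu> u t)"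
    unfolding AE_Rpos_iff
  proof eventually_elim
    case (elim t)
    then show ?case using weyl_borel_version(2)[OF bv, of \<nu> t] \<nu> by auto
  qed
  moreover have "u \<in> Lp_weighted p \<nu>" unfolding Lp_weighted_iff_borel_version using bv T_repD(1)[OF u] by blast
  ultimately show "has_W_in_Lp p \<nu> f" unfolding has_W_in_Lp_def by blast
qed

lemma T_space_mono:
  assumes p: "1 \<le> p" and \<nu>: "0 \<le> \<nu>" "\<nu> \<le> \<alpha>" and f: "f \<in> T_space p \<alpha>" shows "f \<in> T_space p \<nu>"
  using T_inclusion_bound(1)[OF p \<nu>(1) _ f] \<nu>(2) f by (cases "\<nu> = \<alpha>") auto

lemma T_space_subset_Lp:
  assumes p: "1 \<le> p" and \<alpha>: "0 \<le> \<alpha>" shows "T_space p \<alpha> \<subseteq> Lp p"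
  using T_continuous_inclusion_Lp[OF assms] by (simp add: continuous_inclusion_def)

lemma T_norm_eq_weighted_Lp_norm:
  assumes p: "1 \<le> p" and \<nu>: "0 \<le> \<nu>" and f: "f \<in> T_space p \<nu>"
  shows "T_norm p \<nu> f = Lp_norm p (\<lambda>t. t powr \<nu> *\<^sub>R W p \<nu> f t)"
proof -
  obtain u where u: "T_rep p \<nu> f u" using f T_space_iff[OF p \<nu>] by blast
  have bv: "borel_version (\<lambda>t. t powr \<nu> *\<^sub>R W p \<nu> f t) (\<lambda>t. t powr \<nu> *\<^sub>R u t)"
    by (rule borel_version_mult[OF T_norm_W_rep(2)[OF p \<nu> u]]) measurable
  have "\<forall>t\<le>0. u t = 0" using T_repD(3)[OF u] by blast
  then show ?thesis unfolding T_norm_W_rep(1)[OF p \<nu> u] Lp_norm_borel_version[OF bv] by (simp add: Npow_weight)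
qed

text \<open>For \<open>\<nu>\<close> in \<open>{0..\<alpha>}\<close> the argument
  \<open>\<nu> + 1 / p\<close> ranges over a compact interval that avoids the poles of Gamma, so the
  numerators of \<open>weyl_const\<close> are bounded; their common denominator is
  \<open>Gamma (\<alpha> + 1 / p)\<close>.\<close>

lemma T_norm_uniform_bound:
  assumes p: "1 \<le> p" and \<alpha>: "0 \<le> \<alpha>"
  shows "\<exists>C>0. \<forall>f\<in>T_space p \<alpha>. \<forall>\<nu>\<in>{0..\<alpha>}. T_norm p \<nu> f \<le> C * T_norm p \<alpha> f"
proof -
  have p0: "0 < 1 / p" using p by simp
  have "continuous_on {0..\<alpha>} (\<lambda>\<nu>. Gamma (\<nu> + 1 / p))"
  proof (intro continuous_at_imp_continuous_on ballI isCont_Gamma continuous_intros)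
    fix x assume "x \<in> {0..\<alpha>}"
    then have "0 < x + 1 / p" using p0 by (intro add_nonneg_pos) auto
    then show "x + 1 / p \<notin> \<int>\<^sub>\<le>\<^sub>0" using nonpos_Ints_nonpos not_le by blast
  qed
  then have "bounded ((\<lambda>\<nu>. Gamma (\<nu> + 1 / p)) ` {0..\<alpha>})"
    by (intro compact_imp_bounded compact_continuous_image) auto
  then obtain K where K: "\<forall>\<nu>\<in>{0..\<alpha>}. \<bar>Gamma (\<nu> + 1 / p)\<bar> \<le> K" by (auto simp: bounded_iff)
  have G: "0 < Gamma (\<alpha> + 1 / p)" using p0 \<alpha> by (intro Gamma_real_pos add_nonneg_pos)
  \<comment> \<open>The maximum with 1 covers \<open>\<nu> = \<alpha>\<close>, to which
    \<open>T_inclusion_bound\<close> does not apply.\<close>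
  define C where "C = max 1 (K / Gamma (\<alpha> + 1 / p))"
  have "T_norm p \<nu> f \<le> C * T_norm p \<alpha> f" if f: "f \<in> T_space p \<alpha>" and \<nu>: "\<nu> \<in> {0..\<alpha>}" for f \<nu>
  proof -
    note T0 = T_norm_nonneg[OF p \<alpha> f]
    show ?thesis
    proof (cases "\<nu> = \<alpha>")
      case True
      have "1 * T_norm p \<alpha> f \<le> C * T_norm p \<alpha> f" using T0 by (intro mult_right_mono) (auto simp: C_def)
      with True show ?thesis by simp
    next
      case False
      then have "T_norm p \<nu> f \<le> weyl_const p \<nu> (\<alpha> - \<nu>) * T_norm p \<alpha> f"
        using \<nu> by (intro T_inclusion_bound(2)[OF p _ _ f]) auto
      also have "weyl_const p \<nu> (\<alpha> - \<nu>) \<le> C"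
      proof -
        have "Gamma (\<nu> + 1 / p) \<le> K" using K \<nu> abs_le_D1 by blast
        then have "Gamma (\<nu> + 1 / p) / Gamma (\<alpha> + 1 / p) \<le> K / Gamma (\<alpha> + 1 / p)" using G by (simp add: divide_right_mono)
        then show ?thesis by (simp add: weyl_const_def C_def)
      qed
      finally show ?thesis using T0 by (simp add: mult_right_mono)
    qed
  qed
  moreover have "0 < C" by (simp add: C_def)
  ultimately show ?thesis by blast
qed

theorem proposition3p2:
  fixes p :: real
  assumes "1 \<le> p"
  shows
    "(\<forall>\<alpha>\<ge>0. T_dense p \<alpha> Cc_smooth)
     \<and>
     (\<forall>\<alpha>>0.
        (\<exists>M. \<forall>g\<in>T_space 1 \<alpha>. \<forall>f\<in>T_space p \<alpha>.
           (AE t in Rpos. set_integrable lebesgue {0<..<t} (\<lambda>s. g (t - s) * f s)) \<and>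
           conv g f \<in> T_space p \<alpha> \<and>
           T_norm p \<alpha> (conv g f) \<le> M * T_norm 1 \<alpha> g * T_norm p \<alpha> f) \<and>
        T_dense p \<alpha> {conv g f | g f. g \<in> T_space 1 \<alpha> \<and> f \<in> T_space p \<alpha>})
     \<and>
     (\<forall>\<alpha> \<beta>. 0 \<le> \<alpha> \<and> \<alpha> < \<beta> \<longrightarrow>
        continuous_inclusion (T_space p \<beta>) (T_norm p \<beta>) (T_space p \<alpha>) (T_norm p \<alpha>) \<and>
        continuous_inclusion (T_space p \<alpha>) (T_norm p \<alpha>) (Lp p) (Lp_norm p) \<and>
        (\<forall>f\<in>T_space p \<beta>. AE t in Rpos.
           set_integrable lebesgue {t<..} (weyl_integrand (\<beta> - \<alpha>) (W p \<beta> f) t) \<and>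
           W p \<alpha> f t = weyl_integral (\<beta> - \<alpha>) (W p \<beta> f) t) \<and>
        (\<beta> > \<alpha> + 1 / p \<longrightarrow>
           (\<exists>C>0. \<forall>f\<in>T_space p \<beta>. \<forall>t>0.
              set_integrable lebesgue {t<..} (weyl_integrand (\<beta> - \<alpha>) (W p \<beta> f) t) \<and>
              norm (weyl_integral (\<beta> - \<alpha>) (W p \<beta> f) t)
                \<le> C * t powr (- (\<alpha> + 1 / p)) * T_norm p \<beta> f)))
     \<and>
     (\<forall>\<alpha>>0.
        T_space p \<alpha> = {f \<in> Lp p. has_W_in_Lp p \<alpha> f} \<and>
        T_space p \<alpha> = {f \<in> Lp p. \<forall>\<nu>. 0 \<le> \<nu> \<and> \<nu> \<le> \<alpha> \<longrightarrow> has_W_in_Lp p \<nu> f} \<and>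
        (\<forall>f\<in>T_space p \<alpha>. \<forall>\<nu>\<in>{0..\<alpha>}. T_norm p \<nu> f = Lp_norm p (\<lambda>t. t powr \<nu> *\<^sub>R W p \<nu> f t)) \<and>
        (\<forall>f\<in>T_space p \<alpha>. bdd_above ((\<lambda>\<nu>. T_norm p \<nu> f) ` {0..\<alpha>})) \<and>
        (\<exists>c>0. \<exists>C>0. \<forall>f\<in>T_space p \<alpha>.
           c * T_norm p \<alpha> f \<le> (SUP \<nu>\<in>{0..\<alpha>}. T_norm p \<nu> f) \<and>
           (SUP \<nu>\<in>{0..\<alpha>}. T_norm p \<nu> f) \<le> C * T_norm p \<alpha> f))"
proof (intro conjI allI impI)
  show "T_dense p \<alpha> Cc_smooth" if "0 \<le> \<alpha>" for \<alpha>
    by (rule T_dense_Cc_smooth[OF assms that])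
next
  fix \<alpha> :: real assume \<alpha>: "0 < \<alpha>"
  show "\<exists>M. \<forall>g\<in>T_space 1 \<alpha>. \<forall>f\<in>T_space p \<alpha>.
           (AE t in Rpos. set_integrable lebesgue {0<..<t} (\<lambda>s. g (t - s) * f s)) \<and>
           conv g f \<in> T_space p \<alpha> \<and>
           T_norm p \<alpha> (conv g f) \<le> M * T_norm 1 \<alpha> g * T_norm p \<alpha> f"
    using T_module[OF assms \<alpha>] by blast
  show "T_dense p \<alpha> {conv g f | g f. g \<in> T_space 1 \<alpha> \<and> f \<in> T_space p \<alpha>}"
    by (rule T_dense_conv[OF assms \<alpha>])
next
  fix \<alpha> \<beta> :: real assume ab: "0 \<le> \<alpha> \<and> \<alpha> < \<beta>"
  then have \<alpha>: "0 \<le> \<alpha>" and \<beta>: "\<alpha> < \<beta>" by auto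
  show "continuous_inclusion (T_space p \<beta>) (T_norm p \<beta>) (T_space p \<alpha>) (T_norm p \<alpha>)"
    by (rule T_continuous_inclusion[OF assms \<alpha> \<beta>])
  show "continuous_inclusion (T_space p \<alpha>) (T_norm p \<alpha>) (Lp p) (Lp_norm p)"
    by (rule T_continuous_inclusion_Lp[OF assms \<alpha>])
  show "\<forall>f\<in>T_space p \<beta>. AE t in Rpos.
           set_integrable lebesgue {t<..} (weyl_integrand (\<beta> - \<alpha>) (W p \<beta> f) t) \<and>
           W p \<alpha> f t = weyl_integral (\<beta> - \<alpha>) (W p \<beta> f) t"
    using W_eq_weyl_integral[OF assms \<alpha> \<beta>] by blast
  show "\<exists>C>0. \<forall>f\<in>T_space p \<beta>. \<forall>t>0.
              set_integrable lebesgue {t<..} (weyl_integrand (\<beta> - \<alpha>) (W p \<beta> f) t) \<and>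
              norm (weyl_integral (\<beta> - \<alpha>) (W p \<beta> f) t)
                \<le> C * t powr (- (\<alpha> + 1 / p)) * T_norm p \<beta> f" if "\<alpha> + 1 / p < \<beta>"
    by (rule W_pointwise_bound[OF assms \<alpha> that])
next
  fix \<alpha> :: real assume a: "0 < \<alpha>"
  then have \<alpha>: "0 \<le> \<alpha>" by simp
  have W_iff: "has_W_in_Lp p \<nu> f \<longleftrightarrow> f \<in> T_space p \<nu>" if "0 \<le> \<nu>" for \<nu> f
    using has_W_in_Lp_iff[OF that] T_space_iff[OF assms that] by blast
  show "T_space p \<alpha> = {f \<in> Lp p. has_W_in_Lp p \<alpha> f}"
    using T_space_subset_Lp[OF assms \<alpha>] W_iff[OF \<alpha>] by blast
  show "T_space p \<alpha> = {f \<in> Lp p. \<forall>\<nu>. 0 \<le> \<nu> \<and> \<nu> \<le> \<alpha> \<longrightarrow> has_W_in_Lp p \<nu> f}"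
    using T_space_subset_Lp[OF assms \<alpha>] W_iff T_space_mono[OF assms] \<alpha> by blast
  show "\<forall>f\<in>T_space p \<alpha>. \<forall>\<nu>\<in>{0..\<alpha>}. T_norm p \<nu> f = Lp_norm p (\<lambda>t. t powr \<nu> *\<^sub>R W p \<nu> f t)"
    by (intro ballI T_norm_eq_weighted_Lp_norm[OF assms]) (auto intro: T_space_mono[OF assms])
  obtain C where C: "0 < C" "\<forall>f\<in>T_space p \<alpha>. \<forall>\<nu>\<in>{0..\<alpha>}. T_norm p \<nu> f \<le> C * T_norm p \<alpha> f"
    using T_norm_uniform_bound[OF assms \<alpha>] by blast
  have bdd: "bdd_above ((\<lambda>\<nu>. T_norm p \<nu> f) ` {0..\<alpha>})" if "f \<in> T_space p \<alpha>" for f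
    using C(2) that by (intro bdd_aboveI2[where M="C * T_norm p \<alpha> f"]) blast
  show "\<forall>f\<in>T_space p \<alpha>. bdd_above ((\<lambda>\<nu>. T_norm p \<nu> f) ` {0..\<alpha>})" by (intro ballI bdd)
  \<comment> \<open>The lower constant is 1 because \<open>\<alpha>\<close> itself is among the
    orders of the supremum.\<close>
  have "1 * T_norm p \<alpha> f \<le> (SUP \<nu>\<in>{0..\<alpha>}. T_norm p \<nu> f) \<and> (SUP \<nu>\<in>{0..\<alpha>}. T_norm p \<nu> f) \<le> C * T_norm p \<alpha> f"
    if f: "f \<in> T_space p \<alpha>" for f
  proof
    show "1 * T_norm p \<alpha> f \<le> (SUP \<nu>\<in>{0..\<alpha>}. T_norm p \<nu> f)"
      using cSUP_upper[OF _ bdd[OF f], of \<alpha>] \<alpha> by simp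
    show "(SUP \<nu>\<in>{0..\<alpha>}. T_norm p \<nu> f) \<le> C * T_norm p \<alpha> f"
      using C(2) f \<alpha> by (intro cSUP_least) auto
  qed
  then show "\<exists>c>0. \<exists>C>0. \<forall>f\<in>T_space p \<alpha>.
           c * T_norm p \<alpha> f \<le> (SUP \<nu>\<in>{0..\<alpha>}. T_norm p \<nu> f) \<and>
           (SUP \<nu>\<in>{0..\<alpha>}. T_norm p \<nu> f) \<le> C * T_norm p \<alpha> f"
    using C(1) by (intro exI[of _ 1] conjI exI[of _ C]) auto
qed

end
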